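(* Let $\dot A$ be a non-negative symmetric Schrödinger operator as described in the context, with deficiency indices $(1,1)$, such that $m_\infty(-0)$ is finite. Then: (1) the function $1/m_\infty(z)$ is a Stieltjes function if and only if $m_\infty(-0)\ge0$; (2) the function $-m_\infty(z)$ is never a Stieltjes function; (3) for $\alpha\in(0,\pi]$, the function $-m_\alpha(z)$ is a Stieltjes function if and only if $0<\frac{1}{m_\infty(-0)}\le\tan\alpha$ (with the conventions $1/0=+\infty$, $\tan(\pi/2)=+\infty$).
   Context: Setting. Let $\ell\ge0$ and let $q$ be a real-valued locally summable function on $[\ell,\infty)$; put $l(y)=-y''+q(x)y$. In $L^2[\ell,\infty)$ let $\dot A$ be the minimal symmetric operator $\dot Ay=l(y)$ with boundary conditions $y(\ell)=y'(\ell)=0$; it is assumed that $\dot A$ has deficiency indices $(1,1)$ and is non-negative: $(\dot Ay,y)\ge0$ for $y\in\mathrm{dom}(\dot A)$. Weyl–Titchmarsh functions. For $z\in\mathbb C\setminus\mathbb R$ let $\varphi_1,\varphi_2$ solve $l(\varphi)=z\varphi$ with $\varphi_1(\ell)=0,\varphi_1'(\ell)=1$, $\varphi_2(\ell)=-1,\varphi_2'(\ell)=0$; $m_\infty(z)$ is the unique number such that $\varphi_2+m_\infty(z)\varphi_1\in L^2[\ell,\infty)$. For $\alpha\in\mathbb R$ put $m_\alpha(z)=\frac{\sin\alpha+m_\infty(z)\cos\alpha}{\cos\alpha-m_\infty(z)\sin\alpha}$. $m_\infty(-0)=\lim_{x\uparrow0}m_\infty(x)$ denotes the limit of $m_\infty$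 at $0$ from the left along the negative real axis. The functions $-m_\infty$, $1/m_\infty$, $-m_\alpha$ are Herglotz–Nevanlinna functions (holomorphic on $\mathbb C\setminus\mathbb R$, $V(\bar z)=\overline{V(z)}$, $\operatorname{Im}V(z)\ge0$ for $\operatorname{Im}z>0$). A Herglotz–Nevanlinna function $V$ is a Stieltjes function if it is holomorphic in $\mathbb C\setminus[0,+\infty)$ and $\operatorname{Im}[zV(z)]/\operatorname{Im}z\ge0$ for $z\in\mathbb C\setminus\mathbb R$. *)

theory Defs
  imports "HOL-Analysis.Analysis" "HOL-Library.Extended_Real"
begin

definition L2_half :: "real \<Rightarrow> (real \<Rightarrow> complex) \<Rightarrow> bool" where
  "L2_half l f \<longleftrightarrow> set_integrable lborel {l..} (\<lambda>x. (cmod (f x))\<^sup>2)"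

definition loc_summable :: "real \<Rightarrow> (real \<Rightarrow> real) \<Rightarrow> bool" where
  "loc_summable l q \<longleftrightarrow> (\<forall>b\<ge>l. set_integrable lborel {l..b} q)"

text \<open>(Caratheodory) solution y of  -y'' + q y = z y  on [l, infinity), with derivative p:
  y and p are locally absolutely continuous, y' = p, p' = (q - z) y a.e.\<close>
definition sol :: "(real \<Rightarrow> real) \<Rightarrow> real \<Rightarrow> complex \<Rightarrow> (real \<Rightarrow> complex) \<Rightarrow> (real \<Rightarrow> complex) \<Rightarrow> bool" where
  "sol q l z y p \<longleftrightarrow>
     (\<forall>b\<ge>l. set_integrable lborel {l..b} p \<and>
             set_integrable lborel {l..b} (\<lambda>t. (complex_of_real (q t) - z) * y t)) \<and>
     (\<forall>x\<ge>l. y x = y l + set_lebesgue_integral lborel {l..x} p) \<and>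
     (\<forall>x\<ge>l. p x = p l + set_lebesgue_integral lborel {l..x} (\<lambda>t. (complex_of_real (q t) - z) * y t))"

text \<open>Deficiency number of the minimal operator at z equals 1: the space of L2 solutions of
  l(y) = z y (= ker(A* - z)) is one-dimensional, i.e. nonzero and not the whole
  (two-dimensional) solution space.\<close>
definition deficiency_one :: "(real \<Rightarrow> real) \<Rightarrow> real \<Rightarrow> complex \<Rightarrow> bool" where
  "deficiency_one q l z \<longleftrightarrow>
     (\<exists>y p. sol q l z y p \<and> L2_half l y \<and> (\<exists>x\<ge>l. y x \<noteq> 0)) \<and>
     \<not> (\<forall>y p. sol q l z y p \<longrightarrow> L2_half l y)"

text \<open>Domain of the minimal operator: y in L2, y, y' locally AC, f = l(y) in L2,
  y(l) = y'(l) = 0.  The pair (y, f) means y in dom and A y = f.\<close>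
definition min_dom :: "(real \<Rightarrow> real) \<Rightarrow> real \<Rightarrow> (real \<Rightarrow> complex) \<Rightarrow> (real \<Rightarrow> complex) \<Rightarrow> bool" where
  "min_dom q l y f \<longleftrightarrow> L2_half l y \<and> L2_half l f \<and>
     (\<exists>p. (\<forall>b\<ge>l. set_integrable lborel {l..b} p \<and>
                  set_integrable lborel {l..b} (\<lambda>t. complex_of_real (q t) * y t - f t)) \<and>
          (\<forall>x\<ge>l. y x = set_lebesgue_integral lborel {l..x} p) \<and>
          (\<forall>x\<ge>l. p x = set_lebesgue_integral lborel {l..x} (\<lambda>t. complex_of_real (q t) * y t - f t)))"

definition min_op_nonneg :: "(real \<Rightarrow> real) \<Rightarrow> real \<Rightarrow> bool" where
  "min_op_nonneg q l \<longleftrightarrow> (\<forall>y f. min_dom q l y f \<longrightarrow>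
      Im (set_lebesgue_integral lborel {l..} (\<lambda>x. f x * cnj (y x))) = 0 \<and>
      Re (set_lebesgue_integral lborel {l..} (\<lambda>x. f x * cnj (y x))) \<ge> 0)"

definition m_inf :: "(real \<Rightarrow> real) \<Rightarrow> real \<Rightarrow> complex \<Rightarrow> complex" where
  "m_inf q l z = (THE m. \<exists>y1 p1 y2 p2.
      sol q l z y1 p1 \<and> y1 l = 0 \<and> p1 l = 1 \<and>
      sol q l z y2 p2 \<and> y2 l = -1 \<and> p2 l = 0 \<and>
      L2_half l (\<lambda>x. y2 x + m * y1 x))"

definition m_alpha :: "(real \<Rightarrow> real) \<Rightarrow> real \<Rightarrow> real \<Rightarrow> complex \<Rightarrow> complex" where
  "m_alpha q l \<alpha> z =
     (complex_of_real (sin \<alpha>) + m_inf q l z * complex_of_real (cos \<alpha>)) /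
     (complex_of_real (cos \<alpha>) - m_inf q l z * complex_of_real (sin \<alpha>))"

definition herglotz :: "(complex \<Rightarrow> complex) \<Rightarrow> bool" where
  "herglotz V \<longleftrightarrow> V holomorphic_on {z. Im z \<noteq> 0} \<and>
     (\<forall>z. Im z \<noteq> 0 \<longrightarrow> V (cnj z) = cnj (V z)) \<and>
     (\<forall>z. Im z > 0 \<longrightarrow> Im (V z) \<ge> 0)"

definition stieltjes :: "(complex \<Rightarrow> complex) \<Rightarrow> bool" where
  "stieltjes V \<longleftrightarrow> herglotz V \<and>
     (\<exists>W. W holomorphic_on (- {z. Im z = 0 \<and> Re z \<ge> 0}) \<and> (\<forall>z. Im z \<noteq> 0 \<longrightarrow> W z = V z)) \<and>
     (\<forall>z. Im z \<noteq> 0 \<longrightarrow> Im (z * V z) / Im z \<ge> 0)"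

definition inv_ext :: "real \<Rightarrow> ereal" where
  "inv_ext M = (if M = 0 then \<infinity> else ereal (1 / M))"

definition tan_ext :: "real \<Rightarrow> ereal" where
  "tan_ext \<alpha> = (if \<alpha> = pi / 2 then \<infinity> else ereal (tan \<alpha>))"

end

theory Submission
  imports Defs
begin

text \<open>The minimal domain imposes no condition at infinity, so non-negativity already makes the
  minimal operator symmetric and the Wronskian of any two functions of the maximal domain vanishes
  at infinity.  Hence solutions in $L^2$ are unique up to a factor, and coercivity of the minimal
  operator off $[0,\infty)$ gives their existence by compactness.  With $u_z$ the solution in $L^2$
  normalised by $u_z(\ell) = -1$, Green's formula reads $m(z) - m(w) = -(z - w)\int u_z u_w$, which
  yields holomorphy of $m = m_\infty$ and $m' = -\int u_x^2 < 0$ on the negative axis.  If $m$ stayed bounded as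
  $x \to -\infty$, the functions $u_x$ would be bounded away from $0$ near $\ell$, so $m' \le -\delta$, a
  contradiction; thus $m(x) \to +\infty$.  Consequently suitably normalised $u_x$ are asymptotically
  negligible in the quadratic form, which is therefore non-negative under the Dirichlet condition.  This excludes
  poles of $m$ on the negative axis, and applied to $u_z - u_x$ with $x \uparrow 0$ it gives
  $\mathrm{Im}(z \overline{m(z)}) / \mathrm{Im}\, z \ge m(-0)$.  All functions in the theorem other than $-m$
  are of the form $k + (1 + k^2)/(m - k)$, and are Stieltjes functions iff $0 \le k \le m(-0)$.\<close>

section \<open>Indefinite integrals\<close>

text \<open>The obstacle is an apparent circle. The limit m(x) -> +oo is used to prove the Dirichlet
  form non-negative, but m is defined at a negative x only if x is not a Dirichlet eigenvalue, and
  it is this non-negativity that excludes such eigenvalues. The way out: two negative Dirichlet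
  eigenfunctions with data (0,1) would differ by an element of the minimal domain with negative
  form, so there is at most one such eigenvalue, m exists on some half-line x < x0, and this is
  enough for the limit. The form inequality is then proved for sums of two solutions in L2, whose
  pairings with u_x are explicit; these sums cover both later applications. The parameter k is cot
  \<alpha>; k = 0 gives 1/m, while -m is the case \<alpha> = pi, where the cotangent is infinite.
  The bound k >= 0 reflects the behaviour far to the left, the bound k <= m(-0) the absence of a
  pole on the negative axis, along which m decreases from +oo to m(-0).\<close>

lemma set_integral_singleton:
  fixes f :: "real \<Rightarrow> 'a::{banach,second_countable_topology}"
  shows "(LINT t:{a}|lborel. f t) = 0"
proof -
  have "AE t in lborel. indicator {a} t *\<^sub>R f t = 0"
    by (rule AE_mp[OF AE_lborel_singleton[of a]]) (auto simp: indicator_def)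
  then show ?thesis
    unfolding set_lebesgue_integral_def by (rule integral_eq_zero_AE)
qed

lemma set_integral_Icc_split:
  fixes f :: "real \<Rightarrow> 'a::{banach,second_countable_topology}"
  assumes "set_integrable lborel {a..c} f" "a \<le> b" "b \<le> c"
  shows "(LINT t:{a..c}|lborel. f t) = (LINT t:{a..b}|lborel. f t) + (LINT t:{b..c}|lborel. f t)"
proof -
  have 1: "set_integrable lborel {a..b} f" "set_integrable lborel {b..c} f"
    using assms by (auto intro: set_integrable_subset[OF assms(1)])
  have eq: "{a..c} = {a..b} \<union> {b..c}" using assms by auto
  have "AE x in lborel. \<not> (x \<in> {a..b} \<and> x \<in> {b..c})"
    by (rule AE_mp[OF AE_lborel_singleton[of b]]) auto
  then show ?thesis unfolding eq
    by (intro set_integral_Un_AE) (use 1 in auto)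
qed

lemma continuous_on_indefinite_integral:
  fixes f :: "real \<Rightarrow> 'a::euclidean_space"
  assumes "set_integrable lborel {a..b} f"
  shows "continuous_on {a..b} (\<lambda>x. LINT t:{a..x}|lborel. f t)"
proof -
  have "continuous_on {a..b} (\<lambda>x. integral {a..x} f)"
    by (rule indefinite_integral_continuous_1) (rule set_borel_integral_eq_integral[OF assms])
  then show ?thesis
    by (rule continuous_on_eq)
      (use assms in \<open>auto intro!: set_borel_integral_eq_integral(2)[symmetric] intro: set_integrable_subset\<close>)
qed

lemma set_integrable_bounded_mult:
  fixes f h :: "real \<Rightarrow> 'a::{real_normed_field,euclidean_space}"
  assumes "set_integrable lborel {a..b} f" "continuous_on {a..b} h"
  shows "set_integrable lborel {a..b} (\<lambda>t. f t * h t)"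
proof -
  obtain B where B: "\<And>t. t \<in> {a..b} \<Longrightarrow> norm (h t) \<le> B"
    using compact_continuous_image[OF assms(2)]
    by (metis bounded_iff compact_Icc compact_imp_bounded image_eqI)
  have m: "set_borel_measurable lborel {a..b} h"
    using set_measurable_continuous_on[OF _ assms(2)] by (simp add: set_borel_measurable_def)
  have "set_integrable lborel {a..b} (\<lambda>t. B * norm (f t))"
    using assms(1) by (intro set_integrable_mult_right) (auto simp: set_integrable_norm)
  then show ?thesis
  proof (rule set_integrable_bound)
    have "(\<lambda>x. (indicator {a..b} x *\<^sub>R f x) * (indicator {a..b} x *\<^sub>R h x)) \<in> borel_measurable lborel"
      using m borel_measurable_integrable[OF assms(1)[unfolded set_integrable_def]]
      unfolding set_borel_measurable_def by (rule borel_measurable_times[rotated])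
    then show "set_borel_measurable lborel {a..b} (\<lambda>t. f t * h t)"
      unfolding set_borel_measurable_def
      by (rule measurable_cong[THEN iffD1, rotated]) (auto simp: indicator_def)
    show "AE x in lborel. x \<in> {a..b} \<longrightarrow> norm (f x * h x) \<le> norm (B * norm (f x))"
    proof (rule AE_I2, rule impI)
      fix x assume x: "x \<in> {a..b}"
      then have "norm (h x) \<le> \<bar>B\<bar>" using B[OF x] by linarith
      then show "norm (f x * h x) \<le> norm (B * norm (f x))"
        using mult_right_mono[of "norm (h x)" "\<bar>B\<bar>" "norm (f x)"]
        by (simp add: norm_mult abs_mult mult.commute)
    qed
  qed
qed

text \<open>The product is an integral over the square, which is split along its diagonal. This is
  integration by parts for densities that are merely integrable.\<close>

lemma set_integral_mult_Icc_Fubini: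
  fixes f h :: "real \<Rightarrow> 'a::{real_normed_field,euclidean_space}"
  assumes f: "set_integrable lborel {a..b} f" and h: "set_integrable lborel {a..b} h"
  shows "(LINT t:{a..b}|lborel. f t) * (LINT t:{a..b}|lborel. h t) =
     (LINT s:{a..b}|lborel. f s * (LINT t:{a..s}|lborel. h t)) +
     (LINT s:{a..b}|lborel. (LINT t:{a..s}|lborel. f t) * h s)"
proof -
  define f' where "f' = (\<lambda>t. indicator {a..b} t *\<^sub>R f t)"
  define h' where "h' = (\<lambda>t. indicator {a..b} t *\<^sub>R h t)"
  have f': "integrable lborel f'" and h': "integrable lborel h'"
    using f h by (auto simp: set_integrable_def f'_def h'_def)
  note [measurable] = borel_measurable_integrable[OF f', simplified] borel_measurable_integrable[OF h', simplified]
  have K: "integrable (lborel \<Otimes>\<^sub>M lborel) (\<lambda>(s, t). f' s * h' t)"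
  proof (rule lborel_pair.Fubini_integrable)
    show "integrable lborel (\<lambda>x. LINT y|lborel. norm (case (x, y) of (s, t) \<Rightarrow> f' s * h' t))"
      using f' h' by (simp add: norm_mult)
    show "AE x in lborel. integrable lborel (\<lambda>y. case (x, y) of (s, t) \<Rightarrow> f' s * h' t)"
      using h' by simp
  qed measurable
  define K1 where "K1 = (\<lambda>z. indicator {z. snd z \<le> fst z} z *\<^sub>R (\<lambda>(s, t). f' s * h' t) z)"
  define K2 where "K2 = (\<lambda>z. indicator {z. fst z < snd z} z *\<^sub>R (\<lambda>(s, t). f' s * h' t) z)"
  have m1: "{z. snd z \<le> fst z} \<in> sets (lborel \<Otimes>\<^sub>M (lborel :: real measure))"
   and m2: "{z. fst z < snd z} \<in> sets ((lborel :: real measure) \<Otimes>\<^sub>M lborel)"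
    unfolding lborel_prod sets_lborel
    by (auto intro!: borel_closed[OF closed_Collect_le] borel_open[OF open_Collect_less] continuous_intros)
  have K1: "integrable (lborel \<Otimes>\<^sub>M lborel) K1" and K2: "integrable (lborel \<Otimes>\<^sub>M lborel) K2"
    unfolding K1_def K2_def using K m1 m2
    by (auto intro!: integrable_mult_indicator)
  have "(LINT t|lborel. f' t) * (LINT t|lborel. h' t) = (LINT s|lborel. (LINT t|lborel. f' s * h' t))"
    using f' h' by simp
  also have "\<dots> = integral\<^sup>L (lborel \<Otimes>\<^sub>M lborel) (\<lambda>(s, t). f' s * h' t)"
    using lborel_pair.integral_fst'[OF K] by simp
  also have "\<dots> = integral\<^sup>L (lborel \<Otimes>\<^sub>M lborel) (\<lambda>z. K1 z + K2 z)"
    by (rule arg_cong[where f="integral\<^sup>L _"]) (auto simp: K1_def K2_def indicator_def fun_eq_iff)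
  also have "\<dots> = integral\<^sup>L (lborel \<Otimes>\<^sub>M lborel) K1 + integral\<^sup>L (lborel \<Otimes>\<^sub>M lborel) K2"
    using K1 K2 by simp
  also have "integral\<^sup>L (lborel \<Otimes>\<^sub>M lborel) K1 = (LINT s|lborel. (LINT t|lborel. K1 (s, t)))"
    using lborel_pair.integral_fst'[OF K1] by simp
  also have "integral\<^sup>L (lborel \<Otimes>\<^sub>M lborel) K2 = (LINT t|lborel. (LINT s|lborel. K2 (s, t)))"
    using lborel_pair.integral_snd[of "\<lambda>s t. K2 (s, t)"] K2 by (simp add: case_prod_eta)
  also have "(LINT s|lborel. (LINT t|lborel. K1 (s, t))) = (LINT s:{a..b}|lborel. f s * (LINT t:{a..s}|lborel. h t))"
    unfolding set_lebesgue_integral_def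
  proof (rule Bochner_Integration.integral_cong)
    fix s :: real
    have "(LINT t|lborel. K1 (s, t)) = (LINT t|lborel. f' s * (indicator {..s} t *\<^sub>R h' t))"
      by (intro Bochner_Integration.integral_cong) (auto simp: K1_def indicator_def)
    also have "\<dots> = f' s * (LINT t|lborel. indicator {..s} t *\<^sub>R h' t)"
      by (rule Bochner_Integration.integral_mult_right) (use h' in \<open>auto intro!: integrable_mult_indicator\<close>)
    also have "\<dots> = indicator {a..b} s *\<^sub>R (f s * (LINT t|lborel. indicator {a..s} t *\<^sub>R h t))"
      by (cases "s \<in> {a..b}") (auto simp: f'_def h'_def indicator_def intro!: disjI2 Bochner_Integration.integral_cong)
    finally show "(LINT t|lborel. K1 (s, t)) = indicator {a..b} s *\<^sub>R (f s * (LINT t|lborel. indicator {a..s} t *\<^sub>R h t))" .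
  qed simp
  also have "(LINT t|lborel. (LINT s|lborel. K2 (s, t))) = (LINT s:{a..b}|lborel. (LINT t:{a..s}|lborel. f t) * h s)"
    unfolding set_lebesgue_integral_def
  proof (rule Bochner_Integration.integral_cong)
    fix s :: real
    have "(LINT t|lborel. K2 (t, s)) = (LINT t|lborel. (indicator {..<s} t *\<^sub>R f' t) * h' s)"
      by (intro Bochner_Integration.integral_cong) (auto simp: K2_def indicator_def)
    also have "\<dots> = (LINT t|lborel. indicator {..<s} t *\<^sub>R f' t) * h' s"
      by (rule Bochner_Integration.integral_mult_left) (use f' in \<open>auto intro!: integrable_mult_indicator\<close>)
    \<comment> \<open>\<open>K2\<close> leaves out the diagonal, which already belongs to
      \<open>K1\<close>; adding the single point s does not change the inner integral.\<close>
    also have "(LINT t|lborel. indicator {..<s} t *\<^sub>R f' t) = (LINT t|lborel. indicator {..s} t *\<^sub>R f' t)"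
      by (intro integral_discrete_difference[where X="{s}"]) (auto simp: indicator_def)
    also have "(LINT t|lborel. indicator {..s} t *\<^sub>R f' t) * h' s = indicator {a..b} s *\<^sub>R ((LINT t|lborel. indicator {a..s} t *\<^sub>R f t) * h s)"
      by (cases "s \<in> {a..b}") (auto simp: f'_def h'_def indicator_def intro!: disjI2 Bochner_Integration.integral_cong)
    finally show "(LINT t|lborel. K2 (t, s)) = indicator {a..b} s *\<^sub>R ((LINT t|lborel. indicator {a..s} t *\<^sub>R f t) * h s)" .
  qed simp
  finally show ?thesis
    by (simp add: set_lebesgue_integral_def f'_def h'_def)
qed

text \<open>Integration by parts for absolutely continuous functions given through their densities,
  so no pointwise derivative is involved. Green's formula consists of two instances.\<close>

lemma product_rule_indefinite_integral:
  fixes f h :: "real \<Rightarrow> 'a::{real_normed_field,euclidean_space}"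
  assumes f: "set_integrable lborel {a..b} f" and h: "set_integrable lborel {a..b} h"
    and F: "\<And>x. x \<in> {a..b} \<Longrightarrow> F x = F0 + (LINT t:{a..x}|lborel. f t)"
    and H: "\<And>x. x \<in> {a..b} \<Longrightarrow> H x = H0 + (LINT t:{a..x}|lborel. h t)"
    and ab: "a \<le> b"
  shows "F b * H b = F0 * H0 + (LINT t:{a..b}|lborel. f t * H t + F t * h t)"
proof -
  let ?I = "\<lambda>u x. LINT t:{a..x}|lborel. u t"
  have 1: "set_integrable lborel {a..b} (\<lambda>t. f t * ?I h t)"
    by (rule set_integrable_bounded_mult[OF f continuous_on_indefinite_integral[OF h]])
  have 2: "set_integrable lborel {a..b} (\<lambda>t. ?I f t * h t)"
    using set_integrable_bounded_mult[OF h continuous_on_indefinite_integral[OF f]] by (simp add: mult.commute)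
  have "(LINT t:{a..b}|lborel. f t * H t + F t * h t)
     = (LINT t:{a..b}|lborel. (f t * H0 + F0 * h t) + (f t * ?I h t + ?I f t * h t))"
    by (rule set_lebesgue_integral_cong) (auto simp: F H algebra_simps)
  also have "\<dots> = (?I f b * H0 + F0 * ?I h b) + (LINT t:{a..b}|lborel. f t * ?I h t) + (LINT t:{a..b}|lborel. ?I f t * h t)"
    using 1 2 f h by simp
  also have "\<dots> = (?I f b * H0 + F0 * ?I h b) + ?I f b * ?I h b"
    using set_integral_mult_Icc_Fubini[OF f h] by simp
  finally show ?thesis using F[of b] H[of b] ab by (simp add: algebra_simps)
qed

lemma
  fixes f :: "'i \<Rightarrow> 'b \<Rightarrow> 'a::{banach,second_countable_topology}"
  assumes "\<And>i. i \<in> I \<Longrightarrow> set_integrable M A (f i)"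
  shows set_integrable_sum: "set_integrable M A (\<lambda>x. \<Sum>i\<in>I. f i x)"
    and set_integral_sum: "(LINT x:A|M. (\<Sum>i\<in>I. f i x)) = (\<Sum>i\<in>I. LINT x:A|M. f i x)"
  using assms unfolding set_integrable_def set_lebesgue_integral_def by (simp_all add: scaleR_sum_right)

text \<open>Integrated form of (G^(n+1))' = (n+1) g G^n, by induction with the product rule. It
  produces the factorials in the estimates of Gronwall and Picard.\<close>

lemma set_integral_mult_power_indefinite:
  fixes g :: "real \<Rightarrow> real"
  assumes g: "set_integrable lborel {a..b} g" and x: "x \<in> {a..b}"
  shows "(LINT t:{a..x}|lborel. g t * (LINT s:{a..t}|lborel. g s) ^ n) = (LINT s:{a..x}|lborel. g s) ^ Suc n / Suc n"
  using x
proof (induction n arbitrary: x)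
  case 0 then show ?case by simp
next
  case (Suc n)
  let ?G = "\<lambda>x. LINT s:{a..x}|lborel. g s"
  have gx: "set_integrable lborel {a..x} g" using g Suc.prems by (auto intro: set_integrable_subset)
  have cG: "continuous_on {a..x} ?G" by (rule continuous_on_indefinite_integral[OF gx])
  have i: "set_integrable lborel {a..x} (\<lambda>t. Suc n * (g t * ?G t ^ n))"
    by (intro set_integrable_mult_right set_integrable_bounded_mult[OF gx] continuous_intros cG)
  have "?G x ^ Suc n * ?G x = 0 * 0 + (LINT t:{a..x}|lborel. Suc n * (g t * ?G t ^ n) * ?G t + ?G t ^ Suc n * g t)"
    using Suc i gx
    by (intro product_rule_indefinite_integral) auto
  also have "(\<lambda>t. Suc n * (g t * ?G t ^ n) * ?G t + ?G t ^ Suc n * g t) = (\<lambda>t. Suc (Suc n) * (g t * ?G t ^ Suc n))"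
    by (auto simp: algebra_simps)
  finally have "?G x ^ Suc (Suc n) = Suc (Suc n) * (LINT t:{a..x}|lborel. g t * ?G t ^ Suc n)"
    by (simp only: set_integral_mult_right power_Suc2[symmetric])
  then show ?case by (simp add: field_simps del: of_nat_Suc power_Suc)
qed

text \<open>Substituting the inequality into itself n times gives A times a partial sum of the
  exponential series, plus a remainder S G^n / n! with S an upper bound of N.\<close>

lemma Gronwall_integral:
  fixes g N :: "real \<Rightarrow> real"
  assumes g: "set_integrable lborel {a..b} g" and g0: "\<And>t. t \<in> {a..b} \<Longrightarrow> 0 \<le> g t"
    and N: "continuous_on {a..b} N"
    and le: "\<And>x. x \<in> {a..b} \<Longrightarrow> N x \<le> A + (LINT t:{a..x}|lborel. g t * N t)"
    and x: "x \<in> {a..b}"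
  shows "N x \<le> A * exp (LINT t:{a..x}|lborel. g t)"
proof -
  let ?G = "\<lambda>x. LINT s:{a..x}|lborel. g s"
  obtain S where S: "\<And>t. t \<in> {a..b} \<Longrightarrow> N t \<le> S"
    using compact_continuous_image[OF N]
    by (metis bounded_iff compact_Icc compact_imp_bounded image_eqI abs_le_D1 real_norm_def)
  have *: "N x \<le> A * (\<Sum>k<n. ?G x ^ k / fact k) + S * (?G x ^ n / fact n)" if "x \<in> {a..b}" for n x
    using that
  proof (induction n arbitrary: x)
    case 0 then show ?case using S by simp
  next
    case (Suc n)
    have gx: "set_integrable lborel {a..x} g" using g Suc.prems by (auto intro: set_integrable_subset)
    have cG: "continuous_on {a..x} ?G" by (rule continuous_on_indefinite_integral[OF gx])
    have cN: "continuous_on {a..x} N" using N Suc.prems by (auto intro: continuous_on_subset)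
    have ig: "set_integrable lborel {a..x} (\<lambda>t. g t * ?G t ^ k)" for k
      by (intro set_integrable_bounded_mult[OF gx] continuous_intros cG)
    have I: "(LINT t:{a..x}|lborel. g t * (?G t ^ k / fact k)) = ?G x ^ Suc k / fact (Suc k)" for k
    proof -
      have "(LINT t:{a..x}|lborel. g t * (?G t ^ k / fact k)) = (LINT t:{a..x}|lborel. g t * ?G t ^ k) / fact k"
        by simp
      also have "\<dots> = ?G x ^ Suc k / Suc k / fact k"
        by (simp only: set_integral_mult_power_indefinite[OF g Suc.prems])
      finally show ?thesis by (simp add: mult.commute del: of_nat_Suc power_Suc)
    qed
    have "N x \<le> A + (LINT t:{a..x}|lborel. g t * N t)" using le Suc.prems by simp
    also have "(LINT t:{a..x}|lborel. g t * N t) \<le>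
       (LINT t:{a..x}|lborel. g t * (A * (\<Sum>k<n. ?G t ^ k / fact k) + S * (?G t ^ n / fact n)))"
      using Suc.prems
      by (intro set_integral_mono set_integrable_bounded_mult[OF gx] continuous_intros cG cN mult_left_mono Suc.IH g0) auto
    also have "\<dots> = (LINT t:{a..x}|lborel. A * (\<Sum>k<n. g t * (?G t ^ k / fact k)) + S * (g t * (?G t ^ n / fact n)))"
      by (simp add: algebra_simps sum_distrib_left)
    also have "\<dots> = A * (\<Sum>k<n. ?G x ^ Suc k / fact (Suc k)) + S * (?G x ^ Suc n / fact (Suc n))"
    proof -
      have ig': "set_integrable lborel {a..x} (\<lambda>t. g t * (?G t ^ k / fact k))" for k
        using set_integrable_divide[OF ig, of k "fact k"] by simp
      have "set_integrable lborel {a..x} (\<lambda>t. A * (\<Sum>k<n. g t * (?G t ^ k / fact k)))"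
        by (intro set_integrable_mult_right set_integrable_sum ig')
      moreover have "set_integrable lborel {a..x} (\<lambda>t. S * (g t * (?G t ^ n / fact n)))"
        by (intro set_integrable_mult_right ig')
      ultimately show ?thesis
        by (simp only: set_integral_add(2) set_integral_mult_right set_integral_sum[OF ig'] I)
    qed
    finally show ?case by (simp add: sum.lessThan_Suc_shift algebra_simps del: sum.lessThan_Suc fact_Suc power_Suc)
  qed
  have 1: "(\<lambda>n. \<Sum>k<n. ?G x ^ k / fact k) \<longlonglongrightarrow> exp (?G x)"
    using exp_converges[of "?G x"] by (simp add: sums_def scaleR_conv_of_real divide_inverse mult.commute)
  have 2: "(\<lambda>n. ?G x ^ n / fact n) \<longlonglongrightarrow> 0"
    using summable_LIMSEQ_zero[OF summable_exp[of "?G x"]] by (simp add: divide_inverse mult.commute)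
  have "(\<lambda>n. A * (\<Sum>k<n. ?G x ^ k / fact k) + S * (?G x ^ n / fact n)) \<longlonglongrightarrow> A * exp (?G x) + S * 0"
    by (intro tendsto_intros 1 2)
  then have "N x \<le> A * exp (?G x) + S * 0"
    by (rule LIMSEQ_le_const) (use *[OF x] in auto)
  then show ?thesis by simp
qed

lemma tendsto_set_integral_uniform_limit:
  fixes w P :: "real \<Rightarrow> 'a::{real_normed_field,euclidean_space}"
  assumes w: "set_integrable lborel {a..b} w"
    and S: "\<And>n. continuous_on {a..b} (S n)"
    and u: "uniform_limit {a..b} S P sequentially"
  shows "(\<lambda>n. LINT t:{a..b}|lborel. w t * S n t) \<longlonglongrightarrow> (LINT t:{a..b}|lborel. w t * P t)"
proof (rule tendstoI)
  fix e :: real assume e: "e > 0"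
  define W where "W = (LINT t:{a..b}|lborel. norm (w t))"
  have wn: "set_integrable lborel {a..b} (\<lambda>t. norm (w t))" using set_integrable_norm[OF w] .
  have W0: "W \<ge> 0" unfolding W_def set_lebesgue_integral_def by (intro Bochner_Integration.integral_nonneg) auto
  have P: "continuous_on {a..b} P"
    by (rule uniform_limit_theorem[OF _ u]) (use S in auto)
  have "\<forall>\<^sub>F n in sequentially. \<forall>t\<in>{a..b}. dist (S n t) (P t) < e / (W + 1)"
    using u e W0 by (simp add: uniform_limit_iff)
  then show "\<forall>\<^sub>F n in sequentially. dist (LINT t:{a..b}|lborel. w t * S n t) (LINT t:{a..b}|lborel. w t * P t) < e"
  proof eventually_elim
    case (elim n)
    have i: "set_integrable lborel {a..b} (\<lambda>t. w t * S n t)" "set_integrable lborel {a..b} (\<lambda>t. w t * P t)"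
      using set_integrable_bounded_mult[OF w] S P by auto
    have i2: "set_integrable lborel {a..b} (\<lambda>t. w t * (S n t - P t))"
      using S P by (intro set_integrable_bounded_mult[OF w] continuous_intros) auto
    have "dist (LINT t:{a..b}|lborel. w t * S n t) (LINT t:{a..b}|lborel. w t * P t)
        = norm (LINT t:{a..b}|lborel. w t * (S n t - P t))"
      unfolding dist_norm using i by (subst set_integral_diff(2)[symmetric]) (auto simp: algebra_simps)
    also have "\<dots> \<le> (LINT t:{a..b}|lborel. norm (w t * (S n t - P t)))"
      by (rule set_integral_norm_bound[OF i2])
    also have "\<dots> \<le> (LINT t:{a..b}|lborel. norm (w t) * (e / (W + 1)))"
      using set_integrable_norm[OF i2] wn elim
      by (intro set_integral_mono) (auto simp: norm_mult dist_norm less_imp_le simp del: times_divide_eq_right intro!: mult_left_mono)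
    also have "\<dots> = W * (e / (W + 1))" by (simp add: W_def)
    also have "\<dots> < e" using e W0 by (simp add: field_simps)
    finally show ?case .
  qed
qed

section \<open>The initial value problem\<close>

text \<open>Index n gives the n-th term of the Picard series, not the n-th iterate: the initial data
  enter in term 0 only, and the solution is the sum over n.\<close>

primrec picard :: "(real \<Rightarrow> real) \<Rightarrow> real \<Rightarrow> complex \<Rightarrow> complex \<Rightarrow> complex \<Rightarrow> nat \<Rightarrow> (real \<Rightarrow> complex) \<times> (real \<Rightarrow> complex)" where
  "picard q l z a b 0 = ((\<lambda>x. a), (\<lambda>x. b))"
| "picard q l z a b (Suc n) =
    ((\<lambda>x. LINT t:{l..x}|lborel. snd (picard q l z a b n) t),
     (\<lambda>x. LINT t:{l..x}|lborel. (of_real (q t) - z) * fst (picard q l z a b n) t))"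

locale schroedinger =
  fixes q :: "real \<Rightarrow> real" and l :: real
  assumes loc: "loc_summable l q"
begin

lemma q_integrable: "set_integrable lborel {l..b} q"
proof (cases "b \<ge> l")
  case True then show ?thesis using loc by (auto simp: loc_summable_def)
qed auto

lemma q_integrable_complex: "set_integrable lborel {l..b} (\<lambda>t. complex_of_real (q t))"
  using integrable_of_real[OF q_integrable[of b, unfolded set_integrable_def], where 'a=complex]
  by (simp add: set_integrable_def scaleR_conv_of_real)

lemma const_integrable: "set_integrable lborel {l..b} (\<lambda>t. c :: 'a::euclidean_space)"
  by (rule borel_integrable_atLeastAtMost') auto

lemma qz_integrable: "set_integrable lborel {l..b} (\<lambda>t. complex_of_real (q t) - z)"
  by (intro set_integral_diff q_integrable_complex const_integrable)

text \<open>Dominates both coefficients, 1 and q - z, of the first order system y' = p, p' = (q - z)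
  y.\<close>

definition weight :: "complex \<Rightarrow> real \<Rightarrow> real" where "weight z t = 1 + \<bar>q t\<bar> + cmod z"
definition weight_int :: "complex \<Rightarrow> real \<Rightarrow> real" where "weight_int z x = (LINT t:{l..x}|lborel. weight z t)"

lemma weight_nonneg: "0 \<le> weight z t" and weight_ge_1: "1 \<le> weight z t"
  by (simp_all add: weight_def)

lemma norm_qz_le: "cmod (of_real (q t) - z) \<le> \<bar>q t\<bar> + cmod z"
  using norm_triangle_ineq4[of "of_real (q t)" z] by simp

lemma weight_integrable: "set_integrable lborel {l..b} (weight z)"
  unfolding weight_def[abs_def]
  by (intro set_integral_add set_integrable_abs q_integrable const_integrable)

lemma weight_int_mono: "x \<le> y \<Longrightarrow> weight_int z x \<le> weight_int z y"
  unfolding set_lebesgue_integral_def weight_int_def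
  using weight_integrable[unfolded set_integrable_def]
  by (intro integral_mono) (auto simp: indicator_def weight_nonneg)

lemma weight_int_nonneg: "0 \<le> weight_int z x"
  unfolding set_lebesgue_integral_def weight_int_def
  by (intro Bochner_Integration.integral_nonneg) (auto simp: indicator_def weight_nonneg)

lemma continuous_on_weight_int: "continuous_on {l..b} (weight_int z)"
  unfolding weight_int_def[abs_def] by (rule continuous_on_indefinite_integral[OF weight_integrable])

lemma weight_weight_int_integral:
  "x \<ge> l \<Longrightarrow> (LINT t:{l..x}|lborel. weight z t * (C * weight_int z t ^ n / fact n)) = C * weight_int z x ^ Suc n / fact (Suc n)"
proof -
  assume x: "x \<ge> l"
  have "(LINT t:{l..x}|lborel. weight z t * (C * weight_int z t ^ n / fact n)) = (LINT t:{l..x}|lborel. C / fact n * (weight z t * weight_int z t ^ n))"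
    by (rule set_lebesgue_integral_cong) auto
  also have "\<dots> = C / fact n * (LINT t:{l..x}|lborel. weight z t * weight_int z t ^ n)"
    by (rule set_integral_mult_right)
  also have "(LINT t:{l..x}|lborel. weight z t * weight_int z t ^ n) = (weight_int z x ^ Suc n / Suc n)"
    unfolding weight_int_def by (rule set_integral_mult_power_indefinite[OF weight_integrable[of x]]) (use x in auto)
  finally show ?thesis by (simp del: of_nat_Suc power_Suc add: mult.commute)
qed

lemma norm_integral_le:
  fixes w u :: "real \<Rightarrow> complex"
  assumes w: "set_integrable lborel {l..x} w" and u: "continuous_on {l..x} u" "continuous_on {l..x} U"
    and le: "\<And>t. t \<in> {l..x} \<Longrightarrow> cmod (w t) \<le> weight z t" "\<And>t. t \<in> {l..x} \<Longrightarrow> cmod (u t) \<le> U t"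
  shows "cmod (LINT t:{l..x}|lborel. w t * u t) \<le> (LINT t:{l..x}|lborel. weight z t * U t)"
proof -
  have i: "set_integrable lborel {l..x} (\<lambda>t. w t * u t)" by (rule set_integrable_bounded_mult[OF w u(1)])
  have "cmod (LINT t:{l..x}|lborel. w t * u t) \<le> (LINT t:{l..x}|lborel. cmod (w t * u t))"
    by (rule set_integral_norm_bound[OF i])
  also have "\<dots> \<le> (LINT t:{l..x}|lborel. weight z t * U t)"
    using le by (intro set_integral_mono set_integrable_norm[OF i] set_integrable_bounded_mult weight_integrable u(2))
      (auto simp: norm_mult weight_nonneg intro!: mult_mono)
  finally show ?thesis .
qed

text \<open>Every step integrates against a coefficient bounded by \<open>weight\<close>, hence the
  factor \<open>weight_int\<close>^n / n!. Continuity is part of the induction because it makes the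
  next integrand integrable.\<close>

lemma picard_bounds:
  assumes "cmod a + cmod b \<le> C"
  shows "continuous_on {l..x} (fst (picard q l z a b n)) \<and> continuous_on {l..x} (snd (picard q l z a b n))
    \<and> (x \<ge> l \<longrightarrow> cmod (fst (picard q l z a b n) x) \<le> C * weight_int z x ^ n / fact n \<and> cmod (snd (picard q l z a b n) x) \<le> C * weight_int z x ^ n / fact n)"
proof (induction n arbitrary: x)
  case 0
  have "cmod a \<le> C" "cmod b \<le> C" using assms norm_ge_zero[of a] norm_ge_zero[of b] by linarith+
  then show ?case by (simp add: continuous_on_const)
next
  case (Suc n)
  have c: "continuous_on {l..x} (fst (picard q l z a b n))" "continuous_on {l..x} (snd (picard q l z a b n))" for x
    using Suc by auto
  have i1: "set_integrable lborel {l..x} (snd (picard q l z a b n))"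
    by (rule borel_integrable_atLeastAtMost'[OF c(2)])
  have i2: "set_integrable lborel {l..x} (\<lambda>t. (of_real (q t) - z) * fst (picard q l z a b n) t)"
    by (rule set_integrable_bounded_mult[OF qz_integrable c(1)])
  have cU: "continuous_on {l..x} (\<lambda>t. C * weight_int z t ^ n / fact n)"
    by (intro continuous_intros continuous_on_weight_int) auto
  have le: "cmod (of_real (q t) - z) \<le> weight z t" for t
    using norm_qz_le[of t z] by (simp add: weight_def)
  have "cmod (LINT t:{l..x}|lborel. 1 * snd (picard q l z a b n) t) \<le> (LINT t:{l..x}|lborel. weight z t * (C * weight_int z t ^ n / fact n))"
    if "x \<ge> l" using Suc by (intro norm_integral_le const_integrable c cU) (auto simp: weight_ge_1)
  moreover have "cmod (LINT t:{l..x}|lborel. (of_real (q t) - z) * fst (picard q l z a b n) t) \<le> (LINT t:{l..x}|lborel. weight z t * (C * weight_int z t ^ n / fact n))"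
    if "x \<ge> l" using Suc le by (intro norm_integral_le qz_integrable c cU) auto
  ultimately have "x \<ge> l \<longrightarrow> cmod (fst (picard q l z a b (Suc n)) x) \<le> C * weight_int z x ^ Suc n / fact (Suc n) \<and> cmod (snd (picard q l z a b (Suc n)) x) \<le> C * weight_int z x ^ Suc n / fact (Suc n)"
    by (simp only: weight_weight_int_integral mult_1 picard.simps fst_conv snd_conv) blast
  then show ?case
    using continuous_on_indefinite_integral[OF i1] continuous_on_indefinite_integral[OF i2] by simp
qed

lemma sol_exists: "\<exists>y p. sol q l z y p \<and> y l = a \<and> p l = b"
proof -
  define Y where "Y = (\<lambda>n. fst (picard q l z a b n))"
  define P where "P = (\<lambda>n. snd (picard q l z a b n))"
  define C where "C = cmod a + cmod b"
  have C0: "C \<ge> 0" by (simp add: C_def)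
  have YS: "Y (Suc n) x = (LINT t:{l..x}|lborel. P n t)"
   and PS: "P (Suc n) x = (LINT t:{l..x}|lborel. (of_real (q t) - z) * Y n t)" for n x
    by (simp_all add: Y_def P_def)
  have cY: "continuous_on {l..x} (Y n)" and cP: "continuous_on {l..x} (P n)" for n x
    using picard_bounds[of a b C] by (auto simp: Y_def P_def C_def)
  have bd: "cmod (Y n t) \<le> C * (weight_int z x ^ n / fact n)" "cmod (P n t) \<le> C * (weight_int z x ^ n / fact n)" if "t \<in> {l..x}" for n t x
  proof -
    have "C * weight_int z t ^ n / fact n \<le> C * (weight_int z x ^ n / fact n)"
      using that C0 weight_int_mono[of t x z] weight_int_nonneg[of z t] by (auto intro!: mult_left_mono power_mono divide_right_mono)
    then show "cmod (Y n t) \<le> C * (weight_int z x ^ n / fact n)" "cmod (P n t) \<le> C * (weight_int z x ^ n / fact n)"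
      using picard_bounds[of a b C t z n] that by (auto simp: Y_def P_def C_def)
  qed
  have sm: "summable (\<lambda>n. C * (weight_int z x ^ n / fact n))" for x
    using summable_exp[of "weight_int z x"] by (intro summable_mult) (simp add: divide_inverse mult.commute)
  define y where "y = (\<lambda>x. \<Sum>n. Y n x)"
  define p where "p = (\<lambda>x. \<Sum>n. P n x)"
  have uY: "uniform_limit {l..x} (\<lambda>n t. \<Sum>i<n. Y i t) y sequentially" for x
    unfolding y_def by (rule Weierstrass_m_test[OF _ sm[of x]]) (use bd in auto)
  have uP: "uniform_limit {l..x} (\<lambda>n t. \<Sum>i<n. P i t) p sequentially" for x
    unfolding p_def by (rule Weierstrass_m_test[OF _ sm[of x]]) (use bd in auto)
  have cy: "continuous_on {l..x} y" and cp: "continuous_on {l..x} p" for x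
    by (rule uniform_limit_theorem[OF _ uY] uniform_limit_theorem[OF _ uP],
        auto intro!: always_eventually continuous_on_sum cY cP)+
  have Ylim: "(\<lambda>n. \<Sum>i<n. Y i x) \<longlonglongrightarrow> y x" and Plim: "(\<lambda>n. \<Sum>i<n. P i x) \<longlonglongrightarrow> p x" if "x \<ge> l" for x
    using tendsto_uniform_limitI[OF uY[of x]] tendsto_uniform_limitI[OF uP[of x]] that by auto
  have 1: "y x = a + (LINT t:{l..x}|lborel. 1 * p t)" if "x \<ge> l" for x
  proof -
    have "(\<lambda>n. a + (LINT t:{l..x}|lborel. 1 * (\<Sum>i<n. P i t))) \<longlonglongrightarrow> a + (LINT t:{l..x}|lborel. 1 * p t)"
      by (intro tendsto_intros tendsto_set_integral_uniform_limit const_integrable uP continuous_on_sum cP)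
    \<comment> \<open>Integrating a partial sum shifts its index by one; the constant a supplies the
      missing term 0.\<close>
    also have "(\<lambda>n. a + (LINT t:{l..x}|lborel. 1 * (\<Sum>i<n. P i t))) = (\<lambda>n. \<Sum>i<Suc n. Y i x)"
    proof
      fix n
      have "(LINT t:{l..x}|lborel. 1 * (\<Sum>i<n. P i t)) = (\<Sum>i<n. LINT t:{l..x}|lborel. P i t)"
        unfolding mult_1 by (rule set_integral_sum[OF borel_integrable_atLeastAtMost'[OF cP]])
      also have "\<dots> = (\<Sum>i<n. Y (Suc i) x)" by (simp only: YS)
      finally show "a + (LINT t:{l..x}|lborel. 1 * (\<Sum>i<n. P i t)) = (\<Sum>i<Suc n. Y i x)"
        by (subst sum.lessThan_Suc_shift) (simp only:, simp add: Y_def)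
    qed
    finally show ?thesis
      by (rule LIMSEQ_unique[OF LIMSEQ_Suc[OF Ylim[OF that]]])
  qed
  have 2: "p x = b + (LINT t:{l..x}|lborel. (of_real (q t) - z) * y t)" if "x \<ge> l" for x
  proof -
    have "(\<lambda>n. b + (LINT t:{l..x}|lborel. (of_real (q t) - z) * (\<Sum>i<n. Y i t))) \<longlonglongrightarrow> b + (LINT t:{l..x}|lborel. (of_real (q t) - z) * y t)"
      by (intro tendsto_intros tendsto_set_integral_uniform_limit qz_integrable uY continuous_on_sum cY)
    also have "(\<lambda>n. b + (LINT t:{l..x}|lborel. (of_real (q t) - z) * (\<Sum>i<n. Y i t))) = (\<lambda>n. \<Sum>i<Suc n. P i x)"
    proof
      fix n
      have "(LINT t:{l..x}|lborel. (of_real (q t) - z) * (\<Sum>i<n. Y i t)) = (\<Sum>i<n. LINT t:{l..x}|lborel. (of_real (q t) - z) * Y i t)"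
        unfolding sum_distrib_left by (rule set_integral_sum[OF set_integrable_bounded_mult[OF qz_integrable cY]])
      also have "\<dots> = (\<Sum>i<n. P (Suc i) x)" by (simp only: PS)
      finally show "b + (LINT t:{l..x}|lborel. (of_real (q t) - z) * (\<Sum>i<n. Y i t)) = (\<Sum>i<Suc n. P i x)"
        by (subst sum.lessThan_Suc_shift) (simp only:, simp add: P_def)
    qed
    finally show ?thesis
      by (rule LIMSEQ_unique[OF LIMSEQ_Suc[OF Plim[OF that]]])
  qed
  have l: "y l = a" "p l = b" using 1[of l] 2[of l] by (simp_all add: set_integral_singleton)
  have "sol q l z y p"
    unfolding sol_def
    using 1 2 l borel_integrable_atLeastAtMost'[OF cp] set_integrable_bounded_mult[OF qz_integrable cy]
    by (simp only: mult_1) blast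
  then show ?thesis using l by blast
qed

section \<open>Uniqueness and continuous dependence of solutions\<close>

lemma solD:
  assumes "sol q l z y p"
  shows "set_integrable lborel {l..b} p"
    "set_integrable lborel {l..b} (\<lambda>t. (of_real (q t) - z) * y t)"
    "x \<ge> l \<Longrightarrow> y x = y l + (LINT t:{l..x}|lborel. p t)"
    "x \<ge> l \<Longrightarrow> p x = p l + (LINT t:{l..x}|lborel. (of_real (q t) - z) * y t)"
proof -
  have *: "\<forall>b\<ge>l. set_integrable lborel {l..b} p \<and> set_integrable lborel {l..b} (\<lambda>t. (of_real (q t) - z) * y t)"
    using assms unfolding sol_def by blast
  show "set_integrable lborel {l..b} p" "set_integrable lborel {l..b} (\<lambda>t. (of_real (q t) - z) * y t)"
    using * by (cases "b \<ge> l"; simp)+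
  show "x \<ge> l \<Longrightarrow> y x = y l + (LINT t:{l..x}|lborel. p t)"
    "x \<ge> l \<Longrightarrow> p x = p l + (LINT t:{l..x}|lborel. (of_real (q t) - z) * y t)"
    using assms unfolding sol_def by blast+
qed

lemma sol_continuous:
  assumes "sol q l z y p"
  shows "continuous_on {l..b} y" "continuous_on {l..b} p"
proof -
  note c = solD(1,2)[OF assms, THEN continuous_on_indefinite_integral]
  have "continuous_on {l..b} (\<lambda>x. y l + (LINT t:{l..x}|lborel. p t))"
       "continuous_on {l..b} (\<lambda>x. p l + (LINT t:{l..x}|lborel. (of_real (q t) - z) * y t))"
    by (intro continuous_intros c)+
  then show "continuous_on {l..b} y" "continuous_on {l..b} p"
    using solD(3,4)[OF assms]
    by (smt (verit, best) atLeastAtMost_iff continuous_on_cong)+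
qed

text \<open>Gronwall for the difference, which solves the equation at z with source (w - z) y'. The
  source is estimated over all of [l,b], so the constant does not depend on x. Equal data and z = w
  give uniqueness; z -> w gives continuity in the parameter.\<close>

lemma sol_stability:
  assumes s: "sol q l z y p" and s': "sol q l w y' p'" and x: "l \<le> x" "x \<le> b"
  shows "cmod (y x - y' x) + cmod (p x - p' x) \<le>
    (cmod (y l - y' l) + cmod (p l - p' l) + cmod (z - w) * (LINT t:{l..b}|lborel. cmod (y' t))) * exp (weight_int z x)"
proof -
  note c = sol_continuous[OF s] sol_continuous[OF s']
  define N where "N = (\<lambda>x. cmod (y x - y' x) + cmod (p x - p' x))"
  define A where "A = cmod (y l - y' l) + cmod (p l - p' l) + cmod (z - w) * (LINT t:{l..b}|lborel. cmod (y' t))"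
  have "N x \<le> A * exp (weight_int z x)"
    unfolding weight_int_def
  proof (rule Gronwall_integral[OF weight_integrable])
    show "continuous_on {l..x} N" unfolding N_def by (intro continuous_intros c)
    show "x \<in> {l..x}" using x by simp
    fix u assume u: "u \<in> {l..x}"
    have i: "set_integrable lborel {l..u} p" "set_integrable lborel {l..u} p'"
      "set_integrable lborel {l..u} (\<lambda>t. (of_real (q t) - z) * y t)"
      "set_integrable lborel {l..u} (\<lambda>t. (of_real (q t) - w) * y' t)"
      using solD(1,2)[OF s] solD(1,2)[OF s'] by auto
    have "y u = y l + (LINT t:{l..u}|lborel. p t)" "y' u = y' l + (LINT t:{l..u}|lborel. p' t)"
      by (rule solD(3)[OF s] solD(3)[OF s'], use u in simp)+
    then have "y u - y' u = (y l - y' l) + (LINT t:{l..u}|lborel. p t - p' t)"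
      using set_integral_diff(2)[OF i(1,2)] by (simp only: add_diff_add)
    then have 1: "cmod (y u - y' u) \<le> cmod (y l - y' l) + (LINT t:{l..u}|lborel. cmod (p t - p' t))"
      using set_integral_norm_bound[OF set_integral_diff(1)[OF i(1,2)]] norm_triangle_ineq[of "y l - y' l" "(LINT t:{l..u}|lborel. p t - p' t)"]
      by simp
    have i3: "set_integrable lborel {l..u} (\<lambda>t. (of_real (q t) - z) * (y t - y' t))"
      by (intro set_integrable_bounded_mult qz_integrable continuous_intros c)
    have i4: "set_integrable lborel {l..u} (\<lambda>t. (w - z) * y' t)"
      by (intro borel_integrable_atLeastAtMost' continuous_intros c)
    have "p u = p l + (LINT t:{l..u}|lborel. (of_real (q t) - z) * y t)"
       "p' u = p' l + (LINT t:{l..u}|lborel. (of_real (q t) - w) * y' t)"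
      by (rule solD(4)[OF s] solD(4)[OF s'], use u in simp)+
    then have "p u - p' u = (p l - p' l) + (LINT t:{l..u}|lborel. (of_real (q t) - z) * y t - (of_real (q t) - w) * y' t)"
      using set_integral_diff(2)[OF i(3,4)] by (simp only: add_diff_add)
    also have "(\<lambda>t. (of_real (q t) - z) * y t - (of_real (q t) - w) * y' t) = (\<lambda>t. (of_real (q t) - z) * (y t - y' t) + (w - z) * y' t)"
      by (simp add: algebra_simps fun_eq_iff)
    finally have "p u - p' u = (p l - p' l) + (LINT t:{l..u}|lborel. (of_real (q t) - z) * (y t - y' t)) + (LINT t:{l..u}|lborel. (w - z) * y' t)"
      using set_integral_add(2)[OF i3 i4] by (simp only: add.assoc)
    then have "cmod (p u - p' u) \<le> cmod (p l - p' l) + cmod (LINT t:{l..u}|lborel. (of_real (q t) - z) * (y t - y' t)) + cmod (LINT t:{l..u}|lborel. (w - z) * y' t)"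
      using norm_triangle_ineq[of "p l - p' l" "LINT t:{l..u}|lborel. (of_real (q t) - z) * (y t - y' t)"]
        norm_triangle_ineq[of "p l - p' l + (LINT t:{l..u}|lborel. (of_real (q t) - z) * (y t - y' t))" "LINT t:{l..u}|lborel. (w - z) * y' t"]
      by (simp only:)
    also have "cmod (LINT t:{l..u}|lborel. (of_real (q t) - z) * (y t - y' t)) \<le> (LINT t:{l..u}|lborel. (\<bar>q t\<bar> + cmod z) * cmod (y t - y' t))"
    proof -
      have "cmod (LINT t:{l..u}|lborel. (of_real (q t) - z) * (y t - y' t)) \<le> (LINT t:{l..u}|lborel. cmod ((of_real (q t) - z) * (y t - y' t)))"
        by (rule set_integral_norm_bound[OF i3])
      also have "\<dots> \<le> (LINT t:{l..u}|lborel. (\<bar>q t\<bar> + cmod z) * cmod (y t - y' t))"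
      proof (intro set_integral_mono set_integrable_norm[OF i3] set_integrable_bounded_mult continuous_intros c set_integral_add set_integrable_abs q_integrable const_integrable)
        show "cmod ((of_real (q t) - z) * (y t - y' t)) \<le> (\<bar>q t\<bar> + cmod z) * cmod (y t - y' t)" for t
          using norm_qz_le by (simp add: norm_mult mult_right_mono)
      qed
      finally show ?thesis .
    qed
    also have "cmod (LINT t:{l..u}|lborel. (w - z) * y' t) \<le> cmod (z - w) * (LINT t:{l..b}|lborel. cmod (y' t))"
    proof -
      have iy: "set_integrable lborel {l..v} (\<lambda>t. cmod (y' t))" for v
        by (intro borel_integrable_atLeastAtMost' continuous_intros c)
      have "cmod (LINT t:{l..u}|lborel. (w - z) * y' t) \<le> (LINT t:{l..u}|lborel. cmod ((w - z) * y' t))"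
        by (rule set_integral_norm_bound[OF i4])
      also have "\<dots> = cmod (z - w) * (LINT t:{l..u}|lborel. cmod (y' t))"
        by (simp add: norm_mult norm_minus_commute)
      also have "(LINT t:{l..u}|lborel. cmod (y' t)) \<le> (LINT t:{l..b}|lborel. cmod (y' t))"
        using iy[of u] iy[of b] u x unfolding set_lebesgue_integral_def set_integrable_def
        by (intro integral_mono) (auto simp: indicator_def)
      finally show ?thesis by (simp add: mult_left_mono)
    qed
    finally have 2: "cmod (p u - p' u) \<le> cmod (p l - p' l) + (LINT t:{l..u}|lborel. (\<bar>q t\<bar> + cmod z) * cmod (y t - y' t)) + cmod (z - w) * (LINT t:{l..b}|lborel. cmod (y' t))"
      by simp
    have j: "set_integrable lborel {l..u} (\<lambda>t. cmod (p t - p' t))" "set_integrable lborel {l..u} (\<lambda>t. (\<bar>q t\<bar> + cmod z) * cmod (y t - y' t))"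
      "set_integrable lborel {l..u} (\<lambda>t. weight z t * N t)"
    proof -
      show "set_integrable lborel {l..u} (\<lambda>t. cmod (p t - p' t))"
        by (intro borel_integrable_atLeastAtMost' continuous_intros c)
      show "set_integrable lborel {l..u} (\<lambda>t. (\<bar>q t\<bar> + cmod z) * cmod (y t - y' t))"
        by (intro set_integrable_bounded_mult continuous_intros c set_integral_add set_integrable_abs q_integrable const_integrable)
      show "set_integrable lborel {l..u} (\<lambda>t. weight z t * N t)"
        unfolding N_def by (intro set_integrable_bounded_mult weight_integrable continuous_intros c)
    qed
    have "(LINT t:{l..u}|lborel. cmod (p t - p' t)) + (LINT t:{l..u}|lborel. (\<bar>q t\<bar> + cmod z) * cmod (y t - y' t))
      = (LINT t:{l..u}|lborel. cmod (p t - p' t) + (\<bar>q t\<bar> + cmod z) * cmod (y t - y' t))"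
      using j by simp
    also have "\<dots> \<le> (LINT t:{l..u}|lborel. weight z t * N t)"
    proof (intro set_integral_mono set_integral_add j)
      fix t
      have "0 \<le> \<bar>q t\<bar> * cmod (p t - p' t)" "0 \<le> cmod z * cmod (p t - p' t)" by auto
      then show "cmod (p t - p' t) + (\<bar>q t\<bar> + cmod z) * cmod (y t - y' t) \<le> weight z t * N t"
        unfolding N_def weight_def by (simp add: algebra_simps)
    qed
    finally show "N u \<le> A + (LINT t:{l..u}|lborel. weight z t * N t)"
      using 1 2 unfolding N_def A_def by linarith
  qed (rule weight_nonneg)
  then show ?thesis unfolding N_def A_def .
qed

lemma sol_unique:
  assumes "sol q l z y p" "sol q l z y' p'" "y l = y' l" "p l = p' l" "x \<ge> l"
  shows "y x = y' x" "p x = p' x"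
proof -
  have "cmod (y x - y' x) + cmod (p x - p' x) \<le> 0"
    using sol_stability[OF assms(1,2,5) order_refl] assms by simp
  then have "cmod (y x - y' x) = 0" "cmod (p x - p' x) = 0"
    using norm_ge_zero[of "y x - y' x"] norm_ge_zero[of "p x - p' x"] by linarith+
  then show "y x = y' x" "p x = p' x" by simp_all
qed

end

section \<open>Square integrable functions\<close>

text \<open>In contrast to \<open>L2_half\<close> this includes measurability of f itself, without
  which a product f g could fail to be integrable.\<close>

definition L2_on :: "real set \<Rightarrow> (real \<Rightarrow> complex) \<Rightarrow> bool" where
  "L2_on S f \<longleftrightarrow> set_borel_measurable lborel S f \<and> set_integrable lborel S (\<lambda>x. (cmod (f x))\<^sup>2)"

definition norm_sq :: "real set \<Rightarrow> (real \<Rightarrow> complex) \<Rightarrow> real" where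
  "norm_sq S f = (LINT x:S|lborel. (cmod (f x))\<^sup>2)"

lemma norm_sq_nonneg: "0 \<le> norm_sq S f"
  unfolding norm_sq_def set_lebesgue_integral_def by (intro Bochner_Integration.integral_nonneg) auto

lemma norm_add_sq_le: "(cmod (a + b))\<^sup>2 \<le> 2 * (cmod a)\<^sup>2 + 2 * (cmod b)\<^sup>2"
proof -
  have "(cmod (a + b))\<^sup>2 \<le> (cmod a + cmod b)\<^sup>2"
    by (intro power_mono norm_triangle_ineq) auto
  also have "\<dots> \<le> 2 * (cmod a)\<^sup>2 + 2 * (cmod b)\<^sup>2"
    using sum_squares_bound[of "cmod a" "cmod b"] by (simp add: power2_sum)
  finally show ?thesis .
qed

lemma set_borel_measurable_add:
  fixes f g :: "_ \<Rightarrow> complex"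
  shows "set_borel_measurable M S f \<Longrightarrow> set_borel_measurable M S g \<Longrightarrow> set_borel_measurable M S (\<lambda>t. f t + g t)"
  unfolding set_borel_measurable_def scaleR_add_right by (rule borel_measurable_add)

lemma set_borel_measurable_mult:
  fixes f g :: "_ \<Rightarrow> complex"
  assumes "set_borel_measurable M S f" "set_borel_measurable M S g"
  shows "set_borel_measurable M S (\<lambda>t. f t * g t)"
proof -
  have "(\<lambda>x. (indicator S x *\<^sub>R f x) * (indicator S x *\<^sub>R g x)) \<in> borel_measurable M"
    using assms unfolding set_borel_measurable_def by (rule borel_measurable_times)
  then show ?thesis unfolding set_borel_measurable_def
    by (rule measurable_cong[THEN iffD1, rotated]) (auto simp: indicator_def)
qed

lemma set_borel_measurable_norm_sq:
  fixes f :: "_ \<Rightarrow> complex"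
  assumes "set_borel_measurable M S f"
  shows "set_borel_measurable M S (\<lambda>t. (cmod (f t))\<^sup>2)"
proof -
  have "(\<lambda>x. (cmod (indicator S x *\<^sub>R f x))\<^sup>2) \<in> borel_measurable M"
    using assms unfolding set_borel_measurable_def by measurable
  then show ?thesis unfolding set_borel_measurable_def
    by (rule measurable_cong[THEN iffD1, rotated]) (auto simp: indicator_def)
qed

lemma L2_on_scale: "L2_on S f \<Longrightarrow> L2_on S (\<lambda>t. c * f t)"
  unfolding L2_on_def
proof safe
  assume "set_borel_measurable lborel S f"
  then have "(\<lambda>x. c * (indicator S x *\<^sub>R f x)) \<in> borel_measurable lborel"
    unfolding set_borel_measurable_def by measurable
  then show "set_borel_measurable lborel S (\<lambda>t. c * f t)"
    by (simp add: set_borel_measurable_def)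
qed (simp add: norm_mult power_mult_distrib)

lemma norm_sq_scale: "norm_sq S (\<lambda>t. c * f t) = (cmod c)\<^sup>2 * norm_sq S f"
  by (simp add: norm_sq_def norm_mult power_mult_distrib)

lemma L2_on_cnj: "L2_on S f \<Longrightarrow> L2_on S (\<lambda>t. cnj (f t))"
  unfolding L2_on_def
proof safe
  assume "set_borel_measurable lborel S f"
  then have "(\<lambda>x. cnj (indicator S x *\<^sub>R f x)) \<in> borel_measurable lborel"
    unfolding set_borel_measurable_def
    by (rule measurable_compose[OF _ borel_measurable_continuous_onI]) (intro continuous_intros)
  then show "set_borel_measurable lborel S (\<lambda>t. cnj (f t))"
    by (simp add: set_borel_measurable_def)
qed simp

lemma norm_sq_cnj: "norm_sq S (\<lambda>t. cnj (f t)) = norm_sq S f"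
  by (simp add: norm_sq_def)

lemma L2_on_add:
  assumes f: "L2_on S f" and g: "L2_on S g"
  shows "L2_on S (\<lambda>t. f t + g t)" "norm_sq S (\<lambda>t. f t + g t) \<le> 2 * norm_sq S f + 2 * norm_sq S g"
proof -
  have m: "set_borel_measurable lborel S (\<lambda>t. f t + g t)"
    using f g by (auto simp: L2_on_def intro: set_borel_measurable_add)
  have i: "set_integrable lborel S (\<lambda>t. 2 * (cmod (f t))\<^sup>2 + 2 * (cmod (g t))\<^sup>2)"
    using f g by (auto simp: L2_on_def)
  have i2: "set_integrable lborel S (\<lambda>t. (cmod (f t + g t))\<^sup>2)"
    by (rule set_integrable_bound[OF i set_borel_measurable_norm_sq[OF m]])
      (use norm_add_sq_le in auto)
  show "L2_on S (\<lambda>t. f t + g t)" using m i2 by (simp add: L2_on_def)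
  have "norm_sq S (\<lambda>t. f t + g t) \<le> (LINT t:S|lborel. 2 * (cmod (f t))\<^sup>2 + 2 * (cmod (g t))\<^sup>2)"
    unfolding norm_sq_def by (intro set_integral_mono i i2 norm_add_sq_le)
  also have "\<dots> = 2 * norm_sq S f + 2 * norm_sq S g"
    using f g by (simp add: L2_on_def norm_sq_def)
  finally show "norm_sq S (\<lambda>t. f t + g t) \<le> 2 * norm_sq S f + 2 * norm_sq S g" .
qed

lemma L2_on_diff:
  assumes f: "L2_on S f" and g: "L2_on S g"
  shows "L2_on S (\<lambda>t. f t - g t)" "norm_sq S (\<lambda>t. f t - g t) \<le> 2 * norm_sq S f + 2 * norm_sq S g"
  using L2_on_add[OF f L2_on_scale[OF g, of "-1"]] norm_sq_scale[of S "-1" g] by simp_all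

lemma L2_on_mult_integrable:
  assumes f: "L2_on S f" and g: "L2_on S g"
  shows "set_integrable lborel S (\<lambda>t. f t * g t)"
proof -
  have i: "set_integrable lborel S (\<lambda>t. (cmod (f t))\<^sup>2 + (cmod (g t))\<^sup>2)"
    using f g by (auto simp: L2_on_def)
  show ?thesis
  proof (rule set_integrable_bound[OF i])
    show "set_borel_measurable lborel S (\<lambda>t. f t * g t)"
      using f g by (auto simp: L2_on_def intro: set_borel_measurable_mult)
    have "norm (f x * g x) \<le> norm ((cmod (f x))\<^sup>2 + (cmod (g x))\<^sup>2)" for x
    proof -
      have "2 * cmod (f x) * cmod (g x) \<le> (cmod (f x))\<^sup>2 + (cmod (g x))\<^sup>2"
        by (rule sum_squares_bound)
      moreover have "0 \<le> cmod (f x) * cmod (g x)" by simp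
      ultimately have "cmod (f x) * cmod (g x) \<le> (cmod (f x))\<^sup>2 + (cmod (g x))\<^sup>2" by linarith
      then show ?thesis by (simp add: norm_mult)
    qed
    then show "AE x in lborel. x \<in> S \<longrightarrow> norm (f x * g x) \<le> norm ((cmod (f x))\<^sup>2 + (cmod (g x))\<^sup>2)"
      by auto
  qed
qed

text \<open>The choice a = I, b = A gives A I^2 <= A (A B), and A cancels unless it is 0. For A = 0
  and I nonzero, the choice a = (B + 1) / I, b = 1 would give 2 (B + 1) <= B.\<close>

lemma quadratic_form_discriminant:
  fixes A B I :: real
  assumes "A \<ge> 0" "B \<ge> 0" "I \<ge> 0" and q: "\<And>a b. 2 * a * b * I \<le> a\<^sup>2 * A + b\<^sup>2 * B"
  shows "I\<^sup>2 \<le> A * B"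
proof (cases "A = 0")
  case True
  have "I = 0"
  proof (rule ccontr)
    assume "I \<noteq> 0"
    then show False using q[of "(B+1)/I" 1] True assms by simp
  qed
  then show ?thesis using assms by simp
next
  case False
  have "A * I\<^sup>2 \<le> A * (A * B)"
    using q[of I A] by (simp add: power2_eq_square algebra_simps)
  then show ?thesis using False assms by simp
qed

lemma Cauchy_Schwarz_L2_on:
  assumes f: "L2_on S f" and g: "L2_on S g"
  shows "(cmod (LINT t:S|lborel. f t * g t))\<^sup>2 \<le> norm_sq S f * norm_sq S g"
proof -
  define I where "I = (LINT t:S|lborel. cmod (f t * g t))"
  have i: "set_integrable lborel S (\<lambda>t. f t * g t)" by (rule L2_on_mult_integrable[OF f g])
  have i2: "set_integrable lborel S (\<lambda>t. a\<^sup>2 * (cmod (f t))\<^sup>2 + b\<^sup>2 * (cmod (g t))\<^sup>2)" for a b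
    using f g by (auto simp: L2_on_def)
  have I: "cmod (LINT t:S|lborel. f t * g t) \<le> I"
    unfolding I_def by (rule set_integral_norm_bound[OF i])
  have "2 * a * b * I \<le> a\<^sup>2 * norm_sq S f + b\<^sup>2 * norm_sq S g" for a b
  proof -
    have "2 * a * b * I = (LINT t:S|lborel. 2 * a * b * cmod (f t * g t))"
      by (simp add: I_def)
    also have "\<dots> \<le> (LINT t:S|lborel. a\<^sup>2 * (cmod (f t))\<^sup>2 + b\<^sup>2 * (cmod (g t))\<^sup>2)"
    proof (intro set_integral_mono i2 set_integrable_mult_right set_integrable_norm[OF i])
      show "2 * a * b * cmod (f t * g t) \<le> a\<^sup>2 * (cmod (f t))\<^sup>2 + b\<^sup>2 * (cmod (g t))\<^sup>2" for t
        using sum_squares_bound[of "a * cmod (f t)" "b * cmod (g t)"]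
        by (simp add: norm_mult power_mult_distrib mult_ac)
    qed
    also have "\<dots> = a\<^sup>2 * norm_sq S f + b\<^sup>2 * norm_sq S g"
      using f g by (simp add: L2_on_def norm_sq_def)
    finally show ?thesis .
  qed
  moreover have I0: "I \<ge> 0" using I norm_ge_zero order_trans by blast
  ultimately have "I\<^sup>2 \<le> norm_sq S f * norm_sq S g"
    using quadratic_form_discriminant[of "norm_sq S f" "norm_sq S g" I] norm_sq_nonneg by blast
  moreover have "(cmod (LINT t:S|lborel. f t * g t))\<^sup>2 \<le> I\<^sup>2"
    using I by (intro power_mono) auto
  ultimately show ?thesis by linarith
qed

text \<open>Turns a lower bound for the form into one for the operator, with h in the role of f - z
  y: Cauchy-Schwarz, then division by \<open>norm_sq S y\<close>.\<close>

lemma coercivity_estimate: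
  assumes y: "L2_on S y" and h: "L2_on S h" and d: "d > 0"
    and le: "d * norm_sq S y \<le> cmod (LINT t:S|lborel. h t * cnj (y t))"
  shows "d\<^sup>2 * norm_sq S y \<le> norm_sq S h"
proof (cases "norm_sq S y = 0")
  case True then show ?thesis using norm_sq_nonneg by simp
next
  case False
  then have pos: "norm_sq S y > 0" using norm_sq_nonneg[of S y] by simp
  have "(d * norm_sq S y)\<^sup>2 \<le> (cmod (LINT t:S|lborel. h t * cnj (y t)))\<^sup>2"
    using le d norm_sq_nonneg[of S y] by (intro power_mono) auto
  also have "\<dots> \<le> norm_sq S h * norm_sq S y"
    using Cauchy_Schwarz_L2_on[OF h L2_on_cnj[OF y]] by (simp add: norm_sq_cnj)
  finally show ?thesis using pos by (simp add: power2_eq_square)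
qed

lemma L2_on_L2_half: "L2_on {l..} f \<Longrightarrow> L2_half l f"
  by (simp add: L2_on_def L2_half_def)

lemma L2_on_subset: "L2_on S f \<Longrightarrow> T \<in> sets borel \<Longrightarrow> T \<subseteq> S \<Longrightarrow> L2_on T f"
proof -
  assume *: "L2_on S f" "T \<in> sets borel" "T \<subseteq> S"
  have "indicat_real T \<in> borel_measurable lborel" using * by simp
  then have "(\<lambda>x. indicator T x *\<^sub>R (indicator S x *\<^sub>R f x)) \<in> borel_measurable lborel"
    using *(1)[unfolded L2_on_def set_borel_measurable_def, THEN conjunct1] by (rule borel_measurable_scaleR)
  then have "set_borel_measurable lborel T f"
    unfolding set_borel_measurable_def
    by (rule measurable_cong[THEN iffD1, rotated]) (use * in \<open>auto simp: indicator_def\<close>)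
  then show ?thesis using * by (auto simp: L2_on_def intro: set_integrable_subset)
qed

lemma norm_sq_mono: "L2_on S f \<Longrightarrow> T \<in> sets borel \<Longrightarrow> T \<subseteq> S \<Longrightarrow> norm_sq T f \<le> norm_sq S f"
  using L2_on_subset[of S f T] unfolding norm_sq_def set_lebesgue_integral_def L2_on_def set_integrable_def
  by (intro integral_mono) (auto simp: indicator_def)

lemma L2_on_continuous: "continuous_on {a..b} f \<Longrightarrow> L2_on {a..b} f"
  unfolding L2_on_def
proof
  assume c: "continuous_on {a..b} f"
  show "set_borel_measurable lborel {a..b} f"
    using set_measurable_continuous_on[OF _ c] by (simp add: set_borel_measurable_def)
  show "set_integrable lborel {a..b} (\<lambda>x. (cmod (f x))\<^sup>2)"
    by (intro borel_integrable_atLeastAtMost' continuous_intros c)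
qed

lemma set_borel_measurable_atLeast:
  fixes f :: "real \<Rightarrow> complex"
  assumes "\<And>b. set_borel_measurable lborel {l..b} f"
  shows "set_borel_measurable lborel {l..} f"
  unfolding set_borel_measurable_def
proof (rule borel_measurable_LIMSEQ_metric)
  show "(\<lambda>x. indicator {l..real n} x *\<^sub>R f x) \<in> borel_measurable lborel" for n
    using assms unfolding set_borel_measurable_def .
  show "(\<lambda>n. indicator {l..real n} x *\<^sub>R f x) \<longlonglongrightarrow> indicator {l..} x *\<^sub>R f x" for x
  proof (rule tendsto_eventually)
    show "\<forall>\<^sub>F n in sequentially. indicator {l..real n} x *\<^sub>R f x = indicator {l..} x *\<^sub>R f x"
      using eventually_ge_at_top[of "nat \<lceil>x\<rceil>"]
      by eventually_elim (auto simp: indicator_def nat_ceiling_le_eq)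
  qed
qed

lemma set_integral_cnj:
  "(LINT t:S|M. cnj (f t)) = cnj (LINT t:S|M. f t)"
proof -
  have "(\<lambda>t. indicator S t *\<^sub>R cnj (f t)) = (\<lambda>t. cnj (indicator S t *\<^sub>R f t))"
    by (simp add: fun_eq_iff)
  then show ?thesis unfolding set_lebesgue_integral_def by (simp only: Bochner_Integration.integral_cnj)
qed

lemma set_integrable_cnj: "set_integrable M S f \<Longrightarrow> set_integrable M S (\<lambda>t. cnj (f t))"
  unfolding set_integrable_def complex_integrable_cnj[of M "\<lambda>t. indicator S t *\<^sub>R f t", symmetric] by simp

section \<open>The differential expression and Green's formula\<close>

context schroedinger
begin

text \<open>Integrated form of $y' = p$, $l(y) = f$ on $[\ell,\infty)$.\<close>

definition triple :: "(real \<Rightarrow> complex) \<Rightarrow> (real \<Rightarrow> complex) \<Rightarrow> (real \<Rightarrow> complex) \<Rightarrow> bool" where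
  "triple y p f \<longleftrightarrow>
     (\<forall>b. set_integrable lborel {l..b} p \<and>
          set_integrable lborel {l..b} (\<lambda>t. of_real (q t) * y t - f t)) \<and>
     (\<forall>x\<ge>l. y x = y l + (LINT t:{l..x}|lborel. p t)) \<and>
     (\<forall>x\<ge>l. p x = p l + (LINT t:{l..x}|lborel. of_real (q t) * y t - f t))"

lemma tripleD:
  assumes "triple y p f"
  shows "set_integrable lborel {l..b} p"
    "set_integrable lborel {l..b} (\<lambda>t. of_real (q t) * y t - f t)"
    "x \<ge> l \<Longrightarrow> y x = y l + (LINT t:{l..x}|lborel. p t)"
    "x \<ge> l \<Longrightarrow> p x = p l + (LINT t:{l..x}|lborel. of_real (q t) * y t - f t)"
  using assms unfolding triple_def by blast+

lemma sol_iff_triple: "sol q l z y p \<longleftrightarrow> triple y p (\<lambda>t. z * y t)"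
proof
  assume s: "sol q l z y p"
  show "triple y p (\<lambda>t. z * y t)"
    unfolding triple_def left_diff_distrib[symmetric] using solD[OF s] by blast
next
  assume "triple y p (\<lambda>t. z * y t)"
  then show "sol q l z y p"
    unfolding triple_def sol_def left_diff_distrib[symmetric] by blast
qed

lemma triple_continuous:
  assumes "triple y p f"
  shows "continuous_on {l..b} y" "continuous_on {l..b} p"
proof -
  note c = tripleD(1,2)[OF assms, THEN continuous_on_indefinite_integral]
  have "continuous_on {l..b} (\<lambda>x. y l + (LINT t:{l..x}|lborel. p t))"
       "continuous_on {l..b} (\<lambda>x. p l + (LINT t:{l..x}|lborel. of_real (q t) * y t - f t))"
    by (intro continuous_intros c)+
  then show "continuous_on {l..b} y" "continuous_on {l..b} p"
    using tripleD(3,4)[OF assms]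
    by (smt (verit, best) atLeastAtMost_iff continuous_on_cong)+
qed

lemma triple_source_integrable:
  assumes "triple y p f"
  shows "set_integrable lborel {l..b} f"
proof -
  have "set_integrable lborel {l..b} (\<lambda>t. of_real (q t) * y t - (of_real (q t) * y t - f t))"
    by (intro set_integral_diff(1) tripleD(2)[OF assms] set_integrable_bounded_mult[OF q_integrable_complex triple_continuous(1)[OF assms]])
  then show ?thesis by simp
qed

lemma triple_measurable:
  assumes "triple y p f"
  shows "set_borel_measurable lborel {l..} y" "set_borel_measurable lborel {l..} f"
proof -
  show "set_borel_measurable lborel {l..} y"
    using L2_on_continuous[OF triple_continuous(1)[OF assms]]
    by (intro set_borel_measurable_atLeast) (simp add: L2_on_def)
  show "set_borel_measurable lborel {l..} f"
    using triple_source_integrable[OF assms]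
    by (intro set_borel_measurable_atLeast) (auto simp: set_integrable_def set_borel_measurable_def)
qed

lemma triple_scale:
  assumes "triple y p f"
  shows "triple (\<lambda>t. c * y t) (\<lambda>t. c * p t) (\<lambda>t. c * f t)"
proof -
  have *: "(\<lambda>t. of_real (q t) * (c * y t) - c * f t) = (\<lambda>t. c * (of_real (q t) * y t - f t))"
    by (auto simp: algebra_simps)
  show ?thesis
    unfolding triple_def *
  proof (intro conjI allI impI)
    fix x assume x: "l \<le> x"
    show "c * y x = c * y l + (LINT t:{l..x}|lborel. c * p t)"
      unfolding set_integral_mult_right tripleD(3)[OF assms x] distrib_left ..
    show "c * p x = c * p l + (LINT t:{l..x}|lborel. c * (of_real (q t) * y t - f t))"
      unfolding set_integral_mult_right tripleD(4)[OF assms x] distrib_left ..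
  qed (use tripleD(1,2)[OF assms] in auto)
qed

lemma triple_add:
  assumes 1: "triple y p f" and 2: "triple v r g"
  shows "triple (\<lambda>t. y t + v t) (\<lambda>t. p t + r t) (\<lambda>t. f t + g t)"
proof -
  have *: "(\<lambda>t. of_real (q t) * (y t + v t) - (f t + g t)) = (\<lambda>t. (of_real (q t) * y t - f t) + (of_real (q t) * v t - g t))"
    by (auto simp: algebra_simps)
  show ?thesis
    unfolding triple_def *
  proof (intro conjI allI impI)
    fix x assume x: "l \<le> x"
    show "y x + v x = y l + v l + (LINT t:{l..x}|lborel. p t + r t)"
      unfolding set_integral_add(2)[OF tripleD(1)[OF 1] tripleD(1)[OF 2]] tripleD(3)[OF 1 x] tripleD(3)[OF 2 x]
      by (simp only: ac_simps)
    show "p x + r x = p l + r l + (LINT t:{l..x}|lborel. (of_real (q t) * y t - f t) + (of_real (q t) * v t - g t))"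
      unfolding set_integral_add(2)[OF tripleD(2)[OF 1] tripleD(2)[OF 2]] tripleD(4)[OF 1 x] tripleD(4)[OF 2 x]
      by (simp only: ac_simps)
  qed (use tripleD(1,2)[OF 1] tripleD(1,2)[OF 2] in auto)
qed

lemma triple_diff:
  assumes 1: "triple y p f" and 2: "triple v r g"
  shows "triple (\<lambda>t. y t - v t) (\<lambda>t. p t - r t) (\<lambda>t. f t - g t)"
  using triple_add[OF 1 triple_scale[OF 2, of "-1"]] by simp

lemma triple_cnj:
  assumes "triple y p f"
  shows "triple (\<lambda>t. cnj (y t)) (\<lambda>t. cnj (p t)) (\<lambda>t. cnj (f t))"
proof -
  have *: "(\<lambda>t. of_real (q t) * cnj (y t) - cnj (f t)) = (\<lambda>t. cnj (of_real (q t) * y t - f t))"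
    by auto
  show ?thesis
    unfolding triple_def *
  proof (intro conjI allI impI)
    fix x assume x: "l \<le> x"
    show "cnj (y x) = cnj (y l) + (LINT t:{l..x}|lborel. cnj (p t))"
      unfolding set_integral_cnj tripleD(3)[OF assms x] complex_cnj_add ..
    show "cnj (p x) = cnj (p l) + (LINT t:{l..x}|lborel. cnj (of_real (q t) * y t - f t))"
      unfolding set_integral_cnj tripleD(4)[OF assms x] complex_cnj_add ..
  qed (intro set_integrable_cnj tripleD(1,2)[OF assms])+
qed

text \<open>The product rule for y r and for p v produces the same terms p r and q y v, which cancel
  in the difference.\<close>

lemma Green_Icc:
  assumes 1: "triple y p f" and 2: "triple v r g" and b: "l \<le> b"
  shows "y b * r b - p b * v b = y l * r l - p l * v l + (LINT t:{l..b}|lborel. f t * v t - y t * g t)"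
proof -
  note c = triple_continuous[OF 1] triple_continuous[OF 2]
  have "y b * r b = y l * r l + (LINT t:{l..b}|lborel. p t * r t + y t * (of_real (q t) * v t - g t))"
    by (rule product_rule_indefinite_integral[OF tripleD(1)[OF 1] tripleD(2)[OF 2] _ _ b])
      (rule tripleD(3)[OF 1] tripleD(4)[OF 2], simp)+
  moreover have "p b * v b = p l * v l + (LINT t:{l..b}|lborel. (of_real (q t) * y t - f t) * v t + p t * r t)"
    by (rule product_rule_indefinite_integral[OF tripleD(2)[OF 1] tripleD(1)[OF 2] _ _ b])
      (rule tripleD(4)[OF 1] tripleD(3)[OF 2], simp)+
  moreover have "(LINT t:{l..b}|lborel. f t * v t - y t * g t) =
     (LINT t:{l..b}|lborel. p t * r t + y t * (of_real (q t) * v t - g t))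
     - (LINT t:{l..b}|lborel. (of_real (q t) * y t - f t) * v t + p t * r t)"
  proof (subst set_integral_diff(2)[symmetric])
    show "set_integrable lborel {l..b} (\<lambda>t. p t * r t + y t * (of_real (q t) * v t - g t))"
    proof (rule set_integral_add(1))
      show "set_integrable lborel {l..b} (\<lambda>t. p t * r t)"
        by (rule set_integrable_bounded_mult[OF tripleD(1)[OF 1] c(4)])
      show "set_integrable lborel {l..b} (\<lambda>t. y t * (of_real (q t) * v t - g t))"
        using set_integrable_bounded_mult[OF tripleD(2)[OF 2, of b] c(1)] by (simp only: mult.commute)
    qed
    show "set_integrable lborel {l..b} (\<lambda>t. (of_real (q t) * y t - f t) * v t + p t * r t)"
      by (intro set_integral_add set_integrable_bounded_mult tripleD[OF 1] c)
  qed (simp add: algebra_simps)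
  ultimately show ?thesis by (simp only: algebra_simps)
qed

text \<open>\<open>U z a b\<close> is the solution of $l(y) = z y$ with $y(\ell) = a$, $y'(\ell) = b$, and \<open>V z a b\<close> is
  its derivative.\<close>

definition csol where "csol z = (SOME yp. sol q l z (fst yp) (snd yp) \<and> fst yp l = 1 \<and> snd yp l = 0)"
definition ssol where "ssol z = (SOME yp. sol q l z (fst yp) (snd yp) \<and> fst yp l = 0 \<and> snd yp l = 1)"
definition U where "U z a b = (\<lambda>t. a * fst (csol z) t + b * fst (ssol z) t)"
definition V where "V z a b = (\<lambda>t. a * snd (csol z) t + b * snd (ssol z) t)"

lemma csol: "sol q l z (fst (csol z)) (snd (csol z))" "fst (csol z) l = 1" "snd (csol z) l = 0"
  and ssol: "sol q l z (fst (ssol z)) (snd (ssol z))" "fst (ssol z) l = 0" "snd (ssol z) l = 1"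
proof -
  have "\<exists>yp. sol q l z (fst yp) (snd yp) \<and> fst yp l = a \<and> snd yp l = b" for a b
    using sol_exists[of z a b] by (metis fst_conv snd_conv)
  note e = someI_ex[OF this]
  show "sol q l z (fst (csol z)) (snd (csol z))" "fst (csol z) l = 1" "snd (csol z) l = 0"
    using e[of 1 0] unfolding csol_def by blast+
  show "sol q l z (fst (ssol z)) (snd (ssol z))" "fst (ssol z) l = 0" "snd (ssol z) l = 1"
    using e[of 0 1] unfolding ssol_def by blast+
qed

lemma U_l [simp]: "U z a b l = a" and V_l [simp]: "V z a b l = b"
  by (simp_all add: U_def V_def csol ssol)

lemma triple_U: "triple (U z a b) (V z a b) (\<lambda>t. z * U z a b t)"
  using triple_add[OF triple_scale[OF csol(1)[of z, unfolded sol_iff_triple], of a] triple_scale[OF ssol(1)[of z, unfolded sol_iff_triple], of b]]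
  unfolding U_def V_def by (simp add: algebra_simps)

lemma sol_U: "sol q l z (U z a b) (V z a b)"
  by (simp add: sol_iff_triple triple_U)

lemma sol_eq_U:
  assumes "sol q l z y p" "x \<ge> l"
  shows "y x = U z (y l) (p l) x" "p x = V z (y l) (p l) x"
  using sol_unique[OF assms(1) sol_U _ _ assms(2), of "y l" "p l"] by simp_all

text \<open>Conjugation preserves the equation because q is real. Uniqueness says nothing to the
  left of l, where the functions chosen by \<open>SOME\<close> are arbitrary.\<close>

lemma cnj_U: "t \<ge> l \<Longrightarrow> cnj (U z a b t) = U (cnj z) (cnj a) (cnj b) t"
proof -
  assume t: "t \<ge> l"
  have "sol q l (cnj z) (\<lambda>t. cnj (U z a b t)) (\<lambda>t. cnj (V z a b t))"
    using triple_cnj[OF triple_U[of z a b]] by (simp add: sol_iff_triple)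
  from sol_eq_U(1)[OF this t] show ?thesis by simp
qed

text \<open>Makes the dependence on z explicit, so that the Gronwall factor stays bounded while z
  tends to a limit.\<close>

lemma weight_int_eq: "x \<ge> l \<Longrightarrow> weight_int z x = weight_int 0 x + cmod z * (x - l)"
proof -
  assume x: "x \<ge> l"
  have "weight_int z x = (LINT t:{l..x}|lborel. weight 0 t + cmod z)"
    unfolding weight_int_def weight_def by simp
  also have "\<dots> = weight_int 0 x + (LINT t:{l..x}|lborel. cmod z)"
    unfolding weight_int_def by (intro set_integral_add weight_integrable const_integrable)
  also have "(LINT t:{l..x}|lborel. cmod z) = cmod z * (x - l)"
    using x by (simp add: set_lebesgue_integral_def)
  finally show ?thesis .
qed

lemma U_tendsto:
  assumes z: "(z \<longlongrightarrow> w) F" and a: "(a \<longlongrightarrow> a0) F" and b: "(b \<longlongrightarrow> b0) F" and t: "t \<ge> l"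
  shows "((\<lambda>n. U (z n) (a n) (b n) t) \<longlongrightarrow> U w a0 b0 t) F"
proof -
  define I where "I = (LINT s:{l..t}|lborel. cmod (U w a0 b0 s))"
  have "((\<lambda>n. (cmod (a n - a0) + cmod (b n - b0) + cmod (z n - w) * I) * exp (weight_int 0 t + cmod (z n) * (t - l)))
    \<longlongrightarrow> (cmod (a0 - a0) + cmod (b0 - b0) + cmod (w - w) * I) * exp (weight_int 0 t + cmod w * (t - l))) F"
    by (intro tendsto_intros a b z)
  then have lim: "((\<lambda>n. (cmod (a n - a0) + cmod (b n - b0) + cmod (z n - w) * I) * exp (weight_int 0 t + cmod (z n) * (t - l))) \<longlongrightarrow> 0) F"
    by simp
  have "((\<lambda>n. U (z n) (a n) (b n) t - U w a0 b0 t) \<longlongrightarrow> 0) F"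
  proof (rule Lim_null_comparison[OF always_eventually lim], rule)
    fix n
    have "cmod (U (z n) (a n) (b n) t - U w a0 b0 t) + cmod (V (z n) (a n) (b n) t - V w a0 b0 t)
      \<le> (cmod (a n - a0) + cmod (b n - b0) + cmod (z n - w) * I) * exp (weight_int (z n) t)"
      using sol_stability[OF sol_U[of "z n" "a n" "b n"] sol_U[of w a0 b0] t order_refl] by (simp add: I_def)
    then show "norm (U (z n) (a n) (b n) t - U w a0 b0 t) \<le> (cmod (a n - a0) + cmod (b n - b0) + cmod (z n - w) * I) * exp (weight_int 0 t + cmod (z n) * (t - l))"
      using weight_int_eq[OF t, of "z n"] norm_ge_zero[of "V (z n) (a n) (b n) t - V w a0 b0 t"] by (simp only:)
  qed
  then show ?thesis by (simp add: LIM_zero_iff)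
qed

lemma triple_has_vector_derivative:
  assumes "triple y p f" "x \<in> {l..b}"
  shows "(y has_vector_derivative p x) (at x within {l..b})"
proof -
  have 1: "((\<lambda>u. y l + integral {l..u} p) has_vector_derivative p x) (at x within {l..b})"
    using integral_has_vector_derivative[OF triple_continuous(2)[OF assms(1)] assms(2)]
    by (subst add.commute) (simp add: has_vector_derivative_add_const)
  have 2: "y u = y l + integral {l..u} p" if "u \<in> {l..b}" for u
    using tripleD(3)[OF assms(1), of u] that set_borel_integral_eq_integral(2)[OF tripleD(1)[OF assms(1), of u]]
    by (simp only: atLeastAtMost_iff)
  show ?thesis
    by (rule has_vector_derivative_transform[OF assms(2) 2 1])
qed

section \<open>Functions of bounded support with prescribed Cauchy data\<close>

lemma cut_integral:
  fixes f :: "real \<Rightarrow> complex"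
  assumes "set_integrable lborel {l..min b c} f"
  shows "set_integrable lborel {l..b} (\<lambda>t. if t \<le> c then f t else 0)"
    "(LINT t:{l..b}|lborel. if t \<le> c then f t else 0) = (LINT t:{l..min b c}|lborel. f t)"
proof -
  have *: "(\<lambda>t. indicator {l..b} t *\<^sub>R (if t \<le> c then f t else 0)) = (\<lambda>t. indicator {l..min b c} t *\<^sub>R f t)"
    by (auto simp: indicator_def)
  show "set_integrable lborel {l..b} (\<lambda>t. if t \<le> c then f t else 0)"
    using assms by (simp add: set_integrable_def *)
  show "(LINT t:{l..b}|lborel. if t \<le> c then f t else 0) = (LINT t:{l..min b c}|lborel. f t)"
    by (simp add: set_lebesgue_integral_def *)
qed

text \<open>As both y and p vanish at c, extension by zero keeps both of them absolutely
  continuous.\<close>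

lemma triple_cut:
  assumes t: "triple y p f" and c: "c \<ge> l" "y c = 0" "p c = 0"
  shows "triple (\<lambda>t. if t \<le> c then y t else 0) (\<lambda>t. if t \<le> c then p t else 0) (\<lambda>t. if t \<le> c then f t else 0)"
proof -
  have *: "(\<lambda>t. of_real (q t) * (if t \<le> c then y t else 0) - (if t \<le> c then f t else 0))
    = (\<lambda>t. if t \<le> c then of_real (q t) * y t - f t else 0)" by auto
  show ?thesis
    unfolding triple_def *
  proof (intro conjI allI impI)
    fix x assume x: "x \<ge> l"
    show "(if x \<le> c then y x else 0) = (if l \<le> c then y l else 0) + (LINT t:{l..x}|lborel. if t \<le> c then p t else 0)"
      unfolding cut_integral(2)[OF tripleD(1)[OF t]]
    proof (cases "x \<le> c")
      case True
      then show "(if x \<le> c then y x else 0) = (if l \<le> c then y l else 0) + (LINT t:{l..min x c}|lborel. p t)"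
        using tripleD(3)[OF t x] c by (simp only: min_absorb1 if_True)
    next
      case False
      then have m: "min x c = c" "(x \<le> c) = False" by auto
      show "(if x \<le> c then y x else 0) = (if l \<le> c then y l else 0) + (LINT t:{l..min x c}|lborel. p t)"
        unfolding m using tripleD(3)[OF t c(1)] c by (simp only: if_True if_False)
    qed
    show "(if x \<le> c then p x else 0) = (if l \<le> c then p l else 0) + (LINT t:{l..x}|lborel. if t \<le> c then of_real (q t) * y t - f t else 0)"
      unfolding cut_integral(2)[OF tripleD(2)[OF t]]
    proof (cases "x \<le> c")
      case True
      then show "(if x \<le> c then p x else 0) = (if l \<le> c then p l else 0) + (LINT t:{l..min x c}|lborel. of_real (q t) * y t - f t)"
        using tripleD(4)[OF t x] c by (simp only: min_absorb1 if_True)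
    next
      case False
      then have m: "min x c = c" "(x \<le> c) = False" by auto
      show "(if x \<le> c then p x else 0) = (if l \<le> c then p l else 0) + (LINT t:{l..min x c}|lborel. of_real (q t) * y t - f t)"
        unfolding m using tripleD(4)[OF t c(1)] c by (simp only: if_True if_False)
    qed
  qed (intro cut_integral(1) tripleD(1,2)[OF t])+
qed

lemma L2_on_cut: "L2_on {l..c} f \<Longrightarrow> L2_on {l..} (\<lambda>t. if t \<le> c then f t else 0)"
proof -
  have *: "(\<lambda>t. indicator {l..} t *\<^sub>R (if t \<le> c then f t else 0)) = (\<lambda>t. indicator {l..c} t *\<^sub>R f t)"
    by (auto simp: indicator_def)
  have **: "(\<lambda>t. indicator {l..} t *\<^sub>R (cmod (if t \<le> c then f t else 0))\<^sup>2) = (\<lambda>t. indicator {l..c} t *\<^sub>R (cmod (f t))\<^sup>2)"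
    by (auto simp: indicator_def)
  show "L2_on {l..c} f \<Longrightarrow> L2_on {l..} (\<lambda>t. if t \<le> c then f t else 0)"
    unfolding L2_on_def set_borel_measurable_def set_integrable_def * ** .
qed

lemma norm_sq_zero_imp_data_zero:
  assumes "norm_sq {l..c} (U z a b) = 0" "l < c"
  shows "a = 0" "b = 0"
proof -
  have cont: "continuous_on {l..c} (U z a b)" by (rule triple_continuous(1)[OF triple_U])
  have i: "set_integrable lborel {l..c} (\<lambda>t. (cmod (U z a b t))\<^sup>2)"
    using L2_on_continuous[OF cont] by (simp add: L2_on_def)
  have "integral {l..c} (\<lambda>t. (cmod (U z a b t))\<^sup>2) = 0"
    using assms(1) set_borel_integral_eq_integral(2)[OF i] by (simp add: norm_sq_def)
  moreover have "(\<lambda>t. (cmod (U z a b t))\<^sup>2) integrable_on {l..c}"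
    using set_borel_integral_eq_integral(1)[OF i] .
  ultimately have hi: "((\<lambda>t. (cmod (U z a b t))\<^sup>2) has_integral 0) (cbox l c)"
    by (simp add: has_integral_iff)
  have z: "U z a b x = 0" if "x \<in> {l..c}" for x
  proof -
    have "(cmod (U z a b x))\<^sup>2 = 0"
      by (rule has_integral_0_cbox_imp_0[OF _ _ hi]) (use assms(2) that in \<open>auto intro!: continuous_intros cont\<close>)
    then show ?thesis by simp
  qed
  show "a = 0" using z[of l] assms(2) by simp
  have "(U z a b has_vector_derivative V z a b l) (at l within {l..c})"
    by (rule triple_has_vector_derivative[OF triple_U]) (use assms(2) in auto)
  moreover have "(U z a b has_vector_derivative 0) (at l within {l..c})"
    by (rule has_vector_derivative_transform[of _ _ _ "\<lambda>_. 0"]) (use z assms(2) in auto)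
  ultimately have "V z a b l = 0"
    using vector_derivative_unique_within_closed_interval[of l c l "U z a b"] assms(2) by auto
  then show "b = 0" by simp
qed

text \<open>A sum of solutions at $i$ and $-i$ with vanishing Cauchy data at both ends is zero, because
  the range of the minimal operator on $[\ell,\ell+1]$ minus $i$ is orthogonal to the solutions at $-i$.  So the
  four-dimensional space of such sums attains all Cauchy data at both ends.\<close>

lemma bump_exists:
  "\<exists>y p f. triple y p f \<and> y l = a \<and> p l = b \<and> (\<forall>t\<ge>l+1. y t = 0 \<and> p t = 0) \<and> L2_on {l..} y \<and> L2_on {l..} f"
proof -
  define c where "c = l + 1"
  have c: "c > l" by (simp add: c_def)
  \<comment> \<open>Coefficients of a sum of solutions at i and -i are sent to its Cauchy data at l
    and at c. The map is linear over the reals between spaces of equal finite dimension, so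
    injectivity yields surjectivity.\<close>
  define T where "T = (\<lambda>(a, b, a', b'). (a + a', b + b', U \<i> a b c + U (-\<i>) a' b' c, V \<i> a b c + V (-\<i>) a' b' c))"
  have lin: "linear T"
    by (rule linearI) (auto simp: T_def U_def V_def algebra_simps scaleR_conv_of_real split: prod.splits)
  have tr: "triple (\<lambda>t. U \<i> a b t + U (-\<i>) a' b' t) (\<lambda>t. V \<i> a b t + V (-\<i>) a' b' t) (\<lambda>t. \<i> * U \<i> a b t + (-\<i>) * U (-\<i>) a' b' t)" for a b a' b'
    by (rule triple_add[OF triple_U triple_U])
  have "inj T"
    unfolding linear_injective_0[OF lin]
  proof (intro allI impI)
    fix v assume v: "T v = 0"
    obtain a b a' b' where v_eq: "v = (a, b, a', b')" by (cases v) auto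
    have 0: "a + a' = 0" "b + b' = 0" "U \<i> a b c + U (-\<i>) a' b' c = 0" "V \<i> a b c + V (-\<i>) a' b' c = 0"
      using v by (simp_all add: v_eq T_def zero_prod_def)
    let ?R = "U (-\<i>) a' b'"
    \<comment> \<open>The boundary terms vanish by assumption. The conjugate of \<open>?R\<close>
      solves the equation at i, so the part with \<open>U \<i> a b\<close> cancels in the integrand
      and only -2i |R|^2 is left.\<close>
    have "(LINT t:{l..c}|lborel. (\<i> * U \<i> a b t + (-\<i>) * ?R t) * cnj (?R t) - (U \<i> a b t + ?R t) * cnj ((-\<i>) * ?R t)) = 0"
      using Green_Icc[OF tr triple_cnj[OF triple_U[of "-\<i>" a' b']], of c a b a' b'] 0 c by simp
    also have "(LINT t:{l..c}|lborel. (\<i> * U \<i> a b t + (-\<i>) * ?R t) * cnj (?R t) - (U \<i> a b t + ?R t) * cnj ((-\<i>) * ?R t))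
      = (LINT t:{l..c}|lborel. -2 * \<i> * of_real ((cmod (?R t))\<^sup>2))"
    proof (rule arg_cong[where f="set_lebesgue_integral lborel {l..c}"], rule ext)
      fix t
      show "(\<i> * U \<i> a b t + (-\<i>) * ?R t) * cnj (?R t) - (U \<i> a b t + ?R t) * cnj ((-\<i>) * ?R t) = -2 * \<i> * of_real ((cmod (?R t))\<^sup>2)"
        unfolding complex_norm_square by (simp add: algebra_simps)
    qed
    also have "\<dots> = -2 * \<i> * of_real (norm_sq {l..c} ?R)"
      unfolding norm_sq_def set_integral_complex_of_real[symmetric] by (rule set_integral_mult_right)
    finally have "norm_sq {l..c} ?R = 0" by simp
    then have "a' = 0" "b' = 0" using norm_sq_zero_imp_data_zero c by blast+
    then show "v = 0" using 0 by (simp add: v_eq zero_prod_def)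
  qed
  then have "surj T" using linear_injective_imp_surjective[OF lin] by blast
  then obtain v where v: "T v = (a, b, 0, 0)" by (metis surjD)
  obtain a1 b1 a2 b2 where v_eq: "v = (a1, b1, a2, b2)" by (cases v) auto
  define y where "y = (\<lambda>t. U \<i> a1 b1 t + U (-\<i>) a2 b2 t)"
  define p where "p = (\<lambda>t. V \<i> a1 b1 t + V (-\<i>) a2 b2 t)"
  define f where "f = (\<lambda>t. \<i> * U \<i> a1 b1 t + (-\<i>) * U (-\<i>) a2 b2 t)"
  have y: "triple y p f" unfolding y_def p_def f_def by (rule tr)
  have d: "y l = a" "p l = b" "y c = 0" "p c = 0" using v by (simp_all add: v_eq T_def y_def p_def)
  have "continuous_on {l..c} y" "continuous_on {l..c} f"
    unfolding y_def f_def by (intro continuous_intros triple_continuous(1)[OF triple_U])+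
  then have s: "L2_on {l..} (\<lambda>t. if t \<le> c then y t else 0)" "L2_on {l..} (\<lambda>t. if t \<le> c then f t else 0)"
    by (auto intro: L2_on_cut L2_on_continuous)
  have "triple (\<lambda>t. if t \<le> c then y t else 0) (\<lambda>t. if t \<le> c then p t else 0) (\<lambda>t. if t \<le> c then f t else 0)"
    by (rule triple_cut[OF y]) (use c d in auto)
  moreover have "\<forall>t\<ge>l+1. (if t \<le> c then y t else 0) = 0 \<and> (if t \<le> c then p t else 0) = 0"
    using d by (auto simp: c_def)
  ultimately show ?thesis using s d c
    by (intro exI[of _ "\<lambda>t. if t \<le> c then y t else 0"] exI[of _ "\<lambda>t. if t \<le> c then p t else 0"] exI[of _ "\<lambda>t. if t \<le> c then f t else 0"]) auto
qed

end

section \<open>Green's formula at infinity\<close>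

text \<open>The pairing is bilinear: there is no conjugation.\<close>

definition pairing :: "real \<Rightarrow> (real \<Rightarrow> complex) \<Rightarrow> (real \<Rightarrow> complex) \<Rightarrow> complex" where
  "pairing l f g = (LINT t:{l..}|lborel. f t * g t)"

lemma pairing_commute: "pairing l f g = pairing l g f"
  by (simp add: pairing_def mult.commute)

lemma pairing_scale_left: "pairing l (\<lambda>t. c * f t) g = c * pairing l f g"
  unfolding pairing_def set_integral_mult_right[symmetric] by (simp add: mult.assoc)

lemma pairing_scale_right: "pairing l f (\<lambda>t. c * g t) = c * pairing l f g"
  by (subst (1 2) pairing_commute) (rule pairing_scale_left)

lemma pairing_add_left: "L2_on {l..} f \<Longrightarrow> L2_on {l..} f' \<Longrightarrow> L2_on {l..} g \<Longrightarrow> pairing l (\<lambda>t. f t + f' t) g = pairing l f g + pairing l f' g"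
  unfolding pairing_def distrib_right by (intro set_integral_add L2_on_mult_integrable)

lemma pairing_diff_left: "L2_on {l..} f \<Longrightarrow> L2_on {l..} f' \<Longrightarrow> L2_on {l..} g \<Longrightarrow> pairing l (\<lambda>t. f t - f' t) g = pairing l f g - pairing l f' g"
  unfolding pairing_def left_diff_distrib by (intro set_integral_diff L2_on_mult_integrable)

lemma pairing_add_right: "L2_on {l..} f \<Longrightarrow> L2_on {l..} g \<Longrightarrow> L2_on {l..} g' \<Longrightarrow> pairing l f (\<lambda>t. g t + g' t) = pairing l f g + pairing l f g'"
  unfolding pairing_def distrib_left by (intro set_integral_add L2_on_mult_integrable)

lemma pairing_diff_right: "L2_on {l..} f \<Longrightarrow> L2_on {l..} g \<Longrightarrow> L2_on {l..} g' \<Longrightarrow> pairing l f (\<lambda>t. g t - g' t) = pairing l f g - pairing l f g'"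
  unfolding pairing_def right_diff_distrib by (intro set_integral_diff L2_on_mult_integrable)

lemma cnj_pairing: "cnj (pairing l f g) = pairing l (\<lambda>t. cnj (f t)) (\<lambda>t. cnj (g t))"
  unfolding pairing_def set_integral_cnj[symmetric] by simp

lemma pairing_cnj_self: "pairing l f (\<lambda>t. cnj (f t)) = of_real (norm_sq {l..} f)"
  unfolding pairing_def norm_sq_def set_integral_complex_of_real[symmetric] complex_norm_square ..

lemma norm_pairing_le: "L2_on {l..} f \<Longrightarrow> L2_on {l..} g \<Longrightarrow> (cmod (pairing l f g))\<^sup>2 \<le> norm_sq {l..} f * norm_sq {l..} g"
  unfolding pairing_def by (rule Cauchy_Schwarz_L2_on)

lemma pairing_cong: "(\<And>t. t \<ge> l \<Longrightarrow> f t = f' t) \<Longrightarrow> (\<And>t. t \<ge> l \<Longrightarrow> g t = g' t) \<Longrightarrow> pairing l f g = pairing l f' g'"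
  unfolding pairing_def by (rule set_lebesgue_integral_cong) auto

lemma diff_cnj_conv_Im: "a * cnj b - b * cnj a = 2 * \<i> * of_real (Im (a * cnj b))"
  by (rule complex_eqI) simp_all

lemma Im_mult_of_real: "Im (z * of_real r) = Im z * r"
  by simp

text \<open>The complement of [0,oo): there \<open>gap\<close> is positive, and the minimal operator
  minus z is bounded below.\<close>

definition resolvent :: "complex set" where
  "resolvent = {z. Im z \<noteq> 0 \<or> Re z < 0}"

text \<open>A lower bound, positive on \<open>resolvent\<close>, for the distance from $z$ to $[0,\infty)$.\<close>

definition gap :: "complex \<Rightarrow> real" where "gap z = max \<bar>Im z\<bar> (- Re z)"

lemma gap_pos: "z \<in> resolvent \<Longrightarrow> gap z > 0"
  by (auto simp: resolvent_def gap_def)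

lemma open_resolvent: "open resolvent"
proof -
  have "resolvent = {z. 0 < gap z}"
    by (auto simp: resolvent_def gap_def)
  also have "open \<dots>" unfolding gap_def by (intro open_Collect_less continuous_intros)
  finally show ?thesis .
qed

context schroedinger
begin

definition max_domain :: "(real \<Rightarrow> complex) \<Rightarrow> (real \<Rightarrow> complex) \<Rightarrow> (real \<Rightarrow> complex) \<Rightarrow> bool" where
  "max_domain y p f \<longleftrightarrow> triple y p f \<and> L2_on {l..} y \<and> L2_on {l..} f"

lemma max_domain_add: "max_domain y p f \<Longrightarrow> max_domain v r g \<Longrightarrow> max_domain (\<lambda>t. y t + v t) (\<lambda>t. p t + r t) (\<lambda>t. f t + g t)"
  by (auto simp: max_domain_def intro: triple_add L2_on_add)

lemma max_domain_diff: "max_domain y p f \<Longrightarrow> max_domain v r g \<Longrightarrow> max_domain (\<lambda>t. y t - v t) (\<lambda>t. p t - r t) (\<lambda>t. f t - g t)"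
  by (auto simp: max_domain_def intro: triple_diff L2_on_diff)

lemma max_domain_scale: "max_domain y p f \<Longrightarrow> max_domain (\<lambda>t. c * y t) (\<lambda>t. c * p t) (\<lambda>t. c * f t)"
  by (auto simp: max_domain_def intro: triple_scale L2_on_scale)

lemma max_domain_cnj: "max_domain y p f \<Longrightarrow> max_domain (\<lambda>t. cnj (y t)) (\<lambda>t. cnj (p t)) (\<lambda>t. cnj (f t))"
  by (auto simp: max_domain_def intro: triple_cnj L2_on_cnj)

lemma L2_on_U_iff: "L2_on {l..} (U z a b) \<longleftrightarrow> L2_half l (U z a b)"
  using triple_measurable(1)[OF triple_U] by (simp add: L2_on_def L2_half_def)

lemma max_domain_U: "L2_on {l..} (U z a b) \<Longrightarrow> max_domain (U z a b) (V z a b) (\<lambda>t. z * U z a b t)"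
  by (simp add: max_domain_def triple_U L2_on_scale)

text \<open>Functions vanishing beyond $\ell + 1$ with prescribed Cauchy data: subtracting them moves an
  element of the maximal domain into the minimal domain without changing it near infinity.\<close>

definition bump :: "complex \<Rightarrow> complex \<Rightarrow> (real \<Rightarrow> complex) \<times> (real \<Rightarrow> complex) \<times> (real \<Rightarrow> complex)" where
  "bump a b = (SOME (y, p, f). triple y p f \<and> y l = a \<and> p l = b \<and> (\<forall>t\<ge>l+1. y t = 0 \<and> p t = 0) \<and> L2_on {l..} y \<and> L2_on {l..} f)"

text \<open>Composed of two fixed bumps in order to be linear in (a,b), which \<open>bump\<close>,
  chosen by \<open>SOME\<close> for each pair separately, need not be. The norms are therefore
  controlled by |a|^2 + |b|^2 with one constant. Here \<open>\<eta>'\<close> is the derivative of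
  \<open>\<eta>\<close> and \<open>\<psi>\<close> its image under the differential
  expression.\<close>

definition \<eta> where "\<eta> a b = (\<lambda>t. a * fst (bump 1 0) t + b * fst (bump 0 1) t)"
definition \<eta>' where "\<eta>' a b = (\<lambda>t. a * fst (snd (bump 1 0)) t + b * fst (snd (bump 0 1)) t)"
definition \<psi> where "\<psi> a b = (\<lambda>t. a * snd (snd (bump 1 0)) t + b * snd (snd (bump 0 1)) t)"

lemma bump:
  "max_domain (fst (bump a b)) (fst (snd (bump a b))) (snd (snd (bump a b)))"
  "fst (bump a b) l = a" "fst (snd (bump a b)) l = b"
  "t \<ge> l + 1 \<Longrightarrow> fst (bump a b) t = 0" "t \<ge> l + 1 \<Longrightarrow> fst (snd (bump a b)) t = 0"
proof -
  have "\<exists>ypf. case ypf of (y, p, f) \<Rightarrow> triple y p f \<and> y l = a \<and> p l = b \<and> (\<forall>t\<ge>l+1. y t = 0 \<and> p t = 0) \<and> L2_on {l..} y \<and> L2_on {l..} f"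
    using bump_exists[of a b] by simp
  from someI_ex[OF this]
  have "case bump a b of (y, p, f) \<Rightarrow> triple y p f \<and> y l = a \<and> p l = b \<and> (\<forall>t\<ge>l+1. y t = 0 \<and> p t = 0) \<and> L2_on {l..} y \<and> L2_on {l..} f"
    unfolding bump_def .
  then show "max_domain (fst (bump a b)) (fst (snd (bump a b))) (snd (snd (bump a b)))"
  "fst (bump a b) l = a" "fst (snd (bump a b)) l = b"
  "t \<ge> l + 1 \<Longrightarrow> fst (bump a b) t = 0" "t \<ge> l + 1 \<Longrightarrow> fst (snd (bump a b)) t = 0"
    unfolding max_domain_def by (auto split: prod.splits)
qed

lemma \<eta>_props:
  "max_domain (\<eta> a b) (\<eta>' a b) (\<psi> a b)" "\<eta> a b l = a" "\<eta>' a b l = b"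
  "t \<ge> l + 1 \<Longrightarrow> \<eta> a b t = 0" "t \<ge> l + 1 \<Longrightarrow> \<eta>' a b t = 0"
  using max_domain_add[OF max_domain_scale[OF bump(1)] max_domain_scale[OF bump(1)]]
  by (simp_all add: \<eta>_def \<eta>'_def \<psi>_def bump)

definition bump_const :: real where
  "bump_const = norm_sq {l..} (fst (bump 1 0)) + norm_sq {l..} (fst (bump 0 1)) + norm_sq {l..} (snd (snd (bump 1 0))) + norm_sq {l..} (snd (snd (bump 0 1)))"

lemma bump_const_nonneg: "bump_const \<ge> 0"
  by (simp add: bump_const_def norm_sq_nonneg)

lemma norm_sq_\<eta>_le: "norm_sq {l..} (\<eta> a b) \<le> 2 * bump_const * ((cmod a)\<^sup>2 + (cmod b)\<^sup>2)"
  and norm_sq_\<psi>_le: "norm_sq {l..} (\<psi> a b) \<le> 2 * bump_const * ((cmod a)\<^sup>2 + (cmod b)\<^sup>2)"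
proof -
  have aux: "norm_sq {l..} (\<lambda>t. a * f t + b * g t) \<le> 2 * bump_const * ((cmod a)\<^sup>2 + (cmod b)\<^sup>2)"
    if "L2_on {l..} f" "L2_on {l..} g" "norm_sq {l..} f \<le> bump_const" "norm_sq {l..} g \<le> bump_const" for f g
  proof -
    have "norm_sq {l..} (\<lambda>t. a * f t + b * g t) \<le> 2 * ((cmod a)\<^sup>2 * norm_sq {l..} f) + 2 * ((cmod b)\<^sup>2 * norm_sq {l..} g)"
      using L2_on_add(2)[OF L2_on_scale[OF that(1)] L2_on_scale[OF that(2)], of a b] by (simp add: norm_sq_scale)
    also have "\<dots> \<le> 2 * ((cmod a)\<^sup>2 * bump_const) + 2 * ((cmod b)\<^sup>2 * bump_const)"
      using that by (intro add_mono mult_left_mono) auto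
    finally show ?thesis by (simp add: algebra_simps)
  qed
  note n = norm_sq_nonneg[of "{l..}"]
  show "norm_sq {l..} (\<eta> a b) \<le> 2 * bump_const * ((cmod a)\<^sup>2 + (cmod b)\<^sup>2)"
    unfolding \<eta>_def using bump(1)[of 1 0] bump(1)[of 0 1]
    by (intro aux) (auto simp: max_domain_def bump_const_def intro!: add_nonneg_nonneg n)
  show "norm_sq {l..} (\<psi> a b) \<le> 2 * bump_const * ((cmod a)\<^sup>2 + (cmod b)\<^sup>2)"
    unfolding \<psi>_def using bump(1)[of 1 0] bump(1)[of 0 1]
    by (intro aux) (auto simp: max_domain_def bump_const_def intro!: add_nonneg_nonneg n)
qed

section \<open>A priori bounds and existence of square integrable solutions\<close>

definition K_bound :: "real \<Rightarrow> complex \<Rightarrow> real" where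
  "K_bound d z = 8 * bump_const * ((1 + (cmod z)\<^sup>2) / d\<^sup>2 + 1)"

lemma K_bound_nonneg: "K_bound d z \<ge> 0"
  using bump_const_nonneg by (auto simp: K_bound_def intro!: mult_nonneg_nonneg add_nonneg_nonneg)

lemma K_bound_mono: "0 < d \<Longrightarrow> d \<le> d' \<Longrightarrow> cmod z' \<le> cmod z \<Longrightarrow> K_bound d' z' \<le> K_bound d z"
  unfolding K_bound_def using bump_const_nonneg
  by (intro mult_left_mono add_mono frac_le power_mono order_refl) (auto intro!: add_pos_nonneg)

text \<open>U - \<eta> has zero Cauchy data at l, and the differential expression minus z sends it
  to z \<eta> - \<psi>, which depends on the data only; \<open>le\<close> expresses coercivity
  there. \<open>K_bound\<close> collects the factors from |a + b|^2 <= 2 |a|^2 + 2 |b|^2. S will be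
  [l,c] or [l,oo).\<close>

lemma apriori_bound:
  assumes S: "S \<in> sets borel" "S \<subseteq> {l..}" and U: "L2_on S (U z a b)" and d: "d > 0"
    and le: "d\<^sup>2 * norm_sq S (\<lambda>t. U z a b t - \<eta> a b t) \<le> norm_sq S (\<lambda>t. z * \<eta> a b t - \<psi> a b t)"
  shows "norm_sq S (U z a b) \<le> K_bound d z * ((cmod a)\<^sup>2 + (cmod b)\<^sup>2)"
proof -
  define N where "N = (cmod a)\<^sup>2 + (cmod b)\<^sup>2"
  have s: "L2_on {l..} (\<eta> a b)" "L2_on {l..} (\<psi> a b)" using \<eta>_props(1)[of a b] by (auto simp: max_domain_def)
  then have s': "L2_on S (\<eta> a b)" "L2_on S (\<psi> a b)" using S by (auto intro: L2_on_subset)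
  have n1: "norm_sq S (\<eta> a b) \<le> 2 * bump_const * N" "norm_sq S (\<psi> a b) \<le> 2 * bump_const * N"
    unfolding N_def using norm_sq_mono[OF s(1) S] norm_sq_mono[OF s(2) S] norm_sq_\<eta>_le[of a b] norm_sq_\<psi>_le[of a b] by linarith+
  have "norm_sq S (\<lambda>t. z * \<eta> a b t - \<psi> a b t) \<le> 2 * ((cmod z)\<^sup>2 * norm_sq S (\<eta> a b)) + 2 * norm_sq S (\<psi> a b)"
    using L2_on_diff(2)[OF L2_on_scale[OF s'(1)] s'(2), of z] by (simp add: norm_sq_scale)
  also have "\<dots> \<le> 2 * ((cmod z)\<^sup>2 * (2 * bump_const * N)) + 2 * (2 * bump_const * N)"
    using n1 by (intro add_mono mult_left_mono) auto
  also have "\<dots> = 4 * bump_const * (1 + (cmod z)\<^sup>2) * N" by (simp add: algebra_simps)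
  finally have "d\<^sup>2 * norm_sq S (\<lambda>t. U z a b t - \<eta> a b t) \<le> 4 * bump_const * (1 + (cmod z)\<^sup>2) * N"
    using le by linarith
  then have 1: "norm_sq S (\<lambda>t. U z a b t - \<eta> a b t) \<le> 4 * bump_const * (1 + (cmod z)\<^sup>2) * N / d\<^sup>2"
    using d by (simp add: pos_le_divide_eq mult.commute)
  have "norm_sq S (U z a b) \<le> 2 * norm_sq S (\<lambda>t. U z a b t - \<eta> a b t) + 2 * norm_sq S (\<eta> a b)"
    using L2_on_add(2)[OF L2_on_diff(1)[OF U s'(1)] s'(1)] by simp
  also have "\<dots> \<le> 2 * (4 * bump_const * (1 + (cmod z)\<^sup>2) * N / d\<^sup>2) + 2 * (2 * bump_const * N)"
    using 1 n1 by linarith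
  also have "\<dots> \<le> K_bound d z * N"
  proof -
    have "0 \<le> bump_const * N" using bump_const_nonneg by (auto simp: N_def intro!: mult_nonneg_nonneg)
    then show ?thesis by (simp add: K_bound_def algebra_simps)
  qed
  finally show ?thesis unfolding N_def .
qed

text \<open>The Dirichlet condition at $c$ makes the boundary terms vanish, so the operator on $[\ell,c]$ is
  symmetric and the bound does not depend on $c$.\<close>

lemma finite_interval_bound:
  assumes z: "Im z \<noteq> 0" and c: "c \<ge> l + 1" and 0: "U z a b c = 0"
  shows "norm_sq {l..c} (U z a b) \<le> K_bound \<bar>Im z\<bar> z * ((cmod a)\<^sup>2 + (cmod b)\<^sup>2)"
proof (rule apriori_bound)
  let ?y = "\<lambda>t. U z a b t - \<eta> a b t" and ?f = "\<lambda>t. z * U z a b t - \<psi> a b t" and ?h = "\<lambda>t. z * \<eta> a b t - \<psi> a b t"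
  have t: "triple ?y (\<lambda>t. V z a b t - \<eta>' a b t) ?f"
    using triple_diff[OF triple_U[of z a b]] \<eta>_props(1) by (simp add: max_domain_def)
  have sy: "L2_on {l..c} ?y" by (rule L2_on_continuous[OF triple_continuous(1)[OF t]])
  have s: "L2_on {l..} (\<eta> a b)" "L2_on {l..} (\<psi> a b)" using \<eta>_props(1)[of a b] by (auto simp: max_domain_def)
  have s': "L2_on {l..c} (\<eta> a b)" "L2_on {l..c} (\<psi> a b)" by (rule L2_on_subset[OF s(1)] L2_on_subset[OF s(2)]; simp)+
  have sh: "L2_on {l..c} ?h" by (intro L2_on_diff L2_on_scale s')
  have feq: "?f t = ?h t + z * ?y t" for t by (simp add: algebra_simps)
  \<comment> \<open>Zero data at l, and zeros of both \<open>?y\<close> and its conjugate at c,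
    remove all boundary terms; \<eta> contributes nothing at c >= l + 1.\<close>
  have "(LINT t:{l..c}|lborel. ?f t * cnj (?y t) - ?y t * cnj (?f t)) = 0"
    using Green_Icc[OF t triple_cnj[OF t], of c] c 0 \<eta>_props(2-5) by simp
  also have "(\<lambda>t. ?f t * cnj (?y t) - ?y t * cnj (?f t)) =
      (\<lambda>t. 2 * \<i> * of_real (Im (?h t * cnj (?y t)) + Im z * (cmod (?y t))\<^sup>2))"
  proof
    fix t
    have "?f t * cnj (?y t) = ?h t * cnj (?y t) + z * of_real ((cmod (?y t))\<^sup>2)"
      unfolding feq complex_norm_square by (simp only: algebra_simps)
    then have "Im (?f t * cnj (?y t)) = Im (?h t * cnj (?y t)) + Im z * (cmod (?y t))\<^sup>2"
      by (simp only: plus_complex.sel Im_mult_of_real)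
    then show "?f t * cnj (?y t) - ?y t * cnj (?f t) = 2 * \<i> * of_real (Im (?h t * cnj (?y t)) + Im z * (cmod (?y t))\<^sup>2)"
      using diff_cnj_conv_Im[of "?f t" "?y t"] by (simp only:)
  qed
  finally have "2 * \<i> * of_real (LINT t:{l..c}|lborel. Im (?h t * cnj (?y t)) + Im z * (cmod (?y t))\<^sup>2) = 0"
    unfolding set_integral_mult_right set_integral_complex_of_real .
  then have 1: "(LINT t:{l..c}|lborel. Im (?h t * cnj (?y t)) + Im z * (cmod (?y t))\<^sup>2) = 0"
    unfolding mult_eq_0_iff of_real_eq_0_iff by (elim disjE) (simp, simp, assumption)
  have ih: "set_integrable lborel {l..c} (\<lambda>t. ?h t * cnj (?y t))"
    by (intro L2_on_mult_integrable sh L2_on_cnj sy)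
  have "indicator {l..c} t *\<^sub>R Im w = Im (indicator {l..c} t *\<^sub>R w)" for t w by simp
  note Im_ind = this
  have 2: "set_integrable lborel {l..c} (\<lambda>t. Im (?h t * cnj (?y t)))"
    using integrable_Im[OF ih[unfolded set_integrable_def]] unfolding set_integrable_def Im_ind .
  have 3: "(LINT t:{l..c}|lborel. Im (?h t * cnj (?y t))) = Im (LINT t:{l..c}|lborel. ?h t * cnj (?y t))"
    using integral_Im[OF ih[unfolded set_integrable_def]] unfolding set_lebesgue_integral_def Im_ind .
  have 4: "set_integrable lborel {l..c} (\<lambda>t. Im z * (cmod (?y t))\<^sup>2)"
    using sy unfolding L2_on_def by (intro set_integrable_mult_right) blast
  have "Im (LINT t:{l..c}|lborel. ?h t * cnj (?y t)) + Im z * norm_sq {l..c} ?y = 0"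
    using 1 unfolding set_integral_add(2)[OF 2 4] 3 set_integral_mult_right norm_sq_def .
  then have "\<bar>Im z\<bar> * norm_sq {l..c} ?y = \<bar>Im (LINT t:{l..c}|lborel. ?h t * cnj (?y t))\<bar>"
  proof -
    assume "Im (LINT t:{l..c}|lborel. ?h t * cnj (?y t)) + Im z * norm_sq {l..c} ?y = 0"
    then have "Im (LINT t:{l..c}|lborel. ?h t * cnj (?y t)) = - (Im z * norm_sq {l..c} ?y)" by linarith
    then show ?thesis unfolding abs_minus_cancel abs_mult abs_of_nonneg[OF norm_sq_nonneg] by (simp only: abs_minus_cancel abs_mult abs_of_nonneg[OF norm_sq_nonneg])
  qed
  also have "\<dots> \<le> cmod (LINT t:{l..c}|lborel. ?h t * cnj (?y t))" by (rule abs_Im_le_cmod)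
  finally show "\<bar>Im z\<bar>\<^sup>2 * norm_sq {l..c} ?y \<le> norm_sq {l..c} ?h"
    by (intro coercivity_estimate sy sh) (use z in auto)
qed (use z in \<open>auto intro: L2_on_continuous triple_continuous(1)[OF triple_U]\<close>)

text \<open>The data lie on the unit sphere of C^2, so a subsequence converges; the solutions then
  converge pointwise, and Fatou's lemma carries the bound to the half-line. The parameter varies
  too, because existence at x < 0 is obtained by letting nonreal points tend to x.\<close>

lemma weak_limit_L2:
  assumes z: "zn \<longlonglongrightarrow> z" and c: "filterlim cn at_top sequentially"
    and unit: "\<And>n. (cmod (an n))\<^sup>2 + (cmod (bn n))\<^sup>2 = 1"
    and bd: "\<And>n. norm_sq {l..cn n} (U (zn n) (an n) (bn n)) \<le> C"
  shows "\<exists>a b. (cmod a)\<^sup>2 + (cmod b)\<^sup>2 = 1 \<and> L2_on {l..} (U z a b)"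
proof -
  have "\<forall>n. (an n, bn n) \<in> sphere 0 1"
    using unit by (simp add: norm_Pair)
  then obtain d r where d: "d \<in> sphere 0 1" and r: "strict_mono r" and lim: "((\<lambda>n. (an n, bn n)) \<circ> r) \<longlonglongrightarrow> d"
    using compact_sphere[of "0 :: complex \<times> complex" 1] unfolding compact_def by meson
  obtain a b where ab: "d = (a, b)" by (cases d)
  have lima: "(\<lambda>n. an (r n)) \<longlonglongrightarrow> a" and limb: "(\<lambda>n. bn (r n)) \<longlonglongrightarrow> b"
    using tendsto_fst[OF lim] tendsto_snd[OF lim] by (simp_all add: ab o_def)
  have limz: "(\<lambda>n. zn (r n)) \<longlonglongrightarrow> z" using LIMSEQ_subseq_LIMSEQ[OF z r] by (simp add: o_def)
  have limc: "filterlim (\<lambda>n. cn (r n)) at_top sequentially"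
    using filterlim_compose[OF c filterlim_subseq[OF r]] .
  have unit': "(cmod a)\<^sup>2 + (cmod b)\<^sup>2 = 1"
    using d by (simp add: ab norm_Pair)
  define u where "u = (\<lambda>n t. indicator {l..cn (r n)} t *\<^sub>R (cmod (U (zn (r n)) (an (r n)) (bn (r n)) t))\<^sup>2)"
  have iu: "integrable lborel (u n)" for n
    using L2_on_continuous[OF triple_continuous(1)[OF triple_U]] by (simp add: L2_on_def set_integrable_def u_def)
  have pw: "(\<lambda>n. u n t) \<longlonglongrightarrow> indicator {l..} t *\<^sub>R (cmod (U z a b t))\<^sup>2" for t
  proof (cases "t \<ge> l")
    case True
    have "(\<lambda>n. (cmod (U (zn (r n)) (an (r n)) (bn (r n)) t))\<^sup>2) \<longlonglongrightarrow> (cmod (U z a b t))\<^sup>2"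
      by (intro tendsto_intros U_tendsto limz lima limb True)
    moreover have "\<forall>\<^sub>F n in sequentially. (cmod (U (zn (r n)) (an (r n)) (bn (r n)) t))\<^sup>2 = u n t"
      using limc[unfolded filterlim_at_top, rule_format, of t] by eventually_elim (use True in \<open>simp add: u_def\<close>)
    ultimately show ?thesis using True by (auto simp: elim: Lim_transform_eventually)
  qed (simp add: u_def)
  have "(\<integral>\<^sup>+ t. ennreal (indicator {l..} t *\<^sub>R (cmod (U z a b t))\<^sup>2) \<partial>lborel) = (\<integral>\<^sup>+ t. liminf (\<lambda>n. ennreal (u n t)) \<partial>lborel)"
    by (intro nn_integral_cong lim_imp_Liminf[symmetric] tendsto_ennrealI pw) auto
  also have "\<dots> \<le> liminf (\<lambda>n. \<integral>\<^sup>+ t. ennreal (u n t) \<partial>lborel)"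
    by (intro nn_integral_liminf measurable_compose[OF borel_measurable_integrable[OF iu] measurable_ennreal])
  also have "\<dots> \<le> liminf (\<lambda>n. ennreal C)"
  proof (intro Liminf_mono always_eventually allI)
    fix n
    have "(\<integral>\<^sup>+ t. ennreal (u n t) \<partial>lborel) = ennreal (LINT t|lborel. u n t)"
      by (rule nn_integral_eq_integral[OF iu]) (auto simp: u_def)
    also have "(LINT t|lborel. u n t) \<le> C"
      using bd[of "r n"] by (simp add: norm_sq_def set_lebesgue_integral_def u_def)
    finally show "(\<integral>\<^sup>+ t. ennreal (u n t) \<partial>lborel) \<le> ennreal C" by (simp add: ennreal_leI)
  qed
  also have "\<dots> < \<infinity>" by (simp add: Liminf_const)
  finally have fin: "(\<integral>\<^sup>+ t. ennreal (indicator {l..} t *\<^sub>R (cmod (U z a b t))\<^sup>2) \<partial>lborel) < \<infinity>" .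
  have m: "set_borel_measurable lborel {l..} (U z a b)" by (rule triple_measurable(1)[OF triple_U])
  have "integrable lborel (\<lambda>t. indicator {l..} t *\<^sub>R (cmod (U z a b t))\<^sup>2)"
  proof (rule integrableI_nonneg[OF _ _ fin])
    show "(\<lambda>t. indicator {l..} t *\<^sub>R (cmod (U z a b t))\<^sup>2) \<in> borel_measurable lborel"
      using set_borel_measurable_norm_sq[OF m] by (simp add: set_borel_measurable_def)
  qed auto
  then have "L2_on {l..} (U z a b)" using m by (simp add: L2_on_def set_integrable_def)
  then show ?thesis using unit' by blast
qed

lemma unit_multiple:
  assumes "a \<noteq> 0 \<or> b \<noteq> (0::complex)"
  shows "\<exists>k. k \<noteq> 0 \<and> (cmod (k * a))\<^sup>2 + (cmod (k * b))\<^sup>2 = 1"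
proof -
  define N where "N = (cmod a)\<^sup>2 + (cmod b)\<^sup>2"
  have N: "N > 0" using assms by (auto simp: N_def add_pos_nonneg add_nonneg_pos)
  have k: "(cmod (of_real (1 / sqrt N) * c))\<^sup>2 = (cmod c)\<^sup>2 / N" for c
    using N by (simp add: norm_mult power_mult_distrib norm_divide power_divide)
  have "(cmod a)\<^sup>2 / N + (cmod b)\<^sup>2 / N = 1"
    using N by (simp only: add_divide_distrib[symmetric] N_def[symmetric]) simp
  then have "(cmod (of_real (1 / sqrt N) * a))\<^sup>2 + (cmod (of_real (1 / sqrt N) * b))\<^sup>2 = 1"
    unfolding k .
  then show ?thesis using N by (intro exI[of _ "of_real (1 / sqrt N)"]) auto
qed

lemma U_scale: "U z (k * a) (k * b) t = k * U z a b t"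
  by (simp add: U_def algebra_simps)

text \<open>For each c some unit vector of data gives a solution vanishing at c. The bound of
  \<open>finite_interval_bound\<close> is uniform in c, so these data have a limit whose solution
  lies in L2.\<close>

lemma L2_solution_nonreal:
  assumes z: "Im z \<noteq> 0"
  shows "\<exists>a b. (cmod a)\<^sup>2 + (cmod b)\<^sup>2 = 1 \<and> L2_on {l..} (U z a b)"
proof -
  have "\<exists>a b. (cmod a)\<^sup>2 + (cmod b)\<^sup>2 = 1 \<and> U z a b c = 0" for c
  proof (cases "U z 1 0 c = 0")
    case True
    then show ?thesis by (intro exI[of _ 1] exI[of _ 0]) auto
  next
    case False
    define a where "a = U z 0 1 c" define b where "b = - U z 1 0 c"
    have "a \<noteq> 0 \<or> b \<noteq> 0" using False by (simp add: b_def)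
    from unit_multiple[OF this] obtain k where "(cmod (k * a))\<^sup>2 + (cmod (k * b))\<^sup>2 = 1" by blast
    moreover have "U z a b c = 0" by (simp add: U_def a_def b_def)
    ultimately show ?thesis using U_scale[of z k a b c] by auto
  qed
  then have "\<forall>n. \<exists>a b. (cmod a)\<^sup>2 + (cmod b)\<^sup>2 = 1 \<and> U z a b (l + 1 + real n) = 0" by blast
  then obtain an bn where *: "\<And>n. (cmod (an n))\<^sup>2 + (cmod (bn n))\<^sup>2 = 1" "\<And>n. U z (an n) (bn n) (l + 1 + real n) = 0"
    unfolding choice_iff by blast
  show ?thesis
  proof (rule weak_limit_L2[OF tendsto_const _ *(1)])
    show "filterlim (\<lambda>n. l + 1 + real n) at_top sequentially"
      by (rule filterlim_tendsto_add_at_top[OF tendsto_const filterlim_real_sequentially])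
    show "norm_sq {l..l + 1 + real n} (U z (an n) (bn n)) \<le> K_bound \<bar>Im z\<bar> z" for n
      using finite_interval_bound[OF z _ *(2)[of n]] *(1)[of n] by simp
  qed
qed

end

section \<open>The minimal operator: symmetry, coercivity, Green's formula\<close>

locale nonneg_schroedinger = schroedinger +
  assumes nonneg: "min_op_nonneg q l"
begin

definition min_domain :: "(real \<Rightarrow> complex) \<Rightarrow> (real \<Rightarrow> complex) \<Rightarrow> bool" where
  "min_domain y f \<longleftrightarrow> (\<exists>p. max_domain y p f \<and> y l = 0 \<and> p l = 0)"

lemma min_domainI: "max_domain y p f \<Longrightarrow> y l = 0 \<Longrightarrow> p l = 0 \<Longrightarrow> min_domain y f"
  by (auto simp: min_domain_def)

lemma min_domain_L2_on: "min_domain y f \<Longrightarrow> L2_on {l..} y" "min_domain y f \<Longrightarrow> L2_on {l..} f"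
  by (auto simp: min_domain_def max_domain_def)

lemma min_domain_add_scale: "min_domain y f \<Longrightarrow> min_domain v g \<Longrightarrow> min_domain (\<lambda>t. y t + c * v t) (\<lambda>t. f t + c * g t)"
  unfolding min_domain_def by (elim exE conjE, rule exI, rule conjI, erule max_domain_add, erule max_domain_scale) simp

lemma min_domain_form:
  assumes "min_domain y f"
  shows "Im (pairing l f (\<lambda>t. cnj (y t))) = 0" "Re (pairing l f (\<lambda>t. cnj (y t))) \<ge> 0"
proof -
  obtain p where p: "triple y p f" "L2_on {l..} y" "L2_on {l..} f" "y l = 0" "p l = 0"
    using assms by (auto simp: min_domain_def max_domain_def)
  have "min_dom q l y f"
    unfolding min_dom_def
  proof (intro conjI exI[of _ p] allI impI)
    fix x assume x: "x \<ge> l"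
    show "y x = (LINT t:{l..x}|lborel. p t)" using tripleD(3)[OF p(1) x] unfolding p(4) add_0 .
    show "p x = (LINT t:{l..x}|lborel. of_real (q t) * y t - f t)" using tripleD(4)[OF p(1) x] unfolding p(5) add_0 .
  qed (use p tripleD(1,2)[OF p(1)] L2_on_L2_half in blast)+
  then show "Im (pairing l f (\<lambda>t. cnj (y t))) = 0" "Re (pairing l f (\<lambda>t. cnj (y t))) \<ge> 0"
    using nonneg by (simp_all add: min_op_nonneg_def pairing_def)
qed

text \<open>Polarisation: reality of the form at y + v and at y + i v forces the two mixed terms to
  be conjugate to each other.\<close>

lemma min_domain_symmetric:
  assumes y: "min_domain y f" and v: "min_domain v g"
  shows "pairing l f (\<lambda>t. cnj (v t)) = pairing l y (\<lambda>t. cnj (g t))"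
proof -
  note s = min_domain_L2_on[OF y] min_domain_L2_on[OF v]
  define X where "X = pairing l f (\<lambda>t. cnj (v t))"
  define Y where "Y = pairing l g (\<lambda>t. cnj (y t))"
  have exp: "pairing l (\<lambda>t. f t + c * g t) (\<lambda>t. cnj (y t + c * v t)) =
    pairing l f (\<lambda>t. cnj (y t)) + cnj c * X + c * Y + c * cnj c * pairing l g (\<lambda>t. cnj (v t))" for c
    by (simp add: X_def Y_def pairing_add_left pairing_add_right s L2_on_cnj L2_on_scale L2_on_add pairing_scale_left pairing_scale_right algebra_simps)
  have "Im (pairing l (\<lambda>t. f t + c * g t) (\<lambda>t. cnj (y t + c * v t))) = 0" for c
    by (rule min_domain_form(1)[OF min_domain_add_scale[OF y v]])
  then have "Im (cnj c * X + c * Y + c * cnj c * pairing l g (\<lambda>t. cnj (v t))) = 0" for c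
    unfolding exp using min_domain_form(1)[OF y] by simp
  from this[of 1] this[of \<i>] have "Im X + Im Y = 0" "Re Y = Re X"
    using min_domain_form(1)[OF v] by auto
  then have "X = cnj Y" by (simp add: complex_eq_iff)
  also have "\<dots> = pairing l y (\<lambda>t. cnj (g t))" unfolding Y_def cnj_pairing by (subst pairing_commute) simp
  finally show ?thesis unfolding X_def .
qed

text \<open>Subtracting bumps does not change the Wronskian beyond l + 1, and for the corrected pair
  its limit is zero by symmetry.\<close>

lemma Green_at_infinity:
  assumes y: "max_domain y p f" and v: "max_domain v r g"
  shows "pairing l f v - pairing l y g = p l * v l - y l * r l"
proof -
  let ?y = "\<lambda>t. y t - \<eta> (y l) (p l) t" and ?p = "\<lambda>t. p t - \<eta>' (y l) (p l) t" and ?f = "\<lambda>t. f t - \<psi> (y l) (p l) t"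
  let ?v = "\<lambda>t. v t - \<eta> (v l) (r l) t" and ?r = "\<lambda>t. r t - \<eta>' (v l) (r l) t" and ?g = "\<lambda>t. g t - \<psi> (v l) (r l) t"
  have y0: "max_domain ?y ?p ?f" and v0: "max_domain ?v ?r ?g" by (intro max_domain_diff y v \<eta>_props)+
  have z: "?y l = 0" "?p l = 0" "?v l = 0" "?r l = 0" by (simp_all add: \<eta>_props)
  have my: "min_domain ?y ?f" by (rule min_domainI[OF y0]) (rule z)+
  \<comment> \<open>Symmetry is sesquilinear while this formula is bilinear; conjugating the second
    function mediates between the two.\<close>
  have mv: "min_domain (\<lambda>t. cnj (?v t)) (\<lambda>t. cnj (?g t))" by (rule min_domainI[OF max_domain_cnj[OF v0]]) (simp_all add: \<eta>_props)
  have 0: "pairing l ?f ?v - pairing l ?y ?g = 0"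
    using min_domain_symmetric[OF my mv] unfolding complex_cnj_cnj by simp
  \<comment> \<open>Applied twice: to the corrected pair it shows that the Wronskian tends to zero,
    to the original pair it identifies the same limit with the boundary terms.\<close>
  have lim: "((\<lambda>b. y b * r b - p b * v b) \<longlongrightarrow> y l * r l - p l * v l + (pairing l f v - pairing l y g)) at_top"
    if y: "max_domain y p f" and v: "max_domain v r g" for y p f v r g
  proof -
    have i: "set_integrable lborel {l..} (\<lambda>t. f t * v t)" "set_integrable lborel {l..} (\<lambda>t. y t * g t)"
      using y v by (auto simp: max_domain_def intro: L2_on_mult_integrable)
    have "((\<lambda>b. y l * r l - p l * v l + (LINT t:{l..b}|lborel. f t * v t - y t * g t)) \<longlongrightarrow>
       y l * r l - p l * v l + (LINT t:{l..}|lborel. f t * v t - y t * g t)) at_top"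
      by (intro tendsto_add tendsto_const tendsto_set_lebesgue_integral_at_top set_integral_diff(1)[OF i]) auto
    also have "(LINT t:{l..}|lborel. f t * v t - y t * g t) = pairing l f v - pairing l y g"
      unfolding pairing_def by (rule set_integral_diff(2)[OF i])
    finally have lim: "((\<lambda>b. y l * r l - p l * v l + (LINT t:{l..b}|lborel. f t * v t - y t * g t)) \<longlongrightarrow>
       y l * r l - p l * v l + (pairing l f v - pairing l y g)) at_top" .
    have ty: "triple y p f" and tv: "triple v r g" using y v by (simp_all add: max_domain_def)
    have "\<forall>\<^sub>F b in at_top. y l * r l - p l * v l + (LINT t:{l..b}|lborel. f t * v t - y t * g t) = y b * r b - p b * v b"
      using eventually_ge_at_top[of l] by eventually_elim (rule Green_Icc[OF ty tv, symmetric])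
    then show ?thesis by (rule Lim_transform_eventually[OF lim])
  qed
  have "((\<lambda>b. ?y b * ?r b - ?p b * ?v b) \<longlongrightarrow> 0) at_top"
    using lim[OF y0 v0] unfolding z 0 mult_zero_left diff_self add_0 .
  moreover have "\<forall>\<^sub>F b in at_top. ?y b * ?r b - ?p b * ?v b = y b * r b - p b * v b"
    using eventually_ge_at_top[of "l+1"] by eventually_elim (simp add: \<eta>_props)
  ultimately have "((\<lambda>b. y b * r b - p b * v b) \<longlongrightarrow> 0) at_top"
    by (rule Lim_transform_eventually)
  from tendsto_unique[OF _ this lim[OF y v]] show ?thesis by (simp add: algebra_simps)
qed

text \<open>Pair f - z y with y. As the form is real and non-negative, the imaginary part is -Im z
  times \<open>norm_sq\<close>, and the real part is at least -Re z times it; \<open>gap\<close>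
  combines both bounds.\<close>

lemma min_domain_coercive:
  assumes y: "min_domain y f" and z: "z \<in> resolvent"
  shows "(gap z)\<^sup>2 * norm_sq {l..} y \<le> norm_sq {l..} (\<lambda>t. f t - z * y t)"
proof (rule coercivity_estimate)
  note s = min_domain_L2_on[OF y]
  show "L2_on {l..} y" "L2_on {l..} (\<lambda>t. f t - z * y t)" by (intro s L2_on_diff L2_on_scale)+
  show "gap z > 0" by (rule gap_pos[OF z])
  define H where "H = (LINT t:{l..}|lborel. (f t - z * y t) * cnj (y t))"
  have "H = pairing l f (\<lambda>t. cnj (y t)) - z * norm_sq {l..} y"
    unfolding H_def pairing_def[symmetric] by (simp add: pairing_diff_left s L2_on_scale L2_on_cnj pairing_scale_left pairing_cnj_self)
  then have "Im H = - Im z * norm_sq {l..} y" "Re H \<ge> - Re z * norm_sq {l..} y"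
    using min_domain_form[OF y] by simp_all
  moreover have "\<bar>Im H\<bar> \<le> cmod H" "Re H \<le> cmod H" by (rule abs_Im_le_cmod complex_Re_le_cmod)+
  ultimately have "\<bar>Im z\<bar> * norm_sq {l..} y \<le> cmod H" "- Re z * norm_sq {l..} y \<le> cmod H"
    by (auto simp: abs_mult norm_sq_nonneg)
  then show "gap z * norm_sq {l..} y \<le> cmod H" by (auto simp: gap_def max_def)
qed

lemma L2_solution_bound:
  assumes z: "z \<in> resolvent" and s: "L2_on {l..} (U z a b)"
  shows "norm_sq {l..} (U z a b) \<le> K_bound (gap z) z * ((cmod a)\<^sup>2 + (cmod b)\<^sup>2)"
proof (rule apriori_bound)
  have "min_domain (\<lambda>t. U z a b t - \<eta> a b t) (\<lambda>t. z * U z a b t - \<psi> a b t)"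
    by (rule min_domainI[OF max_domain_diff[OF max_domain_U[OF s] \<eta>_props(1)]]) (simp_all add: \<eta>_props)
  from min_domain_coercive[OF this z]
  show "(gap z)\<^sup>2 * norm_sq {l..} (\<lambda>t. U z a b t - \<eta> a b t) \<le> norm_sq {l..} (\<lambda>t. z * \<eta> a b t - \<psi> a b t)"
    by (simp add: algebra_simps)
qed (use s gap_pos[OF z] in auto)

text \<open>At the points x + i/(n+1) the value of \<open>gap\<close> is at least -x, so the
  solutions in L2 there have uniformly bounded norms and \<open>weak_limit_L2\<close>
  applies.\<close>

lemma L2_solution_negative:
  assumes x: "x < 0"
  shows "\<exists>a b. (cmod a)\<^sup>2 + (cmod b)\<^sup>2 = 1 \<and> L2_on {l..} (U (of_real x) a b)"
proof -
  define zn where "zn = (\<lambda>n. Complex x (1 / real (Suc n)))"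
  have "\<forall>n. \<exists>a b. (cmod a)\<^sup>2 + (cmod b)\<^sup>2 = 1 \<and> L2_on {l..} (U (zn n) a b)"
    by (rule allI, rule L2_solution_nonreal) (simp add: zn_def)
  then obtain an bn where *: "\<And>n. (cmod (an n))\<^sup>2 + (cmod (bn n))\<^sup>2 = 1" "\<And>n. L2_on {l..} (U (zn n) (an n) (bn n))"
    unfolding choice_iff by blast
  have lim: "zn \<longlonglongrightarrow> of_real x"
    unfolding tendsto_complex_iff zn_def using LIMSEQ_inverse_real_of_nat by (simp add: divide_inverse)
  show ?thesis
  proof (rule weak_limit_L2[OF lim filterlim_real_sequentially *(1)])
    fix n
    have zO: "zn n \<in> resolvent" by (simp add: resolvent_def zn_def)
    have "norm_sq {l..real n} (U (zn n) (an n) (bn n)) \<le> norm_sq {l..} (U (zn n) (an n) (bn n))"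
      by (rule norm_sq_mono[OF *(2)]) auto
    also have "\<dots> \<le> K_bound (gap (zn n)) (zn n)"
      using L2_solution_bound[OF zO *(2)] *(1)[of n] by simp
    also have "\<dots> \<le> K_bound (-x) (of_real (\<bar>x\<bar> + 1))"
    proof (rule K_bound_mono)
      have "cmod (zn n) \<le> \<bar>x\<bar> + \<bar>1 / real (Suc n)\<bar>"
        using cmod_le[of "zn n"] by (simp add: zn_def)
      also have "\<bar>1 / real (Suc n)\<bar> \<le> 1" by simp
      finally show "cmod (zn n) \<le> cmod (of_real (\<bar>x\<bar> + 1))"
        unfolding norm_of_real by simp
    qed (use x in \<open>auto simp: gap_def zn_def\<close>)
    finally show "norm_sq {l..real n} (U (zn n) (an n) (bn n)) \<le> K_bound (-x) (of_real (\<bar>x\<bar> + 1))" .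
  qed
qed

lemma L2_solution_exists:
  assumes "z \<in> resolvent"
  shows "\<exists>a b. (cmod a)\<^sup>2 + (cmod b)\<^sup>2 = 1 \<and> L2_on {l..} (U z a b)"
proof (cases "Im z = 0")
  case True
  then have *: "of_real (Re z) = z" "Re z < 0" using assms by (auto simp: resolvent_def complex_eq_iff)
  show ?thesis using L2_solution_negative[OF *(2)] unfolding *(1) .
qed (rule L2_solution_nonreal)

text \<open>For z = w the left side is zero: two solutions in L2 have proportional data, whence
  uniqueness of the Weyl solution.\<close>

lemma L2_solution_Wronskian:
  assumes "L2_on {l..} (U z a b)" "L2_on {l..} (U w a' b')"
  shows "(z - w) * pairing l (U z a b) (U w a' b') = b * a' - a * b'"
  using Green_at_infinity[OF max_domain_U[OF assms(1)] max_domain_U[OF assms(2)]]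
  by (simp add: pairing_scale_left pairing_scale_right algebra_simps)

section \<open>The Weyl-Titchmarsh function\<close>

text \<open>\<open>dirichlet z\<close> says that $z$ is an eigenvalue for the condition $y(\ell) = 0$, that is, a pole of
  the Weyl function; outside \<open>weyl_domain\<close> the value of \<open>weyl_m\<close> is junk.\<close>

definition dirichlet :: "complex \<Rightarrow> bool" where "dirichlet z \<longleftrightarrow> L2_on {l..} (U z 0 1)"
definition weyl_m :: "complex \<Rightarrow> complex" where "weyl_m z = (THE m. L2_on {l..} (U z (-1) m))"
definition weyl :: "complex \<Rightarrow> real \<Rightarrow> complex" where "weyl z = U z (-1) (weyl_m z)"

lemma L2_on_U_scale: "L2_on {l..} (U z a b) \<Longrightarrow> L2_on {l..} (U z (k * a) (k * b))"
  using L2_on_scale[of "{l..}" "U z a b" k] unfolding U_scale[symmetric] by simp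

lemma norm_sq_U_pos:
  assumes "L2_on {l..} (U z a b)" "a \<noteq> 0 \<or> b \<noteq> 0"
  shows "norm_sq {l..} (U z a b) > 0"
proof (rule ccontr)
  assume "\<not> ?thesis"
  then have "norm_sq {l..l+1} (U z a b) = 0"
    using norm_sq_mono[OF assms(1), of "{l..l+1}"] norm_sq_nonneg[of "{l..l+1}" "U z a b"] by auto
  from norm_sq_zero_imp_data_zero[OF this] assms(2) show False by auto
qed

lemma weyl_exists:
  assumes z: "z \<in> resolvent" and d: "\<not> dirichlet z"
  shows "L2_on {l..} (weyl z)" "L2_on {l..} (U z (-1) m) \<Longrightarrow> m = weyl_m z"
proof -
  obtain a b where ab: "(cmod a)\<^sup>2 + (cmod b)\<^sup>2 = 1" "L2_on {l..} (U z a b)"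
    using L2_solution_exists[OF z] by blast
  have "a \<noteq> 0"
  proof
    assume a: "a = 0"
    then have "b \<noteq> 0" using ab by auto
    then have "L2_on {l..} (U z 0 1)" using L2_on_U_scale[OF ab(2), of "1 / b"] a by simp
    then show False using d by (simp add: dirichlet_def)
  qed
  then have ex: "L2_on {l..} (U z (-1) (- b / a))" using L2_on_U_scale[OF ab(2), of "- 1 / a"] by simp
  have uniq: "m = m'" if "L2_on {l..} (U z (-1) m)" "L2_on {l..} (U z (-1) m')" for m m'
    using L2_solution_Wronskian[OF that] by simp
  have "\<exists>!m. L2_on {l..} (U z (-1) m)" using ex uniq by blast
  from theI'[OF this] have th: "L2_on {l..} (U z (-1) (weyl_m z))" unfolding weyl_m_def .
  then show "L2_on {l..} (weyl z)" unfolding weyl_def .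
  show "L2_on {l..} (U z (-1) m) \<Longrightarrow> m = weyl_m z" using uniq th by blast
qed

text \<open>The predicates under the two \<open>THE\<close> agree for every z and m, so the equality
  extends even to points where the description has no meaning.\<close>

lemma m_inf_eq_weyl_m: "m_inf q l z = weyl_m z"
proof -
  have "(\<exists>y1 p1 y2 p2.
      sol q l z y1 p1 \<and> y1 l = 0 \<and> p1 l = 1 \<and>
      sol q l z y2 p2 \<and> y2 l = -1 \<and> p2 l = 0 \<and>
      L2_half l (\<lambda>x. y2 x + m * y1 x)) \<longleftrightarrow> L2_on {l..} (U z (-1) m)" for m
  proof
    assume "L2_on {l..} (U z (-1) m)"
    moreover have "U z (-1) m = (\<lambda>x. U z (-1) 0 x + m * U z 0 1 x)"
      by (simp add: U_def algebra_simps)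
    ultimately have "L2_half l (\<lambda>x. U z (-1) 0 x + m * U z 0 1 x)" by (metis L2_on_L2_half)
    then show "\<exists>y1 p1 y2 p2.
      sol q l z y1 p1 \<and> y1 l = 0 \<and> p1 l = 1 \<and>
      sol q l z y2 p2 \<and> y2 l = -1 \<and> p2 l = 0 \<and>
      L2_half l (\<lambda>x. y2 x + m * y1 x)"
      by (intro exI[of _ "U z 0 1"] exI[of _ "V z 0 1"] exI[of _ "U z (-1) 0"] exI[of _ "V z (-1) 0"]) (simp add: sol_U)
  next
    assume "\<exists>y1 p1 y2 p2.
      sol q l z y1 p1 \<and> y1 l = 0 \<and> p1 l = 1 \<and>
      sol q l z y2 p2 \<and> y2 l = -1 \<and> p2 l = 0 \<and>
      L2_half l (\<lambda>x. y2 x + m * y1 x)"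
    then obtain y1 p1 y2 p2 where y: "sol q l z y1 p1" "y1 l = 0" "p1 l = 1"
      "sol q l z y2 p2" "y2 l = -1" "p2 l = 0" and L: "L2_half l (\<lambda>x. y2 x + m * y1 x)" by blast
    have eq: "y2 x + m * y1 x = U z (-1) m x" if "x \<in> {l..}" for x
    proof -
      have "y1 x = U z 0 1 x" using sol_eq_U(1)[OF y(1), of x] that unfolding y(2,3) by simp
      moreover have "y2 x = U z (-1) 0 x" using sol_eq_U(1)[OF y(4), of x] that unfolding y(5,6) by simp
      ultimately show ?thesis by (simp add: U_def algebra_simps)
    qed
    have "L2_half l (U z (-1) m)"
      using L unfolding L2_half_def by (subst set_integrable_cong[OF refl refl]) (auto simp: eq)
    then show "L2_on {l..} (U z (-1) m)" by (simp add: L2_on_U_iff)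
  qed
  then show ?thesis unfolding m_inf_def weyl_m_def by simp
qed

lemma not_dirichlet_nonreal: "Im z \<noteq> 0 \<Longrightarrow> \<not> dirichlet z"
proof
  assume z: "Im z \<noteq> 0" and "dirichlet z"
  then have s: "L2_on {l..} (U z 0 1)" by (simp add: dirichlet_def)
  have "z * of_real (norm_sq {l..} (U z 0 1)) - cnj z * of_real (norm_sq {l..} (U z 0 1)) = 0"
    using Green_at_infinity[OF max_domain_U[OF s] max_domain_cnj[OF max_domain_U[OF s]]]
    by (simp add: pairing_scale_left pairing_scale_right pairing_cnj_self)
  then have "(z - cnj z) * of_real (norm_sq {l..} (U z 0 1)) = 0" by (simp only: left_diff_distrib)
  moreover have "z - cnj z \<noteq> 0" using z by (simp add: complex_eq_iff)
  ultimately show False using norm_sq_U_pos[OF s] by simp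
qed

text \<open>Provisional: it turns out to be \<open>resolvent\<close> once negative Dirichlet
  eigenvalues are excluded. Until then the lemmas on derivatives carry membership near the point as
  an assumption.\<close>

definition weyl_domain :: "complex set" where "weyl_domain = {z \<in> resolvent. \<not> dirichlet z}"

lemma weyl_domainD: "z \<in> weyl_domain \<Longrightarrow> z \<in> resolvent" "z \<in> weyl_domain \<Longrightarrow> \<not> dirichlet z"
  by (auto simp: weyl_domain_def)

lemma weyl_domain_nonreal: "Im z \<noteq> 0 \<Longrightarrow> z \<in> weyl_domain"
  by (auto simp: weyl_domain_def not_dirichlet_nonreal resolvent_def)

lemma weyl_L2_on: "z \<in> weyl_domain \<Longrightarrow> L2_on {l..} (weyl z)"
  by (auto simp: weyl_domain_def intro: weyl_exists)

lemma weyl_norm_sq_pos: "z \<in> weyl_domain \<Longrightarrow> norm_sq {l..} (weyl z) > 0"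
  using norm_sq_U_pos[of z "-1" "weyl_m z"] weyl_L2_on[of z] by (simp add: weyl_def)

lemma weyl_m_diff:
  assumes "z \<in> weyl_domain" "w \<in> weyl_domain"
  shows "(z - w) * pairing l (weyl z) (weyl w) = weyl_m w - weyl_m z"
  using L2_solution_Wronskian[OF weyl_L2_on[OF assms(1), unfolded weyl_def] weyl_L2_on[OF assms(2), unfolded weyl_def]]
  by (simp add: weyl_def)

lemma weyl_m_cnj:
  assumes "z \<in> weyl_domain"
  shows "weyl_m (cnj z) = cnj (weyl_m z)" "t \<ge> l \<Longrightarrow> cnj (weyl z t) = weyl (cnj z) t"
proof -
  have g: "cnj z \<in> weyl_domain"
  proof (cases "Im z = 0")
    case True then have "cnj z = z" by (simp add: complex_eq_iff)
    then show ?thesis using assms by simp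
  qed (auto intro: weyl_domain_nonreal)
  have "L2_on {l..} (\<lambda>t. cnj (weyl z t))" using weyl_L2_on[OF assms] by (rule L2_on_cnj)
  then have "L2_half l (\<lambda>t. cnj (weyl z t))" by (rule L2_on_L2_half)
  then have "L2_half l (U (cnj z) (-1) (cnj (weyl_m z)))"
    unfolding L2_half_def weyl_def by (subst set_integrable_cong[OF refl refl]) (auto simp flip: cnj_U[of _ z "-1" "weyl_m z", simplified])
  then have s: "L2_on {l..} (U (cnj z) (-1) (cnj (weyl_m z)))" by (simp add: L2_on_U_iff)
  from weyl_exists(2)[OF weyl_domainD(1)[OF g] weyl_domainD(2)[OF g] s]
  show 1: "weyl_m (cnj z) = cnj (weyl_m z)" by simp
  show "t \<ge> l \<Longrightarrow> cnj (weyl z t) = weyl (cnj z) t"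
    unfolding weyl_def 1 using cnj_U[of t z "-1" "weyl_m z"] by simp
qed

text \<open>Green's formula for the Weyl solution and its conjugate. It shows that m is real on the
  negative axis and gives -m its Herglotz sign.\<close>

lemma Im_weyl_m: "z \<in> weyl_domain \<Longrightarrow> Im (weyl_m z) = - Im z * norm_sq {l..} (weyl z)"
proof -
  assume z: "z \<in> weyl_domain"
  then have s: "L2_on {l..} (U z (-1) (weyl_m z))" using weyl_L2_on by (simp add: weyl_def)
  have "z * of_real (norm_sq {l..} (weyl z)) - cnj z * of_real (norm_sq {l..} (weyl z)) = cnj (weyl_m z) - weyl_m z"
    using Green_at_infinity[OF max_domain_U[OF s] max_domain_cnj[OF max_domain_U[OF s]]]
    by (simp add: pairing_scale_left pairing_scale_right pairing_cnj_self weyl_def)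
  from arg_cong[OF this, of Im] show ?thesis by simp
qed

lemma weyl_m_real: "of_real x \<in> weyl_domain \<Longrightarrow> of_real (Re (weyl_m (of_real x))) = weyl_m (of_real x)"
  using Im_weyl_m[of "of_real x"] by (simp add: complex_eq_iff)

lemma cnj_weyl_real: "of_real x \<in> weyl_domain \<Longrightarrow> t \<ge> l \<Longrightarrow> cnj (weyl (of_real x) t) = weyl (of_real x) t"
  using weyl_m_cnj(2)[of "of_real x" t] by simp

lemma pairing_cnj_weyl_real: "of_real x \<in> weyl_domain \<Longrightarrow> pairing l f (\<lambda>t. cnj (weyl (of_real x) t)) = pairing l f (weyl (of_real x))"
  by (rule pairing_cong) (simp_all add: cnj_weyl_real)

lemma pairing_weyl_real_self: "of_real x \<in> weyl_domain \<Longrightarrow> pairing l (weyl (of_real x)) (weyl (of_real x)) = of_real (norm_sq {l..} (weyl (of_real x)))"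
  using pairing_cnj_weyl_real[of x "weyl (of_real x)"] by (simp add: pairing_cnj_self)

text \<open>Eigenfunctions u, v with the same data (0,1) differ by an element of the minimal domain.
  They are orthogonal, so the form of the difference is x ||u||^2 + y ||v||^2 < 0.\<close>

lemma dirichlet_negative_unique:
  assumes "dirichlet (of_real x)" "dirichlet (of_real y)" "x < 0" "y < 0"
  shows "x = y"
proof (rule ccontr)
  assume ne: "x \<noteq> y"
  let ?u = "U (of_real x) 0 1" and ?v = "U (of_real y) 0 1"
  have s: "L2_on {l..} ?u" "L2_on {l..} ?v" using assms by (auto simp: dirichlet_def)
  have "of_real (x - y) * pairing l ?u ?v = 0"
    using L2_solution_Wronskian[OF s] by simp
  then have 0: "pairing l ?u ?v = 0" using ne by simp
  have c: "pairing l f (\<lambda>t. cnj (U (of_real r) 0 1 t)) = pairing l f (U (of_real r) 0 1)" for f r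
    by (rule pairing_cong) (simp_all add: cnj_U)
  have "min_domain (\<lambda>t. ?u t - ?v t) (\<lambda>t. x * ?u t - y * ?v t)"
    by (rule min_domainI[OF max_domain_diff[OF max_domain_U[OF s(1)] max_domain_U[OF s(2)]]]) simp_all
  from min_domain_form(2)[OF this]
  have "0 \<le> Re (pairing l (\<lambda>t. x * ?u t - y * ?v t) (\<lambda>t. cnj (?u t) - cnj (?v t)))" by simp
  also have "pairing l (\<lambda>t. x * ?u t - y * ?v t) (\<lambda>t. cnj (?u t) - cnj (?v t)) = x * norm_sq {l..} ?u + y * norm_sq {l..} ?v"
    using 0 pairing_commute[of l ?v ?u]
    by (simp add: pairing_diff_left pairing_diff_right s L2_on_scale L2_on_diff L2_on_cnj pairing_scale_left pairing_cnj_self c[of ?u y] c[of ?v x])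
  finally have "0 \<le> x * norm_sq {l..} ?u + y * norm_sq {l..} ?v" by simp
  moreover have "x * norm_sq {l..} ?u < 0" "y * norm_sq {l..} ?v < 0"
    using norm_sq_U_pos[OF s(1)] norm_sq_U_pos[OF s(2)] assms by (auto intro: mult_neg_pos)
  ultimately show False by linarith
qed

text \<open>Subtracting a bump from the difference of two Weyl solutions gives an element of the minimal
  domain, to which coercivity at $w$ applies.\<close>

lemma weyl_L2_continuous:
  assumes w: "w \<in> weyl_domain" and ev: "\<forall>\<^sub>F z in at w. z \<in> weyl_domain"
  shows "\<exists>C. \<forall>\<^sub>F z in at w. norm_sq {l..} (\<lambda>t. weyl z t - weyl w t) \<le> C * (cmod (z - w))\<^sup>2"
proof -
  define d where "d = gap w"
  have d: "d > 0" using gap_pos weyl_domainD(1)[OF w] by (simp add: d_def)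
  define K where "K = K_bound (d / 2) (of_real (cmod w + 1))"
  have K0: "K \<ge> 0" unfolding K_def by (rule K_bound_nonneg)
  define nw where "nw = norm_sq {l..} (weyl w)"
  have nw0: "nw \<ge> 0" by (simp add: nw_def norm_sq_nonneg)
  define B where "B = K * (2 + 4 * (cmod (weyl_m w))\<^sup>2)"
  define D where "D = 4 * bump_const + 4 * (cmod w)\<^sup>2 * bump_const"
  have D0: "D \<ge> 0" using bump_const_nonneg by (simp add: D_def)
  define C where "C = 2 * ((2 * B + 2 * (D * (B * nw))) / d\<^sup>2) + 2 * (2 * bump_const * (B * nw))"
  have "((\<lambda>z. gap z) \<longlongrightarrow> gap w) (at w)" unfolding gap_def by (intro tendsto_intros)
  then have ev1: "\<forall>\<^sub>F z in at w. d / 2 < gap z"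
    using d by (intro order_tendstoD(1)) (auto simp: d_def)
  have "((\<lambda>z. cmod z) \<longlongrightarrow> cmod w) (at w)" by (intro tendsto_intros)
  then have ev2: "\<forall>\<^sub>F z in at w. cmod z < cmod w + 1" by (intro order_tendstoD(2)) auto
  have "((\<lambda>z. (cmod (z - w))\<^sup>2 * (K * nw)) \<longlongrightarrow> (cmod (w - w))\<^sup>2 * (K * nw)) (at w)" by (intro tendsto_intros)
  \<comment> \<open>The bound on \<open>weyl z\<close> involves m(z), which in turn is estimated
    through the norm of \<open>weyl z\<close>. Under this smallness the loop produces only
    |\<Delta>|^2 / 2 on the right, which is absorbed on the left; the result is the bound
    \<open>B\<close>.\<close>
  then have ev3: "\<forall>\<^sub>F z in at w. (cmod (z - w))\<^sup>2 * (K * nw) < 1 / 4" by (intro order_tendstoD(2)) auto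
  show ?thesis
  proof (rule exI[of _ C], use ev ev1 ev2 ev3 in eventually_elim)
    case (elim z)
    define \<Delta> where "\<Delta> = weyl_m z - weyl_m w"
    have sz: "L2_on {l..} (weyl z)" and sw: "L2_on {l..} (weyl w)" using weyl_L2_on elim(1) w by auto
    have "(cmod (weyl_m z))\<^sup>2 = (cmod (weyl_m w + \<Delta>))\<^sup>2" by (simp add: \<Delta>_def)
    also have "\<dots> \<le> 2 * (cmod (weyl_m w))\<^sup>2 + 2 * (cmod \<Delta>)\<^sup>2" by (rule norm_add_sq_le)
    finally have mz: "(cmod (weyl_m z))\<^sup>2 \<le> 2 * (cmod (weyl_m w))\<^sup>2 + 2 * (cmod \<Delta>)\<^sup>2" .
    have "norm_sq {l..} (weyl z) \<le> K_bound (gap z) z * (1 + (cmod (weyl_m z))\<^sup>2)"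
      using L2_solution_bound[OF weyl_domainD(1)[OF elim(1)], of "-1" "weyl_m z"] sz by (simp add: weyl_def)
    also have "\<dots> \<le> K * (1 + (cmod (weyl_m z))\<^sup>2)"
      unfolding K_def
    proof (intro mult_right_mono K_bound_mono)
      show "cmod z \<le> cmod (of_real (cmod w + 1))" unfolding norm_of_real using elim(3) by simp
    qed (use d elim in auto)
    finally have nz1: "norm_sq {l..} (weyl z) \<le> K * (1 + (cmod (weyl_m z))\<^sup>2)" .
    have "(cmod \<Delta>)\<^sup>2 = (cmod ((z - w) * pairing l (weyl z) (weyl w)))\<^sup>2"
      unfolding weyl_m_diff[OF elim(1) w] \<Delta>_def by (simp add: norm_minus_commute)
    also have "\<dots> \<le> (cmod (z - w))\<^sup>2 * (norm_sq {l..} (weyl z) * nw)"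
      unfolding norm_mult power_mult_distrib nw_def by (intro mult_left_mono norm_pairing_le sz sw) auto
    finally have \<Delta>1: "(cmod \<Delta>)\<^sup>2 \<le> (cmod (z - w))\<^sup>2 * (norm_sq {l..} (weyl z) * nw)" .
    also have "\<dots> \<le> (cmod (z - w))\<^sup>2 * ((K * (1 + (cmod (weyl_m z))\<^sup>2)) * nw)"
      using nz1 nw0 by (intro mult_left_mono mult_right_mono) auto
    also have "\<dots> = ((cmod (z - w))\<^sup>2 * (K * nw)) * (1 + (cmod (weyl_m z))\<^sup>2)" by (simp add: algebra_simps)
    also have "\<dots> \<le> 1 / 4 * (1 + (2 * (cmod (weyl_m w))\<^sup>2 + 2 * (cmod \<Delta>)\<^sup>2))"
      using elim(4) mz by (intro mult_mono) (auto simp: K0 nw0)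
    finally have "(cmod \<Delta>)\<^sup>2 \<le> 1 / 2 + (cmod (weyl_m w))\<^sup>2" by simp
    then have "1 + (cmod (weyl_m z))\<^sup>2 \<le> 2 + 4 * (cmod (weyl_m w))\<^sup>2" using mz by simp
    then have nzB: "norm_sq {l..} (weyl z) \<le> B"
      unfolding B_def using nz1 K0 by (meson mult_left_mono order_trans)
    have \<Delta>2: "(cmod \<Delta>)\<^sup>2 \<le> (cmod (z - w))\<^sup>2 * (B * nw)"
      by (rule order_trans[OF \<Delta>1]) (use nzB nw0 in \<open>auto intro!: mult_left_mono mult_right_mono\<close>)
    let ?v = "\<lambda>t. weyl z t - weyl w t"
    let ?y = "\<lambda>t. ?v t - \<eta> 0 \<Delta> t" and ?f = "\<lambda>t. (z * weyl z t - w * weyl w t) - \<psi> 0 \<Delta> t"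
    have s\<eta>: "L2_on {l..} (\<eta> 0 \<Delta>)" "L2_on {l..} (\<psi> 0 \<Delta>)" using \<eta>_props(1)[of 0 \<Delta>] by (auto simp: max_domain_def)
    have "max_domain ?y (\<lambda>t. (V z (-1) (weyl_m z) t - V w (-1) (weyl_m w) t) - \<eta>' 0 \<Delta> t) ?f"
      unfolding weyl_def by (intro max_domain_diff max_domain_U \<eta>_props sz[unfolded weyl_def] sw[unfolded weyl_def])
    then have y: "min_domain ?y ?f"
      by (rule min_domainI) (simp_all add: weyl_def \<eta>_props \<Delta>_def)
    have "norm_sq {l..} (\<lambda>t. ?f t - w * ?y t) = norm_sq {l..} (\<lambda>t. (z - w) * weyl z t - (\<psi> 0 \<Delta> t - w * \<eta> 0 \<Delta> t))"
      by (simp add: algebra_simps)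
    also have "\<dots> \<le> 2 * norm_sq {l..} (\<lambda>t. (z - w) * weyl z t) + 2 * norm_sq {l..} (\<lambda>t. \<psi> 0 \<Delta> t - w * \<eta> 0 \<Delta> t)"
      by (intro L2_on_diff L2_on_scale sz s\<eta>)
    also have "\<dots> \<le> 2 * ((cmod (z - w))\<^sup>2 * B) + 2 * (D * (cmod \<Delta>)\<^sup>2)"
    proof (intro add_mono mult_left_mono)
      show "norm_sq {l..} (\<lambda>t. (z - w) * weyl z t) \<le> (cmod (z - w))\<^sup>2 * B"
        unfolding norm_sq_scale using nzB by (intro mult_left_mono) auto
      have "norm_sq {l..} (\<lambda>t. \<psi> 0 \<Delta> t - w * \<eta> 0 \<Delta> t) \<le> 2 * norm_sq {l..} (\<psi> 0 \<Delta>) + 2 * ((cmod w)\<^sup>2 * norm_sq {l..} (\<eta> 0 \<Delta>))"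
        using L2_on_diff(2)[OF s\<eta>(2) L2_on_scale[OF s\<eta>(1)]] unfolding norm_sq_scale .
      also have "\<dots> \<le> 2 * (2 * bump_const * (cmod \<Delta>)\<^sup>2) + 2 * ((cmod w)\<^sup>2 * (2 * bump_const * (cmod \<Delta>)\<^sup>2))"
        using norm_sq_\<psi>_le[of 0 \<Delta>] norm_sq_\<eta>_le[of 0 \<Delta>] by (intro add_mono mult_left_mono) auto
      also have "\<dots> = D * (cmod \<Delta>)\<^sup>2" by (simp add: D_def algebra_simps)
      finally show "norm_sq {l..} (\<lambda>t. \<psi> 0 \<Delta> t - w * \<eta> 0 \<Delta> t) \<le> D * (cmod \<Delta>)\<^sup>2" .
    qed auto
    also have "\<dots> \<le> 2 * ((cmod (z - w))\<^sup>2 * B) + 2 * (D * ((cmod (z - w))\<^sup>2 * (B * nw)))"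
      using \<Delta>2 D0 by (intro add_mono mult_left_mono) auto
    finally have "d\<^sup>2 * norm_sq {l..} ?y \<le> (2 * B + 2 * (D * (B * nw))) * (cmod (z - w))\<^sup>2"
      using min_domain_coercive[OF y weyl_domainD(1)[OF w]] by (simp add: d_def algebra_simps)
    then have ny: "norm_sq {l..} ?y \<le> (2 * B + 2 * (D * (B * nw))) * (cmod (z - w))\<^sup>2 / d\<^sup>2"
      using d by (simp add: pos_le_divide_eq mult.commute)
    have n\<eta>: "norm_sq {l..} (\<eta> 0 \<Delta>) \<le> 2 * bump_const * ((cmod (z - w))\<^sup>2 * (B * nw))"
      using norm_sq_\<eta>_le[of 0 \<Delta>] mult_left_mono[OF \<Delta>2, of "2 * bump_const"] bump_const_nonneg by simp
    have "norm_sq {l..} ?v \<le> 2 * norm_sq {l..} ?y + 2 * norm_sq {l..} (\<eta> 0 \<Delta>)"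
      using L2_on_add(2)[OF min_domain_L2_on(1)[OF y] s\<eta>(1)] by simp
    also have "\<dots> \<le> 2 * ((2 * B + 2 * (D * (B * nw))) * (cmod (z - w))\<^sup>2 / d\<^sup>2) + 2 * (2 * bump_const * ((cmod (z - w))\<^sup>2 * (B * nw)))"
      using ny n\<eta> by linarith
    also have "\<dots> = C * (cmod (z - w))\<^sup>2" by (simp add: C_def algebra_simps add_divide_distrib)
    finally show ?case .
  qed
qed

text \<open>By \<open>weyl_m_diff\<close> the difference quotient equals minus the pairing of
  \<open>weyl z\<close> with \<open>weyl w\<close> exactly, so continuity of the Weyl solution in L2
  gives the limit.\<close>

lemma weyl_m_has_derivative:
  assumes w: "w \<in> weyl_domain" and ev: "\<forall>\<^sub>F z in at w. z \<in> weyl_domain"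
  shows "(weyl_m has_field_derivative - pairing l (weyl w) (weyl w)) (at w)"
proof -
  obtain C where C: "\<forall>\<^sub>F z in at w. norm_sq {l..} (\<lambda>t. weyl z t - weyl w t) \<le> C * (cmod (z - w))\<^sup>2"
    using weyl_L2_continuous[OF assms] by blast
  define nw where "nw = norm_sq {l..} (weyl w)"
  have nw0: "nw \<ge> 0" by (simp add: nw_def norm_sq_nonneg)
  have sw: "L2_on {l..} (weyl w)" by (rule weyl_L2_on[OF w])
  have "((\<lambda>z. sqrt (C * (cmod (z - w))\<^sup>2 * nw)) \<longlongrightarrow> sqrt (C * (cmod (w - w))\<^sup>2 * nw)) (at w)"
    by (intro tendsto_intros)
  then have lim: "((\<lambda>z. sqrt (C * (cmod (z - w))\<^sup>2 * nw)) \<longlongrightarrow> 0) (at w)" by simp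
  have "((\<lambda>z. pairing l (weyl z) (weyl w) - pairing l (weyl w) (weyl w)) \<longlongrightarrow> 0) (at w)"
  proof (rule Lim_null_comparison[OF _ lim], use C ev in eventually_elim)
    case (elim z)
    have sz: "L2_on {l..} (weyl z)" by (rule weyl_L2_on[OF elim(2)])
    have "(cmod (pairing l (\<lambda>t. weyl z t - weyl w t) (weyl w)))\<^sup>2 \<le> norm_sq {l..} (\<lambda>t. weyl z t - weyl w t) * nw"
      unfolding nw_def by (intro norm_pairing_le L2_on_diff sz sw)
    also have "\<dots> \<le> C * (cmod (z - w))\<^sup>2 * nw" using elim(1) nw0 by (rule mult_right_mono)
    finally have "cmod (pairing l (\<lambda>t. weyl z t - weyl w t) (weyl w)) \<le> sqrt (C * (cmod (z - w))\<^sup>2 * nw)"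
      by (rule real_le_rsqrt)
    then show ?case by (simp add: pairing_diff_left sz sw)
  qed
  then have "((\<lambda>z. pairing l (weyl z) (weyl w)) \<longlongrightarrow> pairing l (weyl w) (weyl w)) (at w)" by (simp add: LIM_zero_iff)
  then have lim2: "((\<lambda>z. - pairing l (weyl z) (weyl w)) \<longlongrightarrow> - pairing l (weyl w) (weyl w)) (at w)" by (intro tendsto_intros)
  have "\<forall>\<^sub>F z in at w. - pairing l (weyl z) (weyl w) = (weyl_m z - weyl_m w) / (z - w)"
    using ev eventually_neq_at_within[of w w UNIV]
  proof eventually_elim
    case (elim z)
    have "weyl_m z - weyl_m w = - pairing l (weyl z) (weyl w) * (z - w)"
      using weyl_m_diff[OF elim(1) w] by (simp add: algebra_simps)
    then show ?case using elim(2) by simp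
  qed
  from Lim_transform_eventually[OF lim2 this]
  show ?thesis by (simp add: has_field_derivative_iff)
qed

section \<open>The negative half-line\<close>

text \<open>For y = -U, with value 1 at l, the term -x y of y'' pushes upwards while y >= 0, so y
  cannot fall to 1/2 quickly, however far left x is. As y has no upper bound uniform in x, the loss
  is measured relative to the maximum M of y before its first descent to 1/2.\<close>

lemma solution_lower_bound:
  assumes C: "C \<ge> 0"
  shows "\<exists>\<delta>>0. \<forall>x<0. \<forall>c. \<bar>c\<bar> \<le> C \<longrightarrow> L2_on {l..} (U (of_real x) (-1) (of_real c)) \<longrightarrow>
     \<delta> \<le> norm_sq {l..} (U (of_real x) (-1) (of_real c))"
proof -
  define Q where "Q = (LINT t:{l..l+1}|lborel. \<bar>q t\<bar>)"
  have Q0: "Q \<ge> 0" unfolding Q_def set_lebesgue_integral_def by (intro Bochner_Integration.integral_nonneg) auto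
  \<comment> \<open>Chosen so that the drop over length \<delta> is at most M/4; the
    \<open>+ 1\<close> ensures \<delta> <= 1, so that the interval lies where Q is computed.\<close>
  define \<delta> where "\<delta> = 1 / (4 * (C + Q + 1))"
  have \<delta>: "\<delta> > 0" "\<delta> \<le> 1" "\<delta> * (C + Q) \<le> 1 / 4"
    using C Q0 by (auto simp: \<delta>_def field_simps)
  have main: "\<delta> / 4 \<le> norm_sq {l..} (U (of_real x) (-1) (of_real c))"
    if x: "x < 0" and c: "\<bar>c\<bar> \<le> C" and s: "L2_on {l..} (U (of_real x) (-1) (of_real c))" for x c
  proof -
    define y where "y = U (of_real x) 1 (of_real (- c))"
    define p where "p = V (of_real x) 1 (of_real (- c))"
    have t: "sol q l (of_real x) y p" and tr: "triple y p (\<lambda>t. of_real x * y t)"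
      unfolding y_def p_def by (rule sol_U triple_U)+
    define v where "v = (\<lambda>t. Re (y t))"
    define r where "r = (\<lambda>t. Re (p t))"
    have l: "v l = 1" "r l = - c" by (simp_all add: v_def r_def y_def p_def)
    have cv: "continuous_on {l..b} v" for b unfolding v_def by (intro continuous_intros triple_continuous[OF tr])
    have iqx: "set_integrable lborel {l..b} (\<lambda>t. (q t - x) * v t)" for b
      by (intro set_integrable_bounded_mult cv set_integral_diff q_integrable const_integrable)
    have req: "r \<tau> = - c + (LINT t:{l..\<tau>}|lborel. (q t - x) * v t)" if "\<tau> \<ge> l" for \<tau>
    proof -
      have i: "set_integrable lborel {l..\<tau>} (\<lambda>t. (of_real (q t) - of_real x) * y t)" by (rule solD(2)[OF t])
      have *: "Re (indicator {l..\<tau>} t *\<^sub>R ((of_real (q t) - of_real x) * y t)) = indicator {l..\<tau>} t *\<^sub>R ((q t - x) * v t)" for t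
        by (simp add: v_def)
      have "Re (LINT t:{l..\<tau>}|lborel. (of_real (q t) - of_real x) * y t) = (LINT t:{l..\<tau>}|lborel. (q t - x) * v t)"
        using integral_Re[OF i[unfolded set_integrable_def]] unfolding set_lebesgue_integral_def * by simp
      moreover have "r \<tau> = Re (p l + (LINT t:{l..\<tau>}|lborel. (of_real (q t) - of_real x) * y t))"
        unfolding r_def using solD(4)[OF t that] by (rule arg_cong[where f=Re])
      ultimately show ?thesis using l(2) by (simp add: r_def)
    qed
    have dv: "(v has_real_derivative r \<tau>) (at \<tau>)" if "\<tau> > l" for \<tau>
    proof -
      have "(y has_vector_derivative p \<tau>) (at \<tau> within {l..\<tau>+1})"
        by (rule triple_has_vector_derivative[OF tr]) (use that in auto)
      then have "(y has_vector_derivative p \<tau>) (at \<tau>)"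
        using that at_within_interior[of \<tau> "{l..\<tau>+1}"] by simp
      then show ?thesis unfolding v_def r_def has_real_derivative_iff_has_vector_derivative
        by (rule bounded_linear.has_vector_derivative[OF bounded_linear_Re])
    qed
    have half: "v \<tau> > 1 / 2" if \<tau>: "\<tau> \<in> {l..l+\<delta>}" for \<tau>
    proof (rule ccontr)
      assume "\<not> v \<tau> > 1 / 2"
      define S where "S = {t \<in> {l..l+\<delta>}. v t \<le> 1 / 2}"
      have "S \<noteq> {}" using \<open>\<not> v \<tau> > 1 / 2\<close> \<tau> by (auto simp: S_def)
      have "closed S" unfolding S_def
        using continuous_closed_preimage[OF cv[of "l+\<delta>"] closed_atLeastAtMost closed_atMost[of "1/2"]]
        by (simp add: vimage_def Int_def)
      define t1 where "t1 = Inf S"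
      have bS: "bdd_below S" by (rule bdd_belowI[of _ l]) (auto simp: S_def)
      have t1S: "t1 \<in> S" unfolding t1_def by (rule closed_contains_Inf) fact+
      have t1: "t1 \<in> {l..l+\<delta>}" "v t1 \<le> 1 / 2" using t1S by (auto simp: S_def)
      have "t1 \<noteq> l" using t1 l by auto
      then have t1l: "t1 > l" using t1 by auto
      have below: "v t > 1 / 2" if "t \<in> {l..<t1}" for t
      proof (rule ccontr)
        assume "\<not> v t > 1 / 2"
        then have "t \<in> S" using that t1 by (auto simp: S_def)
        then have "t1 \<le> t" unfolding t1_def by (rule cInf_lower[OF _ bS])
        then show False using that by auto
      qed
      have "\<exists>t. l \<le> t \<and> t \<le> t1 \<and> v t = 1 / 2"
        by (rule IVT2') (use t1 l cv in auto)
      then obtain t2 where "l \<le> t2" "t2 \<le> t1" "v t2 = 1 / 2" by blast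
      with below[of t2] have "v t1 = 1 / 2" by (cases "t2 = t1") auto
      then have nn: "v t \<ge> 0" if "t \<in> {l..t1}" for t using below[of t] that by (cases "t = t1") auto
      obtain s0 where s0: "s0 \<in> {l..t1}" "\<And>t. t \<in> {l..t1} \<Longrightarrow> v t \<le> v s0"
        using continuous_attains_sup[of "{l..t1}" v] cv t1l by auto
      define M where "M = v s0"
      have M: "M \<ge> 1" using s0(2)[of l] l t1l by (simp add: M_def)
      have s0t1: "s0 < t1" using s0(1) t1(2) M by (cases "s0 = t1") (auto simp: M_def)
      \<comment> \<open>At the maximum the slope is 0 if s0 is interior and -c if s0 = l; it is not
        at t1, where v is at most 1/2.\<close>
      have rs0: "r s0 \<ge> - C"
      proof (cases "s0 = l")
        case True then show ?thesis using l c by auto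
      next
        case False
        then have "s0 > l" using s0 by auto
        have "r s0 = 0"
        proof (rule DERIV_local_max[OF dv[OF \<open>s0 > l\<close>]])
          show "0 < min (s0 - l) (t1 - s0)" using \<open>s0 > l\<close> s0t1 by auto
          show "\<forall>y. \<bar>s0 - y\<bar> < min (s0 - l) (t1 - s0) \<longrightarrow> v y \<le> v s0"
            by (intro allI impI s0(2)) (auto simp: abs_if split: if_splits)
        qed
        then show ?thesis using C by simp
      qed
      obtain k \<tau> where \<tau>: "s0 < \<tau>" "\<tau> < t1" "(v has_real_derivative k) (at \<tau>)" "v t1 - v s0 = (t1 - s0) * k"
      proof -
        have "\<exists>k z. s0 < z \<and> z < t1 \<and> (v has_real_derivative k) (at z) \<and> v t1 - v s0 = (t1 - s0) * k"
        proof (rule MVT[OF s0t1])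
          show "continuous_on {s0..t1} v" using cv[of t1] by (rule continuous_on_subset) (use s0 in auto)
          show "v differentiable (at x)" if "s0 < x" "x < t1" for x
            using dv[of x] s0 that by (auto simp: real_differentiable_def)
        qed
        then show ?thesis using that by blast
      qed
      have k\<tau>: "k = r \<tau>" using DERIV_unique[OF \<tau>(3) dv] \<tau>(1) s0(1) by auto
      have r\<tau>: "r \<tau> = r s0 + (LINT t:{s0..\<tau>}|lborel. (q t - x) * v t)"
        using req[of \<tau>] req[of s0] set_integral_Icc_split[OF iqx[of \<tau>], of s0] s0 \<tau>(1) by simp
      \<comment> \<open>Discarding -x v >= 0 here is what makes the estimate uniform in x.\<close>
      have I1: "(LINT t:{s0..\<tau>}|lborel. (q t - x) * v t) \<ge> (LINT t:{s0..\<tau>}|lborel. - M * \<bar>q t\<bar>)"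
      proof (rule set_integral_mono)
        show "set_integrable lborel {s0..\<tau>} (\<lambda>t. - M * \<bar>q t\<bar>)"
          by (intro set_integrable_mult_right set_integrable_abs set_integrable_subset[OF q_integrable[of \<tau>]]) (use s0 in auto)
        show "set_integrable lborel {s0..\<tau>} (\<lambda>t. (q t - x) * v t)"
          by (rule set_integrable_subset[OF iqx[of \<tau>]]) (use s0 in auto)
        fix t assume "t \<in> {s0..\<tau>}"
        then have t: "0 \<le> v t" "v t \<le> M" using s0 \<tau> nn[of t] by (auto simp: M_def)
        have "- M * \<bar>q t\<bar> \<le> - (v t * \<bar>q t\<bar>)" using t by (simp add: mult_right_mono)
        also have "\<dots> \<le> v t * q t" using mult_left_mono[OF _ t(1), of "- \<bar>q t\<bar>" "q t"] by simp
        also have "\<dots> \<le> (q t - x) * v t" using x t(1) by (simp add: algebra_simps mult_nonpos_nonneg)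
        finally show "- M * \<bar>q t\<bar> \<le> (q t - x) * v t" .
      qed
      have I2: "(LINT t:{s0..\<tau>}|lborel. - M * \<bar>q t\<bar>) = - M * (LINT t:{s0..\<tau>}|lborel. \<bar>q t\<bar>)"
        by (rule set_integral_mult_right)
      have I3: "(LINT t:{s0..\<tau>}|lborel. \<bar>q t\<bar>) \<le> Q"
        unfolding Q_def set_lebesgue_integral_def
      proof (rule integral_mono)
        show "integrable lborel (\<lambda>t. indicator {l..l+1} t *\<^sub>R \<bar>q t\<bar>)"
          using set_integrable_abs[OF q_integrable[of "l+1"]] by (simp add: set_integrable_def)
        show "integrable lborel (\<lambda>t. indicator {s0..\<tau>} t *\<^sub>R \<bar>q t\<bar>)"
          using set_integrable_subset[OF set_integrable_abs[OF q_integrable[of \<tau>]], of "{s0..\<tau>}"] s0 by (simp add: set_integrable_def)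
        show "indicator {s0..\<tau>} t *\<^sub>R \<bar>q t\<bar> \<le> indicator {l..l+1} t *\<^sub>R \<bar>q t\<bar>" for t
          using s0 \<tau> t1 \<delta> by (auto simp: indicator_def)
      qed
      have "M * (LINT t:{s0..\<tau>}|lborel. \<bar>q t\<bar>) \<le> M * Q" using I3 M by (intro mult_left_mono) auto
      then have k: "k \<ge> - C - M * Q" using rs0 k\<tau> r\<tau> I1 I2 by linarith
      have "M * C \<ge> C" using mult_right_mono[OF M C] by simp
      then have k2: "k \<ge> - (M * (C + Q))" using k by (simp add: algebra_simps)
      have "(t1 - s0) * - (M * (C + Q)) \<le> (t1 - s0) * k"
        using k2 s0t1 by (intro mult_left_mono) auto
      moreover have "\<delta> * - (M * (C + Q)) \<le> (t1 - s0) * - (M * (C + Q))"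
        using t1 s0 M C Q0 by (intro mult_right_mono_neg) auto
      moreover have "\<delta> * - (M * (C + Q)) = - (M * (\<delta> * (C + Q)))" by simp
      moreover have "M * (\<delta> * (C + Q)) \<le> M * (1 / 4)" using \<delta>(3) M by (intro mult_left_mono) auto
      ultimately have "v t1 \<ge> 3 / 4 * M" using \<tau>(4) unfolding M_def by linarith
      then show False using t1(2) M by linarith
    qed
    have Uy: "U (of_real x) (-1) (of_real c) t = - y t" for t
      by (simp add: y_def U_def)
    have "\<delta> / 4 = (LINT t:{l..l+\<delta>}|lborel. 1 / 4)"
      using \<delta> by (simp add: set_lebesgue_integral_def)
    also have "\<dots> \<le> norm_sq {l..l+\<delta>} (U (of_real x) (-1) (of_real c))"
      unfolding norm_sq_def
    proof (rule set_integral_mono)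
      show "set_integrable lborel {l..l+\<delta>} (\<lambda>t. (cmod (U (of_real x) (-1) (of_real c) t))\<^sup>2)"
        using L2_on_continuous[OF triple_continuous(1)[OF triple_U]] by (simp add: L2_on_def)
      fix t assume "t \<in> {l..l+\<delta>}"
      then have "1 / 2 < v t" by (rule half)
      also have "v t \<le> cmod (y t)" unfolding v_def by (rule complex_Re_le_cmod)
      finally have "(1 / 2)\<^sup>2 \<le> (cmod (y t))\<^sup>2" by (intro power_mono) auto
      then show "1 / 4 \<le> (cmod (U (of_real x) (-1) (of_real c) t))\<^sup>2"
        unfolding Uy by (simp add: power2_eq_square)
    qed (rule const_integrable)
    also have "\<dots> \<le> norm_sq {l..} (U (of_real x) (-1) (of_real c))"
      by (rule norm_sq_mono[OF s]) auto
    finally show ?thesis .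
  qed
  show ?thesis
  proof (intro exI[of _ "\<delta> / 4"] conjI allI impI)
    show "0 < \<delta> / 4" using \<delta>(1) by simp
  qed (rule main)
qed

text \<open>Provides room for the limit of m at -oo before the whole negative axis is known to be
  free of poles.\<close>

lemma weyl_domain_far_left: "\<exists>x0<0. \<forall>x<x0. of_real x \<in> weyl_domain"
proof (cases "\<exists>p<0. dirichlet (of_real p)")
  case True
  then obtain p where p: "p < 0" "dirichlet (of_real p)" by blast
  have "of_real x \<in> weyl_domain" if "x < p" for x
    using dirichlet_negative_unique[OF _ p(2) _ p(1), of x] that p(1) by (auto simp: weyl_domain_def resolvent_def)
  then show ?thesis using p(1) by blast
next
  case False
  then show ?thesis by (intro exI[of _ "-1"]) (auto simp: weyl_domain_def resolvent_def)
qed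

abbreviation m_real :: "real \<Rightarrow> real" where "m_real x \<equiv> Re (weyl_m (of_real x))"

lemma m_real_has_derivative:
  assumes w: "of_real x \<in> weyl_domain" and ev: "\<forall>\<^sub>F z in at (of_real x). z \<in> weyl_domain"
  shows "(m_real has_real_derivative - norm_sq {l..} (weyl (of_real x))) (at x)"
proof -
  have "((weyl_m \<circ> of_real) has_vector_derivative 1 * (- of_real (norm_sq {l..} (weyl (of_real x))))) (at x)"
    by (rule field_vector_diff_chain_at)
      (use weyl_m_has_derivative[OF assms] in \<open>auto simp: pairing_weyl_real_self[OF w] intro!: derivative_eq_intros\<close>)
  from bounded_linear.has_vector_derivative[OF bounded_linear_Re this]
  show ?thesis by (simp add: o_def has_real_derivative_iff_has_vector_derivative)
qed

lemma eventually_weyl_domain_left: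
  assumes "x < x0" "\<And>x. x < x0 \<Longrightarrow> of_real x \<in> weyl_domain"
  shows "\<forall>\<^sub>F z in at (of_real x). z \<in> weyl_domain"
proof -
  have "\<forall>\<^sub>F z in at (of_real x). Re z < x0"
    by (intro order_tendstoD(2)[OF tendsto_Re[OF tendsto_ident_at]]) (use assms in simp)
  then show ?thesis
  proof eventually_elim
    case (elim z)
    show ?case
    proof (cases "Im z = 0")
      case True
      then have "of_real (Re z) = z" by (simp add: complex_eq_iff)
      then show ?thesis using assms(2)[OF elim] by simp
    qed (rule weyl_domain_nonreal)
  qed
qed

lemma m_real_at_bot: "filterlim m_real at_top at_bot"
proof -
  obtain x0 where x0: "x0 < 0" and g: "\<And>x. x < x0 \<Longrightarrow> of_real x \<in> weyl_domain" using weyl_domain_far_left by blast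
  have der: "(m_real has_real_derivative - norm_sq {l..} (weyl (of_real x))) (at x)" if "x < x0" for x
    by (rule m_real_has_derivative[OF g[OF that] eventually_weyl_domain_left[OF that g]])
  have mono: "m_real y \<le> m_real x" if "x \<le> y" "y < x0" for x y
  proof (rule DERIV_nonpos_imp_nonincreasing[OF that(1)])
    fix u assume "x \<le> u" "u \<le> y"
    then have "u < x0" using that by simp
    from der[OF this] show "\<exists>d. (m_real has_real_derivative d) (at u) \<and> d \<le> 0"
      using norm_sq_nonneg by (intro exI[of _ "- norm_sq {l..} (weyl (of_real u))"]) simp
  qed
  have unb: "\<exists>x<x0. m_real x > K" for K
  proof (rule ccontr)
    assume "\<not> ?thesis"
    then have K: "\<And>x. x < x0 \<Longrightarrow> m_real x \<le> K" by force
    define x1 where "x1 = x0 - 1"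
    define C where "C = max \<bar>K\<bar> \<bar>m_real x1\<bar>"
    obtain \<delta> where \<delta>: "\<delta> > 0" and low: "\<And>x c. x < 0 \<Longrightarrow> \<bar>c\<bar> \<le> C \<Longrightarrow> L2_on {l..} (U (of_real x) (-1) (of_real c)) \<Longrightarrow>
      \<delta> \<le> norm_sq {l..} (U (of_real x) (-1) (of_real c))"
    proof -
      have "C \<ge> 0" by (simp add: C_def)
      from solution_lower_bound[OF this] show ?thesis using that by blast
    qed
    have lowm: "\<delta> \<le> norm_sq {l..} (weyl (of_real x))" if "x \<le> x1" for x
    proof -
      have x: "x < x0" using that by (simp add: x1_def)
      have "\<bar>m_real x\<bar> \<le> C" using K[OF x] mono[of x x1] that by (auto simp: C_def x1_def)
      moreover have "L2_on {l..} (U (of_real x) (-1) (of_real (m_real x)))"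
        using weyl_L2_on[OF g[OF x]] unfolding weyl_def weyl_m_real[OF g[OF x]] .
      ultimately show ?thesis using low[of x "m_real x"] x x0 unfolding weyl_def weyl_m_real[OF g[OF x]] by simp
    qed
    \<comment> \<open>So far to the left that a decrease at rate at least \<delta> between x and x1
      forces m(x) > K.\<close>
    define x where "x = x1 - (\<bar>K - m_real x1\<bar> + 1) / \<delta>"
    have xx1: "x < x1" using \<delta> by (simp add: x_def add_nonneg_pos)
    obtain \<xi> where \<xi>: "x < \<xi>" "\<xi> < x1" "m_real x1 - m_real x = (x1 - x) * - norm_sq {l..} (weyl (of_real \<xi>))"
      using MVT2[OF xx1, of m_real "\<lambda>x. - norm_sq {l..} (weyl (of_real x))"] der by (auto simp: x1_def)
    have "(x1 - x) * \<delta> \<le> (x1 - x) * norm_sq {l..} (weyl (of_real \<xi>))"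
      using lowm[of \<xi>] \<xi> xx1 by (intro mult_left_mono) auto
    moreover have "(x1 - x) * \<delta> = \<bar>K - m_real x1\<bar> + 1" using \<delta> by (simp add: x_def)
    ultimately have "m_real x > K" using \<xi>(3) by (simp add: abs_if split: if_splits)
    then show False using K[of x] xx1 by (simp add: x1_def)
  qed
  show ?thesis
    unfolding filterlim_at_top
  proof
    fix Z :: real
    obtain x where x: "x < x0" "m_real x > Z" using unb by blast
    show "\<forall>\<^sub>F y in at_bot. Z \<le> m_real y"
      using eventually_le_at_bot[of x] by eventually_elim (use mono x in force)
  qed
qed

section \<open>Non-negativity of the form under the Dirichlet condition\<close>

lemma pairing_weyl_real:
  assumes s: "L2_on {l..} (U z a b)" and x: "of_real x \<in> weyl_domain"
  shows "(z - of_real x) * pairing l (U z a b) (weyl (of_real x)) = - b - a * weyl_m (of_real x)"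
  using L2_solution_Wronskian[OF s weyl_L2_on[OF x, unfolded weyl_def]] by (simp add: weyl_def)

text \<open>With $s_x = (u_x - u_{x_1})/(m(x) - m(x_1))$, which has Cauchy data $(0,1)$, the function \<open>W - \<delta> s_x\<close> lies
  in the minimal domain; as $x \to -\infty$ the contribution of $s_x$ to its form vanishes or is negative.\<close>

lemma dirichlet_form_nonneg:
  assumes u: "L2_on {l..} (U z a b)" and v: "L2_on {l..} (U w a' b')" and aa: "a + a' = 0"
  shows "0 \<le> Re (pairing l (\<lambda>t. z * U z a b t + w * U w a' b' t) (\<lambda>t. cnj (U z a b t + U w a' b' t)))"
proof -
  obtain x0 where x0: "x0 < 0" and g: "\<And>x. x < x0 \<Longrightarrow> of_real x \<in> weyl_domain" using weyl_domain_far_left by blast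
  define x1 where "x1 = x0 - 1"
  have g1: "of_real x1 \<in> weyl_domain" by (rule g) (simp add: x1_def)
  define W where "W = (\<lambda>t. U z a b t + U w a' b' t)"
  define fW where "fW = (\<lambda>t. z * U z a b t + w * U w a' b' t)"
  define W' where "W' = (\<lambda>t. V z a b t + V w a' b' t)"
  define \<delta> where "\<delta> = b + b'"
  have dW: "max_domain W W' fW" unfolding W_def fW_def W'_def by (intro max_domain_add max_domain_U u v)
  have Wl: "W l = 0" "W' l = \<delta>" using aa by (simp_all add: W_def W'_def \<delta>_def)
  have sW: "L2_on {l..} W" "L2_on {l..} fW" using dW by (auto simp: max_domain_def)
  define \<Delta> where "\<Delta> = (\<lambda>x. m_real x - m_real x1)"
  have \<Delta>_top: "filterlim \<Delta> at_top at_bot"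
    unfolding \<Delta>_def diff_conv_add_uminus by (subst add.commute) (rule filterlim_tendsto_add_at_top[OF tendsto_const m_real_at_bot])
  have \<Delta>_inv: "((\<lambda>x. inverse (\<Delta> x)) \<longlongrightarrow> 0) at_bot"
    by (rule tendsto_inverse_0_at_top[OF \<Delta>_top])
  define ux where "ux = (\<lambda>x. weyl (of_real x))"
  define c where "c = (\<lambda>x. complex_of_real (inverse (\<Delta> x)))"
  define s where "s = (\<lambda>x t. c x * (ux x t - ux x1 t))"
  define fs where "fs = (\<lambda>x t. c x * (of_real x * ux x t - of_real x1 * ux x1 t))"
  define P where "P = (\<lambda>x. pairing l fW (\<lambda>t. cnj (s x t)))"
  \<comment> \<open>Upper bound for the form of \<open>s x\<close>: the negative terms with the
    squared norms of u_x and u_x1 are dropped, and \<open>weyl_m_diff\<close> evaluates the cross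
    term.\<close>
  define R where "R = (\<lambda>x. (x + x1) / (x - x1) * inverse (\<Delta> x))"
  have key: "\<forall>\<^sub>F x in at_bot. 2 * Re (cnj \<delta> * P x) - (cmod \<delta>)\<^sup>2 * R x \<le> Re (pairing l fW (\<lambda>t. cnj (W t)))"
    using eventually_gt_at_bot[of x1] \<Delta>_top[unfolded filterlim_at_top_dense, rule_format, of 0]
  proof eventually_elim
    case (elim x)
    then have x: "x < x0" and xx1: "x < x1" by (simp_all add: x1_def)
    note gx = g[OF x]
    have sx: "L2_on {l..} (ux x)" "L2_on {l..} (ux x1)" unfolding ux_def by (rule weyl_L2_on[OF gx] weyl_L2_on[OF g1])+
    have m\<Delta>: "weyl_m (of_real x) - weyl_m (of_real x1) = of_real (\<Delta> x)"
      unfolding \<Delta>_def of_real_diff weyl_m_real[OF gx] weyl_m_real[OF g1] ..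
    have cm: "c x * (weyl_m (of_real x) - weyl_m (of_real x1)) = 1"
      unfolding c_def m\<Delta> of_real_mult[symmetric] using elim(2) by simp
    define s' where "s' = (\<lambda>t. c x * (V (of_real x) (-1) (weyl_m (of_real x)) t - V (of_real x1) (-1) (weyl_m (of_real x1)) t))"
    have ds: "max_domain (s x) s' (fs x)"
      unfolding s_def s'_def fs_def ux_def weyl_def
      by (intro max_domain_scale max_domain_diff max_domain_U sx[unfolded ux_def weyl_def])
    have sl: "s x l = 0" "s' l = 1" using cm by (simp_all add: s_def s'_def ux_def weyl_def)
    have ss: "L2_on {l..} (s x)" "L2_on {l..} (fs x)" using ds by (auto simp: max_domain_def)
    have dm: "min_domain (\<lambda>t. W t - \<delta> * s x t) (\<lambda>t. fW t - \<delta> * fs x t)"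
      by (rule min_domainI[OF max_domain_diff[OF dW max_domain_scale[OF ds]]]) (simp_all add: Wl sl)
    \<comment> \<open>Both functions vanish at l, so Green's formula has no boundary terms here
      although their derivatives at l need not vanish.\<close>
    have sym: "pairing l (fs x) (\<lambda>t. cnj (W t)) = cnj (P x)"
      using Green_at_infinity[OF ds max_domain_cnj[OF dW]] unfolding sl Wl P_def cnj_pairing by (simp add: pairing_commute)
    have Px: "pairing l fW (\<lambda>t. cnj (s x t)) = P x" by (simp add: P_def)
    have "pairing l (\<lambda>t. fW t - \<delta> * fs x t) (\<lambda>t. cnj (W t - \<delta> * s x t)) =
      pairing l fW (\<lambda>t. cnj (W t)) - cnj \<delta> * P x - \<delta> * cnj (P x) + \<delta> * cnj \<delta> * pairing l (fs x) (\<lambda>t. cnj (s x t))"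
      by (simp add: pairing_diff_left pairing_diff_right sW ss L2_on_cnj L2_on_scale L2_on_diff pairing_scale_left pairing_scale_right sym Px algebra_simps)
    then have 1: "0 \<le> Re (pairing l fW (\<lambda>t. cnj (W t)) - cnj \<delta> * P x - \<delta> * cnj (P x) + \<delta> * cnj \<delta> * pairing l (fs x) (\<lambda>t. cnj (s x t)))"
      using min_domain_form(2)[OF dm] by (simp only:)
    have cu: "pairing l f (\<lambda>t. cnj (ux x t)) = pairing l f (ux x)" "pairing l f (\<lambda>t. cnj (ux x1 t)) = pairing l f (ux x1)" for f
      unfolding ux_def by (rule pairing_cnj_weyl_real[OF gx] pairing_cnj_weyl_real[OF g1])+
    have ns: "pairing l (ux x) (ux x) = of_real (norm_sq {l..} (ux x))" "pairing l (ux x1) (ux x1) = of_real (norm_sq {l..} (ux x1))"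
      unfolding ux_def by (rule pairing_weyl_real_self[OF gx] pairing_weyl_real_self[OF g1])+
    have "pairing l (fs x) (\<lambda>t. cnj (s x t)) = c x * cnj (c x) *
      (x * norm_sq {l..} (ux x) + x1 * norm_sq {l..} (ux x1) - (x + x1) * pairing l (ux x) (ux x1))"
      unfolding fs_def s_def
      by (simp add: pairing_diff_left pairing_diff_right sx L2_on_cnj L2_on_scale L2_on_diff pairing_scale_left pairing_scale_right cu ns
          pairing_commute[of l "ux x1" "ux x"]) (simp add: algebra_simps)
    also have "pairing l (ux x) (ux x1) = of_real (- \<Delta> x / (x - x1))"
    proof -
      have "(of_real x - of_real x1) * pairing l (ux x) (ux x1) = of_real (- \<Delta> x)"
        unfolding ux_def weyl_m_diff[OF gx g1] using m\<Delta> by (simp add: algebra_simps)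
      then show ?thesis using xx1 by (simp add: field_simps)
    qed
    finally have fs: "pairing l (fs x) (\<lambda>t. cnj (s x t)) = of_real ((inverse (\<Delta> x))\<^sup>2 *
      (x * norm_sq {l..} (ux x) + x1 * norm_sq {l..} (ux x1) + (x + x1) * (\<Delta> x / (x - x1))))"
      by (simp add: c_def power2_eq_square)
    have "x * norm_sq {l..} (ux x) \<le> 0" "x1 * norm_sq {l..} (ux x1) \<le> 0"
      using x xx1 x0 by (auto simp: x1_def norm_sq_nonneg mult_nonpos_nonneg)
    then have "(inverse (\<Delta> x))\<^sup>2 * (x * norm_sq {l..} (ux x) + x1 * norm_sq {l..} (ux x1) + (x + x1) * (\<Delta> x / (x - x1)))
      \<le> (inverse (\<Delta> x))\<^sup>2 * ((x + x1) * (\<Delta> x / (x - x1)))"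
      by (intro mult_left_mono) auto
    also have "\<dots> = R x"
    proof -
      have "inverse (\<Delta> x) * \<Delta> x = 1" using elim(2) by simp
      then have 1: "(inverse (\<Delta> x))\<^sup>2 * \<Delta> x = inverse (\<Delta> x)" by (simp only: power2_eq_square mult.assoc mult_1_right)
      have "(inverse (\<Delta> x))\<^sup>2 * ((x + x1) * (\<Delta> x / (x - x1))) = ((inverse (\<Delta> x))\<^sup>2 * \<Delta> x) * ((x + x1) / (x - x1))"
        by simp
      also have "\<dots> = R x" unfolding 1 R_def by (rule mult.commute)
      finally show ?thesis .
    qed
    finally have R: "(inverse (\<Delta> x))\<^sup>2 * (x * norm_sq {l..} (ux x) + x1 * norm_sq {l..} (ux x1) + (x + x1) * (\<Delta> x / (x - x1))) \<le> R x" .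
    have "\<delta> * cnj \<delta> * pairing l (fs x) (\<lambda>t. cnj (s x t)) = of_real ((cmod \<delta>)\<^sup>2 * ((inverse (\<Delta> x))\<^sup>2 *
      (x * norm_sq {l..} (ux x) + x1 * norm_sq {l..} (ux x1) + (x + x1) * (\<Delta> x / (x - x1)))))"
      unfolding fs complex_norm_square[symmetric] of_real_mult ..
    then have 2: "Re (\<delta> * cnj \<delta> * pairing l (fs x) (\<lambda>t. cnj (s x t))) \<le> (cmod \<delta>)\<^sup>2 * R x"
      using mult_left_mono[OF R zero_le_power2[of "cmod \<delta>"]] by (simp only: Re_complex_of_real)
    have "Re (\<delta> * cnj (P x)) = Re (cnj \<delta> * P x)" by simp
    then show ?case using 1 2 unfolding minus_complex.sel plus_complex.sel by linarith
  qed
  have inv_lim: "((\<lambda>x. inverse (r + - x)) \<longlongrightarrow> 0) at_bot" for r :: real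
    by (rule tendsto_inverse_0_at_top[OF filterlim_tendsto_add_at_top[OF tendsto_const filterlim_uminus_at_top_at_bot]])
  have Plim: "(P \<longlongrightarrow> 0) at_bot"
  proof -
    \<comment> \<open>c(x) m(x) tends to 1, and the pairing of a solution with u_x is (-b - a m(x))
      / (z - x), so the denominator drives the product to 0. This explicit pairing is the reason for
      taking W to be a sum of solutions.\<close>
    have lim: "((\<lambda>x. c x * pairing l (U z a b) (ux x)) \<longlongrightarrow> 0) at_bot" if su: "L2_on {l..} (U z a b)" for z a b
    proof -
      have "((\<lambda>x. complex_of_real (m_real x1 * inverse (\<Delta> x) + 1)) \<longlongrightarrow> of_real (m_real x1 * 0 + 1)) at_bot"
        by (intro tendsto_intros \<Delta>_inv)
      moreover have "\<forall>\<^sub>F x in at_bot. of_real (m_real x1 * inverse (\<Delta> x) + 1) = c x * of_real (m_real x)"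
        using \<Delta>_top[unfolded filterlim_at_top_dense, rule_format, of 0]
      proof eventually_elim
        case (elim x)
        have "m_real x1 * inverse (\<Delta> x) + 1 = inverse (\<Delta> x) * m_real x"
          using elim by (simp add: field_simps) (simp add: \<Delta>_def)
        then show ?case unfolding c_def of_real_mult[symmetric] by simp
      qed
      ultimately have "((\<lambda>x. c x * of_real (m_real x)) \<longlongrightarrow> of_real (m_real x1 * 0 + 1)) at_bot"
        by (rule Lim_transform_eventually)
      then have cm: "((\<lambda>x. c x * of_real (m_real x)) \<longlongrightarrow> 1) at_bot" by simp
      have c0: "(c \<longlongrightarrow> 0) at_bot" using tendsto_of_real[OF \<Delta>_inv, where 'a=complex] by (simp add: c_def[abs_def])
      have iz: "((\<lambda>x. inverse (z - of_real x)) \<longlongrightarrow> 0) at_bot"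
      proof (rule Lim_null_comparison[OF _ inv_lim[of "Re z"]], use eventually_gt_at_bot[of "Re z"] in eventually_elim)
        case (elim x)
        have "\<bar>Re z + - x\<bar> \<le> cmod (z - of_real x)" using abs_Re_le_cmod[of "z - of_real x"] by simp
        then show ?case unfolding norm_inverse using elim by (intro le_imp_inverse_le) auto
      qed
      have "((\<lambda>x. (- b * c x - a * (c x * of_real (m_real x))) * inverse (z - of_real x)) \<longlongrightarrow> (- b * 0 - a * 1) * 0) at_bot"
        by (intro tendsto_intros cm c0 iz)
      then have "((\<lambda>x. (- b * c x - a * (c x * of_real (m_real x))) * inverse (z - of_real x)) \<longlongrightarrow> 0) at_bot" by simp
      moreover have "\<forall>\<^sub>F x in at_bot. (- b * c x - a * (c x * of_real (m_real x))) * inverse (z - of_real x) = c x * pairing l (U z a b) (ux x)"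
        using eventually_gt_at_bot[of x0] eventually_gt_at_bot[of "Re z"]
      proof eventually_elim
        case (elim x)
        have ne: "z - of_real x \<noteq> 0" using elim(2) by (auto simp: complex_eq_iff)
        have "(z - of_real x) * pairing l (U z a b) (ux x) = - b - a * of_real (m_real x)"
          using pairing_weyl_real[OF su g[OF elim(1)]] unfolding ux_def weyl_m_real[OF g[OF elim(1)]] .
        then have "pairing l (U z a b) (ux x) = (- b - a * of_real (m_real x)) * inverse (z - of_real x)"
          using ne by (simp add: field_simps)
        then show ?case by (simp only:) (simp add: algebra_simps)
      qed
      ultimately show ?thesis by (rule Lim_transform_eventually)
    qed
    have c0: "(c \<longlongrightarrow> 0) at_bot" using tendsto_of_real[OF \<Delta>_inv, where 'a=complex] by (simp add: c_def[abs_def])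
    have "((\<lambda>x. (z * (c x * pairing l (U z a b) (ux x)) + w * (c x * pairing l (U w a' b') (ux x))) - c x * pairing l fW (ux x1)) \<longlongrightarrow>
      (z * 0 + w * 0) - 0 * pairing l fW (ux x1)) at_bot"
      by (intro tendsto_intros lim u v c0)
    moreover have "\<forall>\<^sub>F x in at_bot. (z * (c x * pairing l (U z a b) (ux x)) + w * (c x * pairing l (U w a' b') (ux x))) - c x * pairing l fW (ux x1) = P x"
      using eventually_gt_at_bot[of x0]
    proof eventually_elim
      case (elim x)
      note gx = g[OF elim]
      have sx: "L2_on {l..} (ux x)" "L2_on {l..} (ux x1)" unfolding ux_def by (rule weyl_L2_on[OF gx] weyl_L2_on[OF g1])+
      have "P x = c x * (pairing l fW (ux x) - pairing l fW (ux x1))"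
      proof -
        have cu: "pairing l f (\<lambda>t. cnj (ux x t)) = pairing l f (ux x)" "pairing l f (\<lambda>t. cnj (ux x1 t)) = pairing l f (ux x1)" for f
          unfolding ux_def by (rule pairing_cnj_weyl_real[OF gx] pairing_cnj_weyl_real[OF g1])+
        have "cnj (c x) = c x" by (simp add: c_def)
        then show ?thesis unfolding P_def s_def
          by (simp add: pairing_diff_right sx sW L2_on_cnj L2_on_scale L2_on_diff pairing_scale_right cu)
      qed
      also have "pairing l fW (ux x) = z * pairing l (U z a b) (ux x) + w * pairing l (U w a' b') (ux x)"
        unfolding fW_def by (simp add: pairing_add_left sx u v L2_on_scale pairing_scale_left)
      finally show ?case by (simp add: algebra_simps)
    qed
    ultimately have "(P \<longlongrightarrow> (z * 0 + w * 0) - 0 * pairing l fW (ux x1)) at_bot"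
      by (rule Lim_transform_eventually)
    then show ?thesis by simp
  qed
  have Rlim: "(R \<longlongrightarrow> 0) at_bot"
  proof -
    have "((\<lambda>x. 1 - 2 * x1 * inverse (x1 + - x)) \<longlongrightarrow> 1 - 2 * x1 * 0) at_bot"
      by (intro tendsto_intros inv_lim)
    moreover have "\<forall>\<^sub>F x in at_bot. 1 - 2 * x1 * inverse (x1 + - x) = (x + x1) / (x - x1)"
      using eventually_gt_at_bot[of x1] by eventually_elim (simp add: field_simps)
    ultimately have "((\<lambda>x. (x + x1) / (x - x1)) \<longlongrightarrow> 1 - 2 * x1 * 0) at_bot"
      by (rule Lim_transform_eventually)
    then have "((\<lambda>x. (x + x1) / (x - x1)) \<longlongrightarrow> 1) at_bot" by simp
    then have "((\<lambda>x. (x + x1) / (x - x1) * inverse (\<Delta> x)) \<longlongrightarrow> 1 * 0) at_bot"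
      by (intro tendsto_intros \<Delta>_inv)
    then show ?thesis by (simp add: R_def[abs_def])
  qed
  have "((\<lambda>x. 2 * Re (cnj \<delta> * P x) - (cmod \<delta>)\<^sup>2 * R x) \<longlongrightarrow> 2 * Re (cnj \<delta> * 0) - (cmod \<delta>)\<^sup>2 * 0) at_bot"
    by (intro tendsto_intros Plim Rlim)
  then have "((\<lambda>x. 2 * Re (cnj \<delta> * P x) - (cmod \<delta>)\<^sup>2 * R x) \<longlongrightarrow> 0) at_bot" by simp
  from tendsto_upperbound[OF this key] have "0 \<le> Re (pairing l fW (\<lambda>t. cnj (W t)))" by simp
  then show ?thesis by (simp add: fW_def W_def)
qed

text \<open>A Dirichlet eigenfunction u at z < 0 would have the form value z ||u||^2 < 0. The zero
  solution fills the second place in \<open>dirichlet_form_nonneg\<close>.\<close>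

lemma not_dirichlet: "z \<in> resolvent \<Longrightarrow> \<not> dirichlet z"
proof
  assume z: "z \<in> resolvent" and d: "dirichlet z"
  have Im: "Im z = 0" using not_dirichlet_nonreal d by blast
  then have neg: "Re z < 0" using z by (auto simp: resolvent_def)
  have s: "L2_on {l..} (U z 0 1)" using d by (simp add: dirichlet_def)
  have s0: "L2_on {l..} (U z 0 0)" using L2_on_U_scale[OF s, of 0] by simp
  have "0 \<le> Re (pairing l (\<lambda>t. z * U z 0 1 t) (\<lambda>t. cnj (U z 0 1 t)))"
    using dirichlet_form_nonneg[OF s s0] by (simp add: U_def)
  also have "pairing l (\<lambda>t. z * U z 0 1 t) (\<lambda>t. cnj (U z 0 1 t)) = z * norm_sq {l..} (U z 0 1)"
    by (simp add: pairing_scale_left pairing_cnj_self)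
  finally have "0 \<le> Re z * norm_sq {l..} (U z 0 1)" by simp
  moreover have "norm_sq {l..} (U z 0 1) > 0" by (rule norm_sq_U_pos[OF s]) simp
  ultimately show False using neg by (simp add: zero_le_mult_iff)
qed

lemma weyl_domain_eq: "weyl_domain = resolvent"
  using not_dirichlet by (auto simp: weyl_domain_def)

lemma weyl_m_holomorphic: "weyl_m holomorphic_on resolvent"
proof (rule holomorphic_onI)
  fix z assume z: "z \<in> resolvent"
  have "\<forall>\<^sub>F w in at z. w \<in> weyl_domain"
    unfolding weyl_domain_eq by (rule eventually_at_in_open'[OF open_resolvent z])
  from weyl_m_has_derivative[OF z[folded weyl_domain_eq] this]
  show "weyl_m field_differentiable at z within resolvent"
    using field_differentiable_at_within field_differentiable_def by blast
qed

lemma negative_weyl_domain: "x < 0 \<Longrightarrow> of_real x \<in> weyl_domain"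
  by (simp add: weyl_domain_eq resolvent_def)

lemma m_real_strict_decreasing:
  assumes "x < y" "y < 0"
  shows "m_real y < m_real x"
proof (rule DERIV_neg_imp_decreasing[OF assms(1)])
  fix u assume "x \<le> u" "u \<le> y"
  then have u: "u < 0" using assms by simp
  show "\<exists>d. (m_real has_real_derivative d) (at u) \<and> d < 0"
    using m_real_has_derivative[OF negative_weyl_domain[OF u] eventually_weyl_domain_left[OF u negative_weyl_domain]] weyl_norm_sq_pos[OF negative_weyl_domain[OF u]]
    by (intro exI[of _ "- norm_sq {l..} (weyl (of_real u))"]) simp
qed

lemma continuous_on_m_real: "b < 0 \<Longrightarrow> continuous_on {a..b} m_real"
  by (intro continuous_intros holomorphic_on_imp_continuous_on[OF weyl_m_holomorphic, THEN continuous_on_compose2])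
    (auto simp: resolvent_def)

text \<open>The right side is Im(z cnj(m)) / Im z. As u_z and u_x agree at l, the Dirichlet form
  applies to u_z - u_x. Its term x ||u_x||^2 <= 0 is dropped, so the norm of u_x may be unbounded as
  x increases to 0.\<close>

lemma weyl_m_Stieltjes_inequality:
  assumes z: "Im z \<noteq> 0" and M: "(m_real \<longlongrightarrow> M) (at_left 0)"
  shows "M \<le> Re (weyl_m z) - Re z * Im (weyl_m z) / Im z"
proof -
  have gz: "z \<in> weyl_domain" by (rule weyl_domain_nonreal[OF z])
  define n where "n = norm_sq {l..} (weyl z)"
  have n: "n = - Im (weyl_m z) / Im z" using Im_weyl_m[OF gz] z by (simp add: n_def)
  have ineq: "0 \<le> Re z * n + Re ((z + of_real x) * ((weyl_m z - of_real (m_real x)) / (z - of_real x)))" if x: "x < 0" for x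
  proof -
    note gx = negative_weyl_domain[OF x]
    define \<rho> where "\<rho> = (weyl_m z - of_real (m_real x)) / (z - of_real x)"
    have ne: "z - of_real x \<noteq> 0" using z by (auto simp: complex_eq_iff)
    let ?u = "weyl z" and ?v = "weyl (of_real x)"
    have su: "L2_on {l..} ?u" and sv: "L2_on {l..} ?v" by (rule weyl_L2_on[OF gz] weyl_L2_on[OF gx])+
    \<comment> \<open>The form inequality is about sums, so -u_x enters as the solution with data
      (1, -m(x)).\<close>
    have sv': "L2_on {l..} (U (of_real x) 1 (- weyl_m (of_real x)))"
      using L2_on_U_scale[OF sv[unfolded weyl_def], of "-1"] by simp
    have v': "U (of_real x) 1 (- weyl_m (of_real x)) = (\<lambda>t. - ?v t)"
      by (simp add: weyl_def U_def fun_eq_iff)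
    have "0 \<le> Re (pairing l (\<lambda>t. z * ?u t - of_real x * ?v t) (\<lambda>t. cnj (?u t) - cnj (?v t)))"
      using dirichlet_form_nonneg[OF su[unfolded weyl_def] sv'] unfolding v' by (simp flip: weyl_def)
    also have "pairing l (\<lambda>t. z * ?u t - of_real x * ?v t) (\<lambda>t. cnj (?u t) - cnj (?v t)) =
      z * n + of_real x * norm_sq {l..} ?v - z * pairing l ?u (\<lambda>t. cnj (?v t)) - of_real x * pairing l ?v (\<lambda>t. cnj (?u t))"
      by (simp add: pairing_diff_left pairing_diff_right su sv L2_on_scale L2_on_diff L2_on_cnj pairing_scale_left pairing_cnj_self n_def algebra_simps)
    also have uv: "pairing l ?u (\<lambda>t. cnj (?v t)) = - \<rho>"
    proof -
      have "(z - of_real x) * pairing l ?u ?v = - (weyl_m z - of_real (m_real x))"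
        unfolding weyl_m_diff[OF gz gx] weyl_m_real[OF gx] by simp
      then have "pairing l ?u ?v = - \<rho>" using ne by (simp add: \<rho>_def field_simps)
      then show ?thesis by (simp add: pairing_cnj_weyl_real[OF gx])
    qed
    also have "pairing l ?v (\<lambda>t. cnj (?u t)) = - cnj \<rho>"
      using arg_cong[OF uv, of cnj] unfolding cnj_pairing by (simp add: pairing_commute)
    finally have "0 \<le> Re z * n + x * norm_sq {l..} ?v + Re ((z + of_real x) * \<rho>)"
      by (simp add: algebra_simps)
    moreover have "x * norm_sq {l..} ?v \<le> 0" using x by (simp add: mult_nonpos_nonneg norm_sq_nonneg)
    ultimately show ?thesis unfolding \<rho>_def by linarith
  qed
  have "((\<lambda>x. Re z * n + Re ((z + of_real x) * ((weyl_m z - of_real (m_real x)) / (z - of_real x))))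
     \<longlongrightarrow> Re z * n + Re ((z + of_real 0) * ((weyl_m z - of_real M) / (z - of_real 0)))) (at_left 0)"
    using z by (intro tendsto_intros M) (auto simp: complex_eq_iff)
  then have "0 \<le> Re z * n + Re ((z + of_real 0) * ((weyl_m z - of_real M) / (z - of_real 0)))"
  proof (rule tendsto_lowerbound)
    show "\<forall>\<^sub>F x in at_left 0. 0 \<le> Re z * n + Re ((z + of_real x) * ((weyl_m z - of_real (m_real x)) / (z - of_real x)))"
      unfolding eventually_at_left_field using ineq by (intro exI[of _ "-1"]) auto
  qed simp
  moreover have "z \<noteq> 0" using z by auto
  ultimately have "0 \<le> Re z * n + (Re (weyl_m z) - M)" by simp
  then show ?thesis unfolding n by simp
qed

section \<open>Stieltjes functions\<close>

text \<open>The limit bounds m only weakly; passing through x / 2 and strict monotonicity makes the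
  inequality strict.\<close>

lemma m_real_gt_limit:
  assumes M: "(m_real \<longlongrightarrow> M) (at_left 0)" and x: "x < 0"
  shows "m_real x > M"
proof -
  have "M \<le> m_real (x / 2)"
  proof (rule tendsto_upperbound[OF M])
    show "\<forall>\<^sub>F y in at_left 0. m_real y \<le> m_real (x / 2)"
      unfolding eventually_at_left_field using x m_real_strict_decreasing[of "x / 2"]
      by (intro exI[of _ "x / 2"]) (auto simp: less_imp_le)
  qed simp
  also have "\<dots> < m_real x" using m_real_strict_decreasing[of x "x / 2"] x by simp
  finally show ?thesis .
qed

lemma m_real_unbounded: "\<exists>x<0. m_real x > K"
  using eventually_conj[OF m_real_at_bot[unfolded filterlim_at_top_dense, rule_format, of K] eventually_gt_at_bot[of 0]]
  by (auto dest: eventually_happens)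

lemma m_real_attains:
  assumes M: "(m_real \<longlongrightarrow> M) (at_left 0)" and k: "M < k"
  shows "\<exists>x<0. m_real x = k"
proof -
  obtain a where a: "a < 0" "m_real a > k" using m_real_unbounded by blast
  have "\<forall>\<^sub>F y in at_left 0. m_real y < k \<and> y < 0 \<and> a < y"
    by (intro eventually_conj order_tendstoD(2)[OF M k])
      (use a in \<open>auto simp: eventually_at_left_field intro: exI[of _ a]\<close>)
  then obtain b where b: "m_real b < k" "b < 0" "a < b"
    by (auto dest: eventually_happens)
  have "\<exists>x. a \<le> x \<and> x \<le> b \<and> m_real x = k"
    by (rule IVT2') (use a b continuous_on_m_real[OF b(2)] in auto)
  then obtain x where "x \<le> b" "m_real x = k" by blast
  then show ?thesis using b(2) by (intro exI[of _ x]) simp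
qed

lemma Im_weyl_m_quotient_neg: "Im z \<noteq> 0 \<Longrightarrow> Im (weyl_m z) / Im z < 0"
  using Im_weyl_m[OF weyl_domain_nonreal] weyl_norm_sq_pos[OF weyl_domain_nonreal] by simp

lemma weyl_m_nonreal: "Im z \<noteq> 0 \<Longrightarrow> weyl_m z \<noteq> of_real k"
  using Im_weyl_m_quotient_neg[of z] by auto

lemma isCont_weyl_m: "x < 0 \<Longrightarrow> isCont weyl_m (of_real x)"
  using holomorphic_on_imp_continuous_on[OF weyl_m_holomorphic] open_resolvent
  by (auto simp: continuous_on_eq_continuous_at resolvent_def)

lemma nonreal_approach:
  "(\<lambda>n. Complex x (1 / real (Suc n))) \<longlonglongrightarrow> of_real x"
  unfolding tendsto_complex_iff using LIMSEQ_inverse_real_of_nat by (simp add: divide_inverse)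

text \<open>With w = m(z) the expression in the numerator is the one of
  \<open>weyl_m_Stieltjes_inequality\<close> less k, hence at least m(-0) - k.\<close>

lemma Im_times_Moebius:
  assumes z: "Im z \<noteq> 0" and w: "w \<noteq> of_real k"
  shows "Im (z * (of_real k + of_real c / (w - of_real k))) / Im z =
    k + c * (Re w - k - Re z * Im w / Im z) / (cmod (w - of_real k))\<^sup>2"
proof -
  define N where "N = (cmod (w - of_real k))\<^sup>2"
  have N: "N \<noteq> 0" using w by (simp add: N_def)
  have "of_real c / (w - of_real k) = of_real (c / N) * cnj (w - of_real k)"
    unfolding complex_div_cnj[of "of_real c"] N_def by simp
  then have "Im (z * (of_real k + of_real c / (w - of_real k))) =
     Im (z * (of_real k + of_real (c / N) * cnj (w - of_real k)))" by (simp only:)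
  also have "\<dots> = Im z * k + c / N * (Im z * (Re w - k) - Re z * Im w)"
    by (simp add: algebra_simps diff_divide_distrib add_divide_distrib)
  also have "\<dots> = Im z * (k + c * (Re w - k - Re z * Im w / Im z) / N)"
    using z by (simp add: algebra_simps diff_divide_distrib add_divide_distrib)
  finally show ?thesis unfolding N_def[symmetric] using z by simp
qed

text \<open>If 0 <= k <= M, then m > k on the negative axis, so there is no pole, and both terms of
  \<open>Im_times_Moebius\<close> are non-negative. A value k > M is attained by m at some negative
  x, where F would have a pole. A negative k is refuted far to the left, where m is large and the
  second term small.\<close>

lemma stieltjes_Moebius_iff:
  assumes M: "(m_real \<longlongrightarrow> M) (at_left 0)"
    and V: "\<And>z. Im z \<noteq> 0 \<Longrightarrow> F z = of_real k + of_real (1 + k\<^sup>2) / (weyl_m z - of_real k)"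
  shows "stieltjes F \<longleftrightarrow> k \<le> M \<and> 0 \<le> k"
proof -
  define c where "c = 1 + k\<^sup>2"
  have c: "c > 0" by (simp add: c_def add_pos_nonneg)
  define W where "W = (\<lambda>z. of_real k + of_real c / (weyl_m z - of_real k))"
  have FW: "Im z \<noteq> 0 \<Longrightarrow> F z = W z" for z using V by (simp add: W_def c_def)
  have ImF: "Im (z * F z) / Im z = k + c * (Re (weyl_m z) - k - Re z * Im (weyl_m z) / Im z) / (cmod (weyl_m z - of_real k))\<^sup>2"
    if "Im z \<noteq> 0" for z
    unfolding FW[OF that] W_def by (rule Im_times_Moebius[OF that weyl_m_nonreal[OF that]])
  have dom: "- {z. Im z = 0 \<and> Re z \<ge> 0} = resolvent" by (auto simp: resolvent_def)
  show ?thesis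
  proof
    assume kM: "k \<le> M \<and> 0 \<le> k"
    have ne: "weyl_m z \<noteq> of_real k" if "z \<in> resolvent" for z
    proof (cases "Im z = 0")
      case True
      then have z: "z = of_real (Re z)" "Re z < 0" using that by (auto simp: resolvent_def complex_eq_iff)
      have "Re (weyl_m z) > k" using m_real_gt_limit[OF M z(2)] kM unfolding z(1)[symmetric] by simp
      then show ?thesis by auto
    qed (rule weyl_m_nonreal)
    have hW: "W holomorphic_on resolvent"
      unfolding W_def using ne by (intro holomorphic_intros weyl_m_holomorphic) auto
    show "stieltjes F"
      unfolding stieltjes_def herglotz_def dom
    proof (intro conjI allI impI exI[of _ W])
      have "W holomorphic_on {z. Im z \<noteq> 0}"
        using hW by (rule holomorphic_on_subset) (auto simp: resolvent_def)
      then show "F holomorphic_on {z. Im z \<noteq> 0}" by (rule holomorphic_transform) (simp add: FW)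
      show "F (cnj z) = cnj (F z)" if "Im z \<noteq> 0" for z
        using that by (simp add: FW W_def weyl_m_cnj(1)[OF weyl_domain_nonreal])
      show "Im (F z) \<ge> 0" if "Im z > 0" for z
      proof -
        have z: "Im z \<noteq> 0" using that by simp
        have "Im (F z) = c * - Im (weyl_m z) / (cmod (weyl_m z - of_real k))\<^sup>2"
          unfolding FW[OF z] W_def complex_div_cnj[of "of_real c"] by simp
        moreover have "- Im (weyl_m z) \<ge> 0" using Im_weyl_m_quotient_neg[OF z] that by (simp add: divide_less_0_iff)
        moreover from this have "c * - Im (weyl_m z) / (cmod (weyl_m z - of_real k))\<^sup>2 \<ge> 0"
          using c by (intro divide_nonneg_nonneg mult_nonneg_nonneg) auto
        ultimately show ?thesis by (simp only:)
      qed
      show "Im (z * F z) / Im z \<ge> 0" if "Im z \<noteq> 0" for z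
        unfolding ImF[OF that] using weyl_m_Stieltjes_inequality[OF that M] kM c
        by (intro add_nonneg_nonneg divide_nonneg_nonneg mult_nonneg_nonneg) auto
    qed (simp_all add: FW hW)
  next
    assume st: "stieltjes F"
    have "k \<le> M"
    proof (rule ccontr)
      assume "\<not> k \<le> M"
      then obtain x where x: "x < 0" "m_real x = k" using m_real_attains[OF M, of k] by auto
      obtain G where G: "G holomorphic_on resolvent" "\<And>z. Im z \<noteq> 0 \<Longrightarrow> G z = F z"
        using st unfolding stieltjes_def dom by blast
      have "isCont G (of_real x)"
        using holomorphic_on_imp_continuous_on[OF G(1)] open_resolvent x
        by (auto simp: continuous_on_eq_continuous_at resolvent_def)
      note limG = isCont_tendsto_compose[OF this nonreal_approach]
      note limm = isCont_tendsto_compose[OF isCont_weyl_m[OF x(1)] nonreal_approach]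
      \<comment> \<open>Multiplying by m - k clears the pole. The identity known off the real axis
        extends to x by continuity, where it reads 0 = c.\<close>
      have "(\<lambda>n. G (Complex x (1 / real (Suc n))) * (weyl_m (Complex x (1 / real (Suc n))) - of_real k))
        \<longlonglongrightarrow> G (of_real x) * (weyl_m (of_real x) - of_real k)"
       and lim2: "(\<lambda>n. of_real k * (weyl_m (Complex x (1 / real (Suc n))) - of_real k) + of_real c)
        \<longlonglongrightarrow> of_real k * (weyl_m (of_real x) - of_real k) + of_real c"
        by (intro tendsto_intros limG limm)+
      moreover have "G z * (weyl_m z - of_real k) = of_real k * (weyl_m z - of_real k) + of_real c"
        if "Im z \<noteq> 0" for z
        using weyl_m_nonreal[OF that, of k] by (simp add: G(2)[OF that] FW[OF that] W_def distrib_right)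
      ultimately have "(\<lambda>n. of_real k * (weyl_m (Complex x (1 / real (Suc n))) - of_real k) + of_real c)
        \<longlonglongrightarrow> G (of_real x) * (weyl_m (of_real x) - of_real k)" by simp
      from LIMSEQ_unique[OF this lim2]
      have "G (of_real x) * (weyl_m (of_real x) - of_real k) = of_real k * (weyl_m (of_real x) - of_real k) + of_real c" .
      moreover have "weyl_m (of_real x) = of_real k"
        using weyl_m_real[OF negative_weyl_domain[OF x(1)]] x(2) by simp
      ultimately show False using c by simp
    qed
    moreover have "0 \<le> k"
    proof (rule ccontr)
      assume k: "\<not> 0 \<le> k"
      \<comment> \<open>With this margin c / (m(x) - k) < -k / 2, so k + c / (m(x) - k) is
        negative.\<close>
      obtain x where x: "x < 0" "m_real x > k + 2 * c / (- k)" using m_real_unbounded by blast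
      have "2 * c / (- k) > 0" using c k by (simp add: divide_pos_neg)
      then have pos: "m_real x - k > 0" using x(2) by linarith
      let ?z = "\<lambda>n. Complex x (1 / real (Suc n))"
      have "0 \<le> k + c * (Re (weyl_m z) - k) / (cmod (weyl_m z - of_real k))\<^sup>2" if z: "Im z \<noteq> 0" "Re z < 0" for z
      proof -
        have "0 \<le> Im (z * F z) / Im z" using st z by (simp add: stieltjes_def)
        also have "\<dots> = k + c * (Re (weyl_m z) - k - Re z * Im (weyl_m z) / Im z) / (cmod (weyl_m z - of_real k))\<^sup>2" by (rule ImF[OF z(1)])
        also have "\<dots> \<le> k + c * (Re (weyl_m z) - k) / (cmod (weyl_m z - of_real k))\<^sup>2"
        proof (intro add_left_mono divide_right_mono mult_left_mono)
          have "Re z * (Im (weyl_m z) / Im z) \<ge> 0" using Im_weyl_m_quotient_neg[OF z(1)] z(2) by (intro mult_nonpos_nonpos) auto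
          then show "Re (weyl_m z) - k - Re z * Im (weyl_m z) / Im z \<le> Re (weyl_m z) - k" by simp
        qed (use c in auto)
        finally show ?thesis .
      qed
      then have "0 \<le> k + c * (Re (weyl_m (?z n)) - k) / (cmod (weyl_m (?z n) - of_real k))\<^sup>2" for n
        using x(1) by simp
      moreover have "(\<lambda>n. k + c * (Re (weyl_m (?z n)) - k) / (cmod (weyl_m (?z n) - of_real k))\<^sup>2) \<longlonglongrightarrow>
        k + c * (m_real x - k) / (cmod (weyl_m (of_real x) - of_real k))\<^sup>2"
        using pos by (intro tendsto_intros isCont_tendsto_compose[OF isCont_weyl_m[OF x(1)] nonreal_approach]) auto
      ultimately have "0 \<le> k + c * (m_real x - k) / (cmod (weyl_m (of_real x) - of_real k))\<^sup>2"
        by (intro LIMSEQ_le_const) auto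
      also have "cmod (weyl_m (of_real x) - of_real k) = m_real x - k"
      proof -
        have "weyl_m (of_real x) - of_real k = of_real (m_real x - k)"
          unfolding of_real_diff weyl_m_real[OF negative_weyl_domain[OF x(1)]] ..
        then show ?thesis using pos by (simp only: norm_of_real abs_of_pos)
      qed
      also have "c * (m_real x - k) / (m_real x - k)\<^sup>2 = c / (m_real x - k)" using pos by (simp add: power2_eq_square)
      finally have le: "- k * (m_real x - k) \<le> c" using pos by (simp add: field_simps)
      have "- k * (2 * c / (- k)) < - k * (m_real x - k)" using x(2) k by (intro mult_strict_left_mono) auto
      from less_le_trans[OF this le] show False using c k by simp
    qed
    ultimately show "k \<le> M \<and> 0 \<le> k" ..
  qed
qed

text \<open>For Re z < 0 the Stieltjes condition would force Re m(z) <= 0, as Im m / Im z is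
  negative; this fails near the points of the negative axis where m is positive.\<close>

lemma not_stieltjes_uminus_weyl_m:
  assumes F: "\<And>z. Im z \<noteq> 0 \<Longrightarrow> F z = - weyl_m z"
  shows "\<not> stieltjes F"
proof
  assume st: "stieltjes F"
  obtain x where x: "x < 0" "m_real x > 0" using m_real_unbounded by blast
  let ?z = "\<lambda>n. Complex x (1 / real (Suc n))"
  have "Re (weyl_m z) \<le> 0" if z: "Im z \<noteq> 0" "Re z < 0" for z
  proof -
    have "0 \<le> Im (z * F z) / Im z" using st z by (simp add: stieltjes_def)
    also have "\<dots> = - Re (weyl_m z) - Re z * (Im (weyl_m z) / Im z)"
      using z by (simp add: F field_simps)
    finally show ?thesis
      using mult_nonpos_nonpos[of "Re z" "Im (weyl_m z) / Im z"] Im_weyl_m_quotient_neg[OF z(1)] z(2) by linarith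
  qed
  then have "Re (weyl_m (?z n)) \<le> 0" for n using x(1) by simp
  moreover have "(\<lambda>n. Re (weyl_m (?z n))) \<longlonglongrightarrow> m_real x"
    by (intro tendsto_intros isCont_tendsto_compose[OF isCont_weyl_m[OF x(1)] nonreal_approach])
  ultimately have "m_real x \<le> 0" by (intro LIMSEQ_le_const2) auto
  then show False using x by simp
qed

end

text \<open>Below pi/2 the cotangent k is positive, and k <= M means 0 < 1/M <= 1/k. At pi/2 both
  sides mean M >= 0, the convention 1/0 = oo covering M = 0. Beyond pi/2 cotangent and tangent are
  negative and both sides fail.\<close>

lemma cot_condition_iff:
  assumes a: "0 < \<alpha>" "\<alpha> < pi"
  shows "cos \<alpha> / sin \<alpha> \<le> M \<and> 0 \<le> cos \<alpha> / sin \<alpha> \<longleftrightarrow> 0 < inv_ext M \<and> inv_ext M \<le> tan_ext \<alpha>"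
proof -
  have s: "sin \<alpha> > 0" using a by (rule sin_gt_zero)
  consider "\<alpha> < pi / 2" | "\<alpha> = pi / 2" | "\<alpha> > pi / 2" by linarith
  then show ?thesis
  proof cases
    case 1
    then have c: "cos \<alpha> > 0" using a by (intro cos_gt_zero_pi) auto
    then have k: "cos \<alpha> / sin \<alpha> > 0" using s by simp
    have t: "tan_ext \<alpha> = ereal (1 / (cos \<alpha> / sin \<alpha>))" using 1 by (simp add: tan_ext_def tan_def)
    show ?thesis
    proof (cases "M > 0")
      case True
      then have "1 / M \<le> 1 / (cos \<alpha> / sin \<alpha>) \<longleftrightarrow> cos \<alpha> / sin \<alpha> \<le> M"
        using k s c by (simp add: field_simps)
      then show ?thesis using True k unfolding t by (simp add: inv_ext_def del: divide_divide_eq_right)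
    qed (use k in \<open>auto simp: inv_ext_def t\<close>)
  next
    case 2
    have k: "cos \<alpha> / sin \<alpha> = 0" unfolding 2 by simp
    have t: "tan_ext \<alpha> = \<infinity>" using 2 by (simp add: tan_ext_def)
    show ?thesis unfolding k t by (auto simp: inv_ext_def)
  next
    case 3
    then have "cos \<alpha> < 0" using a cos_gt_zero_pi[of "pi - \<alpha>"] by simp
    then have k: "cos \<alpha> / sin \<alpha> < 0" "tan \<alpha> < 0" using s by (simp_all add: divide_neg_pos divide_pos_neg tan_def)
    have t: "tan_ext \<alpha> = ereal (tan \<alpha>)" using 3 by (simp add: tan_ext_def)
    have "\<not> (0 < inv_ext M \<and> inv_ext M \<le> tan_ext \<alpha>)"
    proof
      assume "0 < inv_ext M \<and> inv_ext M \<le> tan_ext \<alpha>"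
      then have "0 < ereal (tan \<alpha>)" unfolding t by (elim conjE) (rule less_le_trans)
      then show False using k(2) by simp
    qed
    then show ?thesis using k(1) by auto
  qed
qed

theorem theorem14:
  fixes q :: "real \<Rightarrow> real" and l :: real and M :: real
  assumes "l \<ge> 0"
    and "loc_summable l q"
    and "deficiency_one q l \<i>" and "deficiency_one q l (- \<i>)"
    and "min_op_nonneg q l"
    and "((\<lambda>x. m_inf q l (complex_of_real x)) \<longlongrightarrow> complex_of_real M) (at_left 0)"
  shows "(stieltjes (\<lambda>z. 1 / m_inf q l z) \<longleftrightarrow> M \<ge> 0)
     \<and> \<not> stieltjes (\<lambda>z. - m_inf q l z)
     \<and> (\<forall>\<alpha>\<in>{0<..pi}. stieltjes (\<lambda>z. - m_alpha q l \<alpha> z) \<longleftrightarrow>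
           (0 < inv_ext M \<and> inv_ext M \<le> tan_ext \<alpha>))"
proof -
  interpret nonneg_schroedinger q l
    by unfold_locales (use assms in auto)
  have M: "(m_real \<longlongrightarrow> M) (at_left 0)"
    using tendsto_Re[OF assms(6)] by (simp add: m_inf_eq_weyl_m)
  \<comment> \<open>For k = 0 the expression k + (1 + k^2) / (m - k) is 1/m.\<close>
  have "stieltjes (\<lambda>z. 1 / m_inf q l z) \<longleftrightarrow> 0 \<le> M \<and> (0::real) \<le> 0"
    by (rule stieltjes_Moebius_iff[OF M]) (simp add: m_inf_eq_weyl_m)
  moreover have "\<not> stieltjes (\<lambda>z. - m_inf q l z)"
    by (rule not_stieltjes_uminus_weyl_m) (simp add: m_inf_eq_weyl_m)
  moreover have "stieltjes (\<lambda>z. - m_alpha q l \<alpha> z) \<longleftrightarrow> (0 < inv_ext M \<and> inv_ext M \<le> tan_ext \<alpha>)"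
    if \<alpha>: "\<alpha> \<in> {0<..pi}" for \<alpha>
  proof (cases "\<alpha> = pi")
    case True
    \<comment> \<open>At \<alpha> = pi the function \<open>m_alpha\<close> is m itself, and tan pi =
      0 makes the condition on \<open>inv_ext M\<close> impossible as well.\<close>
    have "\<not> stieltjes (\<lambda>z. - m_alpha q l \<alpha> z)"
      by (rule not_stieltjes_uminus_weyl_m) (simp add: m_inf_eq_weyl_m m_alpha_def True)
    then show ?thesis by (auto simp: True tan_ext_def zero_ereal_def[symmetric])
  next
    case False
    then have a: "0 < \<alpha>" "\<alpha> < pi" using \<alpha> by auto
    have s: "sin \<alpha> > 0" using a by (rule sin_gt_zero)
    \<comment> \<open>Dividing numerator and denominator by sin \<alpha> turns -m_alpha into (1 + k
      m) / (m - k), which is k + (1 + k^2) / (m - k).\<close>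
    define k where "k = cos \<alpha> / sin \<alpha>"
    have cos: "cos \<alpha> = k * sin \<alpha>" using s by (simp add: k_def)
    have "stieltjes (\<lambda>z. - m_alpha q l \<alpha> z) \<longleftrightarrow> k \<le> M \<and> 0 \<le> k"
    proof (rule stieltjes_Moebius_iff[OF M])
      fix z :: complex assume "Im z \<noteq> 0"
      then have ne: "weyl_m z - of_real k \<noteq> 0" using weyl_m_nonreal by simp
      have "- m_alpha q l \<alpha> z = - (of_real (sin \<alpha>) * (1 + weyl_m z * of_real k)) / (of_real (sin \<alpha>) * (of_real k - weyl_m z))"
        unfolding m_alpha_def m_inf_eq_weyl_m cos minus_divide_left[symmetric] by (simp add: algebra_simps)
      also have "\<dots> = (1 + weyl_m z * of_real k) / (weyl_m z - of_real k)"
        using s ne by (simp add: divide_simps) (simp add: algebra_simps)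
      also have "\<dots> = of_real k + of_real (1 + k\<^sup>2) / (weyl_m z - of_real k)"
        using ne by (simp add: divide_simps) (simp add: algebra_simps power2_eq_square)
      finally show "- m_alpha q l \<alpha> z = of_real k + of_real (1 + k\<^sup>2) / (weyl_m z - of_real k)" .
    qed
    then show ?thesis using cot_condition_iff[OF a, of M] by (simp add: k_def)
  qed
  ultimately show ?thesis by simp
qed

end
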